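(* Let $2\le d<\infty$ and let $L_1\le L_2\le\dots\le L_d$ be positive integers such that the greatest common divisor of $L_1,\dots,L_d$ is $1$. Let $\sigma$ be the one-parameter automorphism group of the Cuntz algebra $\mathcal{O}_d$ with $\sigma_t(s_j)=e^{itL_j}s_j$, and let $\mathfrak{A}_L$ be its fixed-point algebra. Then $\mathfrak{A}_L$ is a simple AF-algebra with a unique trace state, defined as follows. Let $\beta$ be the positive real number such that $\sum_{i=1}^d e^{-\beta L_i}=1$, and put $p_i=e^{-\beta L_i}$. Then the unique trace state is the restriction to $\mathfrak{A}_L$ of the state $\omega$ defined on $\mathcal{O}_d$ by $$\omega(s_\alpha s_\gamma^* )=\delta_{\alpha\gamma}p^\alpha,$$ where $p^\alpha=p_{\alpha_1}p_{\alpha_2}\cdots p_{\alpha_k}$ for $\alpha=(\alpha_1\dots\alpha_k)$.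
   Context: $\mathcal{O}_d$ is the universal unital $C^*$-algebra generated by $s_1,\dots,s_d$ with $s_i^*s_j=\delta_{ij}1$, $\sum_i s_is_i^*=1$. For a finite multi-index $\alpha=(\alpha_1\dots\alpha_k)$ with entries in $\{1,\dots,d\}$ (possibly empty), $s_\alpha=s_{\alpha_1}\cdots s_{\alpha_k}$; the elements $s_\alpha s_\gamma^*$ span a dense subspace of $\mathcal{O}_d$. An AF-algebra is a $C^*$-algebra that is the closure of the union of an increasing sequence of finite-dimensional $*$-subalgebras. A trace state is a state $\tau$ with $\tau(xy)=\tau(yx)$. *)

theory Defs
  imports
    "HOL-Analysis.Analysis"
    "HOL-Algebra.Ideal"
    "HOL-Algebra.Module"
    "HOL-Algebra.Algebraic_Closure_Type"
begin

section \<open>Unital C*-algebras\<close>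

record 'a cstar_alg = "(complex, 'a) module" +
  star :: "'a \<Rightarrow> 'a"
  nrm :: "'a \<Rightarrow> real"

text \<open>
  The operations of a structure are meaningful on its carrier only, whereas
  \<^locale>\<open>Metric_space\<close> requires symmetry and nonnegativity everywhere; hence the guard.
\<close>

definition cstar_dist :: "'a cstar_alg \<Rightarrow> 'a \<Rightarrow> 'a \<Rightarrow> real" where
  "cstar_dist A x y =
     (if x \<in> carrier A \<and> y \<in> carrier A then nrm A (x \<ominus>\<^bsub>A\<^esub> y) else 0)"

definition cstar_topology :: "'a cstar_alg \<Rightarrow> 'a topology" where
  "cstar_topology A = Metric_space.mtopology (carrier A) (cstar_dist A)"

text \<open>The zero algebra is allowed; it is excluded explicitly where necessary.\<close>

locale cstar_algebra =
  ring A + scalars: Module.module "ring_of_type_algebra :: complex ring" A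
  for A :: "'a cstar_alg" (structure) +
  assumes smult_mult_left:
      "\<lbrakk>x \<in> carrier A; y \<in> carrier A\<rbrakk> \<Longrightarrow> (c \<odot>\<^bsub>A\<^esub> x) \<otimes>\<^bsub>A\<^esub> y = c \<odot>\<^bsub>A\<^esub> (x \<otimes>\<^bsub>A\<^esub> y)"
    and smult_mult_right:
      "\<lbrakk>x \<in> carrier A; y \<in> carrier A\<rbrakk> \<Longrightarrow> x \<otimes>\<^bsub>A\<^esub> (c \<odot>\<^bsub>A\<^esub> y) = c \<odot>\<^bsub>A\<^esub> (x \<otimes>\<^bsub>A\<^esub> y)"
    and star_closed: "x \<in> carrier A \<Longrightarrow> star A x \<in> carrier A"
    and star_star: "x \<in> carrier A \<Longrightarrow> star A (star A x) = x"
    and star_add: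
      "\<lbrakk>x \<in> carrier A; y \<in> carrier A\<rbrakk> \<Longrightarrow> star A (x \<oplus>\<^bsub>A\<^esub> y) = star A x \<oplus>\<^bsub>A\<^esub> star A y"
    and star_smult: "x \<in> carrier A \<Longrightarrow> star A (c \<odot>\<^bsub>A\<^esub> x) = cnj c \<odot>\<^bsub>A\<^esub> star A x"
    and star_mult:
      "\<lbrakk>x \<in> carrier A; y \<in> carrier A\<rbrakk> \<Longrightarrow> star A (x \<otimes>\<^bsub>A\<^esub> y) = star A y \<otimes>\<^bsub>A\<^esub> star A x"
    and nrm_nonneg: "x \<in> carrier A \<Longrightarrow> 0 \<le> nrm A x"
    and nrm_eq_0_iff: "x \<in> carrier A \<Longrightarrow> nrm A x = 0 \<longleftrightarrow> x = \<zero>\<^bsub>A\<^esub>"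
    and nrm_triangle:
      "\<lbrakk>x \<in> carrier A; y \<in> carrier A\<rbrakk> \<Longrightarrow> nrm A (x \<oplus>\<^bsub>A\<^esub> y) \<le> nrm A x + nrm A y"
    and nrm_smult: "x \<in> carrier A \<Longrightarrow> nrm A (c \<odot>\<^bsub>A\<^esub> x) = cmod c * nrm A x"
    and nrm_mult:
      "\<lbrakk>x \<in> carrier A; y \<in> carrier A\<rbrakk> \<Longrightarrow> nrm A (x \<otimes>\<^bsub>A\<^esub> y) \<le> nrm A x * nrm A y"
    and cstar_identity: "x \<in> carrier A \<Longrightarrow> nrm A (star A x \<otimes>\<^bsub>A\<^esub> x) = (nrm A x)\<^sup>2"
    and complete: "Metric_space.mcomplete (carrier A) (cstar_dist A)"

definition star_subalgebra :: "'a set \<Rightarrow> 'a cstar_alg \<Rightarrow> bool" where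
  "star_subalgebra B A \<longleftrightarrow>
     B \<subseteq> carrier A \<and> \<zero>\<^bsub>A\<^esub> \<in> B \<and>
     (\<forall>x\<in>B. \<forall>y\<in>B. x \<oplus>\<^bsub>A\<^esub> y \<in> B \<and> x \<otimes>\<^bsub>A\<^esub> y \<in> B) \<and>
     (\<forall>c. \<forall>x\<in>B. c \<odot>\<^bsub>A\<^esub> x \<in> B) \<and>
     (\<forall>x\<in>B. star A x \<in> B)"

definition finite_dimensional :: "'a cstar_alg \<Rightarrow> 'a set \<Rightarrow> bool" where
  "finite_dimensional A F \<longleftrightarrow>
     (\<exists>B. finite B \<and> B \<subseteq> F \<and> F \<subseteq> {(\<Oplus>\<^bsub>A\<^esub>b\<in>B. c b \<odot>\<^bsub>A\<^esub> b) |c. True})"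

definition unital_star_hom :: "'a cstar_alg \<Rightarrow> 'b cstar_alg \<Rightarrow> ('a \<Rightarrow> 'b) set" where
  "unital_star_hom A B =
     {h \<in> ring_hom A B.
        (\<forall>c. \<forall>x\<in>carrier A. h (c \<odot>\<^bsub>A\<^esub> x) = c \<odot>\<^bsub>B\<^esub> h x) \<and>
        (\<forall>x\<in>carrier A. h (star A x) = star B (h x))}"

definition star_automorphism :: "'a cstar_alg \<Rightarrow> ('a \<Rightarrow> 'a) \<Rightarrow> bool" where
  "star_automorphism A h \<longleftrightarrow> h \<in> unital_star_hom A A \<and> bij_betw h (carrier A) (carrier A)"

definition simple_cstar_algebra :: "'a cstar_alg \<Rightarrow> bool" where
  "simple_cstar_algebra A \<longleftrightarrow>
     cstar_algebra A \<and> carrier A \<noteq> {\<zero>\<^bsub>A\<^esub>} \<and>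
     (\<forall>I. ideal I A \<and> closedin (cstar_topology A) I \<longrightarrow> I = {\<zero>\<^bsub>A\<^esub>} \<or> I = carrier A)"

text \<open>The finite-dimensional subalgebras need not contain the unit.\<close>

definition AF_algebra :: "'a cstar_alg \<Rightarrow> bool" where
  "AF_algebra A \<longleftrightarrow>
     cstar_algebra A \<and>
     (\<exists>F :: nat \<Rightarrow> 'a set.
        (\<forall>n. star_subalgebra (F n) A \<and> finite_dimensional A (F n) \<and> F n \<subseteq> F (Suc n)) \<and>
        cstar_topology A closure_of (\<Union>n. F n) = carrier A)"

text \<open>
  States are functions on the carrier; extensionality (the value is \<^const>\<open>undefined\<close>
  elsewhere) makes equality of states the equality of functions on the carrier, and
  \<^const>\<open>restrict\<close> the restriction to a subalgebra.
\<close>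

definition state :: "'a cstar_alg \<Rightarrow> ('a \<Rightarrow> complex) \<Rightarrow> bool" where
  "state A \<phi> \<longleftrightarrow>
     \<phi> \<in> extensional (carrier A) \<and>
     (\<forall>x\<in>carrier A. \<forall>y\<in>carrier A. \<phi> (x \<oplus>\<^bsub>A\<^esub> y) = \<phi> x + \<phi> y) \<and>
     (\<forall>c. \<forall>x\<in>carrier A. \<phi> (c \<odot>\<^bsub>A\<^esub> x) = c * \<phi> x) \<and>
     (\<forall>x\<in>carrier A. \<phi> (star A x \<otimes>\<^bsub>A\<^esub> x) \<in> \<real>\<^sub>\<ge>\<^sub>0) \<and>
     \<phi> \<one>\<^bsub>A\<^esub> = 1"

definition trace_state :: "'a cstar_alg \<Rightarrow> ('a \<Rightarrow> complex) \<Rightarrow> bool" where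
  "trace_state A \<tau> \<longleftrightarrow>
     state A \<tau> \<and> (\<forall>x\<in>carrier A. \<forall>y\<in>carrier A. \<tau> (x \<otimes>\<^bsub>A\<^esub> y) = \<tau> (y \<otimes>\<^bsub>A\<^esub> x))"

definition one_parameter_automorphism_group ::
    "'a cstar_alg \<Rightarrow> (real \<Rightarrow> 'a \<Rightarrow> 'a) \<Rightarrow> bool" where
  "one_parameter_automorphism_group A \<sigma> \<longleftrightarrow>
     (\<forall>t. star_automorphism A (\<sigma> t)) \<and>
     (\<forall>x\<in>carrier A. \<sigma> 0 x = x) \<and>
     (\<forall>t u. \<forall>x\<in>carrier A. \<sigma> (t + u) x = \<sigma> t (\<sigma> u x)) \<and>
     (\<forall>x\<in>carrier A. continuous_map euclideanreal (cstar_topology A) (\<lambda>t. \<sigma> t x))"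

definition fixed_point_algebra :: "'a cstar_alg \<Rightarrow> (real \<Rightarrow> 'a \<Rightarrow> 'a) \<Rightarrow> 'a cstar_alg" where
  "fixed_point_algebra A \<sigma> = A\<lparr>carrier := {x \<in> carrier A. \<forall>t. \<sigma> t x = x}\<rparr>"


section \<open>The Cuntz algebra\<close>

definition cuntz_family :: "nat \<Rightarrow> 'a cstar_alg \<Rightarrow> (nat \<Rightarrow> 'a) \<Rightarrow> bool" where
  "cuntz_family d A s \<longleftrightarrow>
     (\<forall>i\<in>{1..d}. s i \<in> carrier A) \<and>
     (\<forall>i\<in>{1..d}. \<forall>j\<in>{1..d}.
        star A (s i) \<otimes>\<^bsub>A\<^esub> s j = (if i = j then \<one>\<^bsub>A\<^esub> else \<zero>\<^bsub>A\<^esub>)) \<and>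
     (\<Oplus>\<^bsub>A\<^esub>i\<in>{1..d}. s i \<otimes>\<^bsub>A\<^esub> star A (s i)) = \<one>\<^bsub>A\<^esub>"

text \<open>
  \<open>cuntz_algebra d A s\<close>: \<open>A\<close> is the universal unital C*-algebra generated by a Cuntz family
  \<open>s\<close>. In the universal property, \<open>B\<close> ranges over the C*-algebras whose carrier lies in the
  type \<^typ>\<open>'a\<close> of elements of \<open>A\<close>. This is no restriction: since \<open>A\<close> is nonzero, \<^typ>\<open>'a\<close> has
  at least the cardinality of the continuum, and the C*-subalgebra generated by a Cuntz family
  in any C*-algebra is separable, so it has an isomorphic copy with carrier in \<^typ>\<open>'a\<close>.
  Without \<^prop>\<open>\<one>\<^bsub>A\<^esub> \<noteq> \<zero>\<^bsub>A\<^esub>\<close> the zero algebra on a one-element type would qualify.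
\<close>

definition cuntz_algebra :: "nat \<Rightarrow> 'a cstar_alg \<Rightarrow> (nat \<Rightarrow> 'a) \<Rightarrow> bool" where
  "cuntz_algebra d A s \<longleftrightarrow>
     cstar_algebra A \<and> \<one>\<^bsub>A\<^esub> \<noteq> \<zero>\<^bsub>A\<^esub> \<and>
     cuntz_family d A s \<and>
     (\<forall>B. star_subalgebra B A \<and> closedin (cstar_topology A) B \<and> s ` {1..d} \<subseteq> B
        \<longrightarrow> B = carrier A) \<and>
     (\<forall>(B :: 'a cstar_alg) t. cstar_algebra B \<and> cuntz_family d B t
        \<longrightarrow> (\<exists>h \<in> unital_star_hom A B. \<forall>i\<in>{1..d}. h (s i) = t i))"

definition word :: "'a cstar_alg \<Rightarrow> (nat \<Rightarrow> 'a) \<Rightarrow> nat list \<Rightarrow> 'a" where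
  "word A s \<alpha> = foldr (\<lambda>i x. s i \<otimes>\<^bsub>A\<^esub> x) \<alpha> \<one>\<^bsub>A\<^esub>"

text \<open>
  \<open>\<omega> (s\<^sub>\<alpha> s\<^sub>\<gamma>\<^sup>*) = \<delta>\<^sub>\<alpha>\<^sub>\<gamma> p\<^sup>\<alpha>\<close>, the multi-indices \<open>\<alpha>\<close>, \<open>\<gamma>\<close> being lists (possibly empty) over
  \<open>{1..d}\<close>.
\<close>

definition cuntz_state :: "nat \<Rightarrow> 'a cstar_alg \<Rightarrow> (nat \<Rightarrow> 'a) \<Rightarrow> (nat \<Rightarrow> real) \<Rightarrow> ('a \<Rightarrow> complex) \<Rightarrow> bool" where
  "cuntz_state d A s p \<omega> \<longleftrightarrow>
     state A \<omega> \<and>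
     (\<forall>\<alpha>\<in>lists {1..d}. \<forall>\<gamma>\<in>lists {1..d}.
        \<omega> (word A s \<alpha> \<otimes>\<^bsub>A\<^esub> star A (word A s \<gamma>)) =
          (if \<alpha> = \<gamma> then complex_of_real (\<Prod>i\<leftarrow>\<alpha>. p i) else 0))"

end

theory Submission
  imports Defs
begin

text \<open>
  For a self-adjoint \<open>a\<close> of norm less than \<open>1\<close>, a contraction principle yields a square root of
  \<open>1 - a\<close>; from it one gets that homomorphisms are contractive and that states are bounded by the
  norm, without any spectral theory.

  Words stopped when their weight first reaches \<open>n\<close> form a complete prefix code, so the
  \<open>s\<^sub>\<alpha> s\<^sub>\<gamma>\<^sup>*\<close> with \<open>\<alpha>\<close>, \<open>\<gamma>\<close> stopped words of equal weight are the matrix units of a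
  finite-dimensional algebra. These algebras increase with \<open>n\<close>, and averaging over \<open>\<sigma>\<close> shows that
  their union is dense in the fixed-point algebra. The norm of such a matrix algebra is its operator
  norm on columns; hence a nonzero ideal contains a projection \<open>s\<^sub>\<alpha> s\<^sub>\<alpha>\<^sup>*\<close>, and as all large integers
  are weights of words, it contains \<open>1\<close>.

  The state is the limit of the iterates of \<open>x \<mapsto> \<Sum>\<^sub>i p\<^sub>i s\<^sub>i\<^sup>* x s\<^sub>i\<close>. A trace \<open>\<tau>\<close> is determined by
  \<open>\<tau> (s\<^sub>\<alpha> s\<^sub>\<alpha>\<^sup>*)\<close>, which depends on the weight of \<open>\<alpha>\<close> only; multiplied by \<open>e\<^bsup>\<beta> weight\<^esup>\<close> it is a
  nonnegative harmonic function of the weight, and those are constant since the weights have greatest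
  common divisor \<open>1\<close>.
\<close>

section \<open>Harmonic functions on the natural numbers\<close>

text \<open>Words of one fixed weight would give fixed matrix units, but their range projections
  need not sum to \<open>\<one>\<close>. Stopping at the first crossing repairs this; the price is
  that the weights of stopped words vary, so that each finite-dimensional algebra is a direct sum of
  full matrix algebras, one for each weight that occurs. Its elements are treated as matrices
  without a Hilbert space: combinations of stopped words of one weight serve as columns, because an
  adjoint column times a column is a scalar.

  The greatest common divisor enters twice through one fact, that all large integers are weights of
  words. It links a projection in an ideal with projections of every large weight, and it rules out
  periodic harmonic functions of the weight.

  Positivity of the limit state is not read off from \<open>\<Phi>\<close>, as limits of positive
  elements of \<open>A\<close> are not at hand. It is proved on the span of the
  \<open>unit \<alpha> \<gamma>\<close> and carried over by continuity of the functional.\<close>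

lemma exp_sum_eq_1_ex1:
  fixes L :: "nat \<Rightarrow> nat"
  assumes d: "2 \<le> d" and L: "\<And>i. i \<in> {1..d} \<Longrightarrow> 0 < L i"
  shows "\<exists>!\<beta>::real. 0 < \<beta> \<and> (\<Sum>i=1..d. exp (- \<beta> * real (L i))) = 1"
proof -
  define F where "F = (\<lambda>b::real. \<Sum>i=1..d. exp (- b * real (L i)))"
  have less: "F c < F b" if "b < c" for b c
    unfolding F_def using that d L by (intro sum_strict_mono) auto
  have lim: "(F \<longlongrightarrow> 0) at_top"
  proof -
    have "((\<lambda>b. exp (- b * real (L i))) \<longlongrightarrow> 0) at_top" if "i \<in> {1..d}" for i
    proof -
      have "filterlim (\<lambda>b. real (L i) * b) at_top at_top"
        using L[OF that] by (intro filterlim_tendsto_pos_mult_at_top[OF tendsto_const]) (auto simp: filterlim_ident)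
      then have "filterlim (\<lambda>b. - (real (L i) * b)) at_bot at_top"
        by (simp add: filterlim_uminus_at_bot)
      from filterlim_compose[OF exp_at_bot this] show ?thesis
        by (simp add: mult.commute)
    qed
    then have "(F \<longlongrightarrow> (\<Sum>i=1..d. 0)) at_top"
      unfolding F_def by (intro tendsto_sum) auto
    then show ?thesis by simp
  qed
  then have "eventually (\<lambda>b. F b < 1) at_top"
    by (rule order_tendstoD) simp
  then obtain B where B: "\<And>b. B \<le> b \<Longrightarrow> F b < 1"
    by (auto simp: eventually_at_top_linorder)
  define c where "c = max 1 B"
  have F0: "F 0 = real d" by (simp add: F_def)
  have "\<exists>x\<ge>0. x \<le> c \<and> F x = 1"
  proof (rule IVT2')
    show "F c \<le> 1" using B[of c] by (simp add: c_def)
    show "1 \<le> F 0" "0 \<le> c" using d by (auto simp: F0 c_def)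
    show "continuous_on {0..c} F" unfolding F_def by (intro continuous_intros)
  qed
  then obtain x where x: "0 \<le> x" "F x = 1" by blast
  \<comment> \<open>At 0 the sum is \<open>d\<close>, which is at least 2; this keeps the root
    positive.\<close>
  have "x \<noteq> 0" using x d F0 by auto
  with x have "0 < x" by simp
  show ?thesis
  proof (rule ex1I[of _ x])
    show "0 < x \<and> (\<Sum>i=1..d. exp (- x * real (L i))) = 1"
      using x \<open>0 < x\<close> by (simp add: F_def)
    fix y assume "0 < y \<and> (\<Sum>i=1..d. exp (- y * real (L i))) = 1"
    then have "F y = F x" using x by (simp add: F_def)
    then show "y = x" using less by (metis less_irrefl linorder_neqE)
  qed
qed

text \<open>The least positive difference \<open>m\<close> of elements divides every element, since
  remainders modulo \<open>m\<close> are again differences; hence \<open>m = 1\<close>, and some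
  \<open>a\<close> and \<open>a + 1\<close> both lie in \<open>S\<close>. Once \<open>n\<close>
  exceeds the square of \<open>a\<close>, its quotient by \<open>a\<close> is at least the
  remainder, so that remainder many copies of \<open>a\<close> can be traded for
  \<open>a + 1\<close>.\<close>

lemma coprime_submonoid_cofinite:
  fixes S :: "nat set"
  assumes z: "0 \<in> S" and add: "\<And>a b. a \<in> S \<Longrightarrow> b \<in> S \<Longrightarrow> a + b \<in> S" and g: "Gcd S = 1"
  obtains N where "\<And>n. N \<le> n \<Longrightarrow> n \<in> S"
proof -
  have mult: "k * a \<in> S" if "a \<in> S" for k a
    using that by (induct k) (auto simp: z add)
  define D where "D = {k. 0 < k \<and> (\<exists>a\<in>S. a + k \<in> S)}"
  have "\<exists>a\<in>S. a \<noteq> 0" using g by (metis Gcd_0_iff subsetI singleton_iff zero_neq_one)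
  then have "\<exists>k. k \<in> D" using z by (force simp: D_def)
  define m where "m = (LEAST k. k \<in> D)"
  have mD: "m \<in> D" unfolding m_def using \<open>\<exists>k. k \<in> D\<close> by (rule LeastI_ex)
  then obtain a where a: "0 < m" "a \<in> S" "a + m \<in> S" by (auto simp: D_def)
  have "m dvd b" if b: "b \<in> S" for b
  proof (rule ccontr)
    assume "\<not> m dvd b"
    then have r: "0 < b mod m" by (simp add: mod_greater_zero_iff_not_dvd)
    \<comment> \<open>Adding \<open>(b div m) * a\<close> exhibits the remainder as a difference of
      two elements of \<open>S\<close>.\<close>
    have "b + (b div m) * a = (b div m) * (a + m) + b mod m"
      by (simp add: algebra_simps)
    moreover have "b + (b div m) * a \<in> S" "(b div m) * (a + m) \<in> S" 
      using a b add mult by auto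
    ultimately have "b mod m \<in> D" using r by (auto simp: D_def)
    then have "m \<le> b mod m" unfolding m_def by (rule Least_le)
    then show False using mod_less_divisor[OF a(1), of b] by simp
  qed
  then have "m dvd Gcd S" by (rule Gcd_greatest)
  then have m: "m = 1" using g by simp
  show thesis
  proof
    fix n assume n: "a * a + 1 \<le> n"
    show "n \<in> S"
    proof (cases "a = 0")
      case True
      then show ?thesis using a(3) m mult[of 1 n] by simp
    next
      case False
      then have "n mod a < a" by simp
      moreover have "a \<le> n div a" using n False by (simp add: less_eq_div_iff_mult_less_eq)
      ultimately have le: "n mod a \<le> n div a" by simp
      have "(n div a - n mod a) * a + n mod a * (a + 1) = n"
        using le by (simp add: algebra_simps diff_mult_distrib2)
      then show ?thesis
        using add[OF mult[of a "n div a - n mod a"] mult[of "a + 1" "n mod a"]] a m by simp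
    qed
  qed
qed

text \<open>Since \<open>h\<close> is nonnegative, \<open>h m\<close> dominates a fixed multiple of all later values of \<open>h\<close>, so a
  value close to the infimum forces all later values, and hence, by averaging, all values, to be
  close to it.\<close>

lemma nonneg_harmonic_const:
  fixes h :: "nat \<Rightarrow> real" and p :: "'i \<Rightarrow> real" and L :: "'i \<Rightarrow> nat"
  assumes I: "finite I" and p: "\<And>i. i \<in> I \<Longrightarrow> 0 < p i" and p1: "sum p I = 1"
    and L: "\<And>i. i \<in> I \<Longrightarrow> 0 < L i" and g: "Gcd (L ` I) = 1"
    and nn: "\<And>m. 0 \<le> h m" and har: "\<And>m. h m = (\<Sum>i\<in>I. p i * h (m + L i))"
  shows "h m = h 0"
proof -
  \<comment> \<open>The constants below have to serve all nonnegative harmonic functions: they are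
    found for arbitrary \<open>h'\<close> and then applied to \<open>h\<close> minus its
    infimum.\<close>
  define H where "H h' \<longleftrightarrow> (\<forall>m. 0 \<le> h' m) \<and> (\<forall>m. h' m = (\<Sum>i\<in>I. p i * h' (m + L i)))"
    for h' :: "nat \<Rightarrow> real"
  have H0: "0 \<le> h' m" if "H h'" for h' m using that unfolding H_def by blast
  have Hsum: "h' m = (\<Sum>i\<in>I. p i * h' (m + L i))" if "H h'" for h' m
    using that unfolding H_def by blast
  \<comment> \<open>The shifts over which a value dominates a fixed multiple of the later one,
    uniformly in position and function. One averaging step puts every \<open>L i\<close> in
    \<open>S\<close>, and the constants multiply when shifts are added.\<close>
  define S where "S = {n. \<exists>\<delta>>0. \<forall>h' m. H h' \<longrightarrow> \<delta> * h' (m + n) \<le> h' m}"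
  have "0 \<in> S" by (auto simp: S_def intro!: exI[of _ 1])
  moreover have "a + b \<in> S" if "a \<in> S" "b \<in> S" for a b
  proof -
    from that obtain e f where e: "e > 0" "f > 0"
      "\<And>h' m. H h' \<Longrightarrow> e * h' (m + a) \<le> h' m"
      "\<And>h' m. H h' \<Longrightarrow> f * h' (m + b) \<le> h' m"
      unfolding S_def by blast
    have "(e * f) * h' (m + (a + b)) \<le> h' m" if "H h'" for h' m
    proof -
      have "e * (f * h' ((m + a) + b)) \<le> e * h' (m + a)"
        using e(1) e(4)[OF that, of "m + a"] by simp
      also have "\<dots> \<le> h' m" by (rule e(3)[OF that])
      finally show ?thesis by (simp add: algebra_simps)
    qed
    then show ?thesis using e(1,2) unfolding S_def
      by (intro CollectI exI[of _ "e * f"]) auto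
  qed
  moreover have LS: "L i \<in> S" if i: "i \<in> I" for i
    unfolding S_def
  proof (intro CollectI exI[of _ "p i"] conjI allI impI)
    show "p i > 0" using p i .
    fix h' :: "nat \<Rightarrow> real" and m
    assume h': "H h'"
    have "p i * h' (m + L i) \<le> (\<Sum>i\<in>I. p i * h' (m + L i))"
      using I i H0[OF h'] p by (intro member_le_sum) (auto intro!: mult_nonneg_nonneg intro: less_imp_le)
    then show "p i * h' (m + L i) \<le> h' m" using Hsum[OF h', of m] by linarith
  qed
  moreover have "Gcd S = 1"
  proof -
    have "Gcd S dvd Gcd (L ` I)" using LS by (intro Gcd_greatest) (auto intro: Gcd_dvd)
    then show ?thesis using g by simp
  qed
  ultimately obtain N where N: "\<And>n. N \<le> n \<Longrightarrow> n \<in> S"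
    using coprime_submonoid_cofinite by metis
  define w where "w = Max (insert 0 (L ` I))"
  have Lw: "L i \<le> w" if "i \<in> I" for i using that I by (auto simp: w_def)
  have "\<forall>n. \<exists>\<delta>. N \<le> n \<longrightarrow> 0 < \<delta> \<and> (\<forall>h' m. H h' \<longrightarrow> \<delta> * h' (m + n) \<le> h' m)"
    using N unfolding S_def by blast
  then obtain \<Delta> where \<Delta>: "\<And>n. N \<le> n \<Longrightarrow> 0 < \<Delta> n"
    "\<And>n h' m. N \<le> n \<Longrightarrow> H h' \<Longrightarrow> \<Delta> n * h' (m + n) \<le> h' m"
    by metis
  \<comment> \<open>A window of length \<open>w\<close>, a bound on the weights, suffices: for a
    shift \<open>n\<close> beyond it every \<open>n - L i\<close> is still at least
    \<open>N\<close>, and one averaging step preserves the bound because the \<open>p i\<close> sum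
    to 1.\<close>
  define \<delta> where "\<delta> = Min (\<Delta> ` {N..N + w})"
  have \<delta>: "0 < \<delta>" unfolding \<delta>_def using \<Delta> by (subst Min_gr_iff) auto
  have dom: "\<delta> * h' (m + n) \<le> h' m"
    if n: "N \<le> n" and h': "H h'" for h' m n
    using n
  proof (induction n arbitrary: m rule: less_induct)
    case (less n)
    show ?case
    proof (cases "n \<le> N + w")
      case True
      then have "\<delta> \<le> \<Delta> n" unfolding \<delta>_def using less.prems by (intro Min_le) auto
      then have "\<delta> * h' (m + n) \<le> \<Delta> n * h' (m + n)" using H0[OF h'] by (intro mult_right_mono) auto
      then show ?thesis using \<Delta>(2)[OF less.prems h', of m] by linarith
    next
      case False
      have "\<delta> * h' (m + n) = (\<Sum>i\<in>I. p i) * (\<delta> * h' (m + n))" by (simp add: p1)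
      also have "\<dots> = (\<Sum>i\<in>I. p i * (\<delta> * h' (m + n)))" by (simp add: sum_distrib_right)
      also have "\<dots> \<le> (\<Sum>i\<in>I. p i * h' (m + L i))"
      proof (intro sum_mono mult_left_mono)
        fix i assume i: "i \<in> I"
        show "0 \<le> p i" using p i by (simp add: less_imp_le)
        have "\<delta> * h' ((m + L i) + (n - L i)) \<le> h' (m + L i)"
          using less.IH[of "n - L i" "m + L i"] L[OF i] Lw[OF i] False by simp
        then show "\<delta> * h' (m + n) \<le> h' (m + L i)" using Lw[OF i] False by simp
      qed
      also have "\<dots> = h' m" using Hsum[OF h', of m] by simp
      finally show ?thesis .
    qed
  qed
  define c where "c = Inf (range h)"
  have bdd: "bdd_below (range h)" using nn by (auto intro: bdd_belowI[of _ 0])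
  have cle: "c \<le> h m" for m unfolding c_def by (rule cInf_lower) (auto simp: bdd)
  define k where "k m = h m - c" for m
  have k0: "0 \<le> k m" for m using cle by (simp add: k_def)
  have kh: "k m = (\<Sum>i\<in>I. p i * k (m + L i))" for m
  proof -
    have "(\<Sum>i\<in>I. p i * k (m + L i)) = (\<Sum>i\<in>I. p i * h (m + L i)) - sum p I * c"
      by (simp add: k_def algebra_simps sum_subtractf flip: sum_distrib_left sum_distrib_right)
    then show "k m = (\<Sum>i\<in>I. p i * k (m + L i))" using har[of m] unfolding k_def[of m] p1 by linarith
  qed
  have Hk: "H k" unfolding H_def using k0 kh by blast
  have small: "k j \<le> e" if e: "0 < e" for j e
  proof -
    have "\<exists>x\<in>range h. x < c + \<delta> * e"
      unfolding c_def using \<delta> e bdd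
      by (subst cInf_less_iff[symmetric]) auto
    then obtain m where "h m < c + \<delta> * e" by blast
    then have m: "k m < \<delta> * e" by (simp add: k_def)
    have late: "k n \<le> e" if "m + N \<le> n" for n
    proof -
      have "\<delta> * k (m + (n - m)) \<le> k m" using that Hk by (intro dom) auto
      then have "\<delta> * k n \<le> \<delta> * e" using m that by simp
      then show ?thesis using \<delta> by simp
    qed
    \<comment> \<open>Downward induction: below \<open>m + N\<close> each value is an average of
      values further on.\<close>
    show ?thesis
    proof (induction "m + N - j" arbitrary: j rule: less_induct)
      case less
      show ?case
      proof (cases "m + N \<le> j")
        case False
        have "k j = (\<Sum>i\<in>I. p i * k (j + L i))" by (rule kh)
        also have "\<dots> \<le> (\<Sum>i\<in>I. p i * e)"
        proof (intro sum_mono mult_left_mono)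
          fix i assume i: "i \<in> I"
          show "0 \<le> p i" using p i by (simp add: less_imp_le)
          show "k (j + L i) \<le> e" using less[of "j + L i"] L[OF i] False by simp
        qed
        also have "\<dots> = e" by (simp add: p1 flip: sum_distrib_right)
        finally show ?thesis .
      qed (rule late)
    qed
  qed
  have "k j = 0" for j
  proof (rule antisym)
    show "k j \<le> 0" using small by (rule field_le_epsilon[of _ 0, simplified])
  qed (use k0 in simp)
  then show ?thesis by (simp add: k_def)
qed

section \<open>C*-algebras\<close>

context cstar_algebra
begin

section \<open>Calculus of scalars, differences and the involution\<close>

lemma smult_closed [simp, intro]: "x \<in> carrier A \<Longrightarrow> c \<odot> x \<in> carrier A"
  by (rule scalars.smult_closed) (simp_all add: ring_of_type_algebra_def)

lemma smult_add_left: "x \<in> carrier A \<Longrightarrow> (a + b) \<odot> x = a \<odot> x \<oplus> b \<odot> x"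
  using scalars.smult_l_distr[of a b x] by (simp add: ring_of_type_algebra_def)

lemma smult_add_right:
  "x \<in> carrier A \<Longrightarrow> y \<in> carrier A \<Longrightarrow> c \<odot> (x \<oplus> y) = c \<odot> x \<oplus> c \<odot> y"
  using scalars.smult_r_distr[of c x y] by (simp add: ring_of_type_algebra_def)

lemma smult_smult: "x \<in> carrier A \<Longrightarrow> a \<odot> (b \<odot> x) = (a * b) \<odot> x"
  using scalars.smult_assoc1[of a b x] by (simp add: ring_of_type_algebra_def)

lemma smult_1 [simp]: "x \<in> carrier A \<Longrightarrow> 1 \<odot> x = x"
  using scalars.smult_one[of x] by (simp add: ring_of_type_algebra_def)

lemma smult_0 [simp]: "x \<in> carrier A \<Longrightarrow> 0 \<odot> x = \<zero>"
  using scalars.smult_l_null[of x] by (simp add: ring_of_type_algebra_def)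

lemma smult_zero [simp]: "c \<odot> \<zero> = \<zero>"
  using scalars.smult_r_null[of c] by (simp add: ring_of_type_algebra_def)

lemma smult_minus_right: "x \<in> carrier A \<Longrightarrow> c \<odot> (\<ominus> x) = \<ominus> (c \<odot> x)"
  using scalars.smult_r_minus[of c x] by (simp add: ring_of_type_algebra_def)

lemma smult_minus_left: "x \<in> carrier A \<Longrightarrow> (- c) \<odot> x = \<ominus> (c \<odot> x)"
  using minus_equality[of "(- c) \<odot> x" "c \<odot> x"] smult_add_left[of x "- c" c] by simp

lemma minus_conv_smult: "x \<in> carrier A \<Longrightarrow> \<ominus> x = (- 1) \<odot> x"
  by (simp add: smult_minus_left)

lemma smult_diff_right:
  "x \<in> carrier A \<Longrightarrow> y \<in> carrier A \<Longrightarrow> c \<odot> (x \<ominus> y) = c \<odot> x \<ominus> c \<odot> y"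
  by (simp add: a_minus_def smult_add_right smult_minus_right)

lemma smult_diff_left: "x \<in> carrier A \<Longrightarrow> (a - b) \<odot> x = a \<odot> x \<ominus> b \<odot> x"
  using smult_add_left[of x a "- b"] by (simp add: a_minus_def smult_minus_left)

lemma diff_mult_left:
  "x \<in> carrier A \<Longrightarrow> y \<in> carrier A \<Longrightarrow> z \<in> carrier A \<Longrightarrow> (x \<ominus> y) \<otimes> z = x \<otimes> z \<ominus> y \<otimes> z"
  by (simp add: a_minus_def l_distr l_minus)

lemma diff_mult_right:
  "x \<in> carrier A \<Longrightarrow> y \<in> carrier A \<Longrightarrow> z \<in> carrier A \<Longrightarrow> z \<otimes> (x \<ominus> y) = z \<otimes> x \<ominus> z \<otimes> y"
  by (simp add: a_minus_def r_distr r_minus)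

lemma diff_add_diff:
  "x \<in> carrier A \<Longrightarrow> y \<in> carrier A \<Longrightarrow> z \<in> carrier A \<Longrightarrow> (x \<ominus> y) \<oplus> (y \<ominus> z) = x \<ominus> z"
  by (simp add: a_minus_def a_assoc r_neg1)

lemma add_diff_add:
  "x \<in> carrier A \<Longrightarrow> y \<in> carrier A \<Longrightarrow> z \<in> carrier A \<Longrightarrow> w \<in> carrier A \<Longrightarrow>
    (x \<oplus> y) \<ominus> (z \<oplus> w) = (x \<ominus> z) \<oplus> (y \<ominus> w)"
  by (simp add: a_minus_def minus_add a_ac)

lemma diff_self [simp]: "x \<in> carrier A \<Longrightarrow> x \<ominus> x = \<zero>"
  by (simp add: a_minus_def r_neg)

lemma diff_add_cancel [simp]: "x \<in> carrier A \<Longrightarrow> y \<in> carrier A \<Longrightarrow> (x \<ominus> y) \<oplus> y = x"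
  by (simp add: a_minus_def a_assoc l_neg)

lemma diff_eq_zero_iff: "x \<in> carrier A \<Longrightarrow> y \<in> carrier A \<Longrightarrow> x \<ominus> y = \<zero> \<longleftrightarrow> x = y"
  by (metis diff_self diff_add_cancel l_zero)

declare star_closed [simp, intro]

lemma star_zero [simp]: "star A \<zero> = \<zero>"
  using star_smult[of \<zero> 0] by simp

lemma star_one [simp]: "star A \<one> = \<one>"
  by (metis one_closed r_one star_closed star_mult star_star)

lemma star_minus: "x \<in> carrier A \<Longrightarrow> star A (\<ominus> x) = \<ominus> star A x"
  by (simp add: minus_conv_smult star_smult)

lemma star_diff: "x \<in> carrier A \<Longrightarrow> y \<in> carrier A \<Longrightarrow> star A (x \<ominus> y) = star A x \<ominus> star A y"
  by (simp add: a_minus_def star_add star_minus)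

lemma nrm_zero [simp]: "nrm A \<zero> = 0"
  by (simp add: nrm_eq_0_iff)

lemma nrm_minus [simp]: "x \<in> carrier A \<Longrightarrow> nrm A (\<ominus> x) = nrm A x"
  by (simp add: minus_conv_smult nrm_smult)

lemma nrm_diff_commute: "x \<in> carrier A \<Longrightarrow> y \<in> carrier A \<Longrightarrow> nrm A (x \<ominus> y) = nrm A (y \<ominus> x)"
  using nrm_minus[of "y \<ominus> x"] by (simp add: a_minus_def minus_add a_comm)

lemma nrm_diff_triangle:
  "x \<in> carrier A \<Longrightarrow> y \<in> carrier A \<Longrightarrow> z \<in> carrier A \<Longrightarrow>
    nrm A (x \<ominus> z) \<le> nrm A (x \<ominus> y) + nrm A (y \<ominus> z)"
  using nrm_triangle[of "x \<ominus> y" "y \<ominus> z"] by (simp add: diff_add_diff)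

lemma nrm_le_add_diff: "x \<in> carrier A \<Longrightarrow> y \<in> carrier A \<Longrightarrow> nrm A x \<le> nrm A y + nrm A (x \<ominus> y)"
  using nrm_triangle[of "x \<ominus> y" y] by simp

lemma nrm_star [simp]: assumes x: "x \<in> carrier A" shows "nrm A (star A x) = nrm A x"
proof -
  have le: "nrm A y \<le> nrm A (star A y)" if y: "y \<in> carrier A" for y
  proof (cases "nrm A y = 0")
    case False
    have "nrm A y * nrm A y \<le> nrm A (star A y) * nrm A y"
      using cstar_identity[OF y] nrm_mult[of "star A y" y] y by (simp add: power2_eq_square)
    then show ?thesis using False nrm_nonneg[OF y] by (simp add: mult_le_cancel_right)
  qed (simp add: nrm_nonneg y)
  show ?thesis using le[OF x] le[of "star A x"] x by (simp add: star_star)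
qed

lemma nrm_one: assumes "\<one> \<noteq> \<zero>" shows "nrm A \<one> = 1"
  using cstar_identity[of \<one>] assms nrm_eq_0_iff[of \<one>] by (simp add: power2_eq_square)

text \<open>Only an inequality, since the zero algebra is allowed and its unit has norm 0.\<close>

lemma nrm_one_le: "nrm A \<one> \<le> 1"
  using nrm_one by (cases "\<one> = \<zero>") auto

lemma nrm_unitary_le: assumes "x \<in> carrier A" "star A x \<otimes> x = \<one>" shows "nrm A x \<le> 1"
  using cstar_identity[of x] assms nrm_one_le
  by (metis one_le_power power2_eq_square nrm_nonneg linorder_le_cases mult_le_one order_antisym power_one abs_le_square_iff abs_of_nonneg abs_one)

section \<open>Norm topology, contractions, inverses and square roots\<close>

lemma metric_space: "Metric_space (carrier A) (cstar_dist A)"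
proof
  fix x y
  show "0 \<le> cstar_dist A x y" by (simp add: cstar_dist_def nrm_nonneg)
  show "cstar_dist A x y = cstar_dist A y x" by (simp add: cstar_dist_def nrm_diff_commute)
next
  fix x y assume "x \<in> carrier A" "y \<in> carrier A"
  then show "cstar_dist A x y = 0 \<longleftrightarrow> x = y"
    by (simp add: cstar_dist_def nrm_eq_0_iff diff_eq_zero_iff)
next
  fix x y z assume "x \<in> carrier A" "y \<in> carrier A" "z \<in> carrier A"
  then show "cstar_dist A x z \<le> cstar_dist A x y + cstar_dist A y z"
    by (simp add: cstar_dist_def nrm_diff_triangle)
qed

lemma cstar_dist_eq: "x \<in> carrier A \<Longrightarrow> y \<in> carrier A \<Longrightarrow> cstar_dist A x y = nrm A (x \<ominus> y)"
  by (simp add: cstar_dist_def)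

lemma closure_of_eq:
  "cstar_topology A closure_of S = {x \<in> carrier A. \<forall>e>0. \<exists>y\<in>S. y \<in> carrier A \<and> nrm A (x \<ominus> y) < e}"
proof -
  interpret M: Metric_space "carrier A" "cstar_dist A" by (rule metric_space)
  show ?thesis
    unfolding cstar_topology_def M.metric_closure_of by (auto simp: cstar_dist_def M.mball_def)
qed

lemma closedinI:
  assumes "C \<subseteq> carrier A"
    and "\<And>x. x \<in> carrier A \<Longrightarrow> (\<And>e. 0 < e \<Longrightarrow> \<exists>y\<in>C. nrm A (x \<ominus> y) < e) \<Longrightarrow> x \<in> C"
  shows "closedin (cstar_topology A) C"
proof -
  interpret M: Metric_space "carrier A" "cstar_dist A" by (rule metric_space)
  have "Abstract_Topology.closure_of (cstar_topology A) C \<subseteq> C"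
    unfolding closure_of_eq using assms(2) by blast
  then show ?thesis
    using assms(1) Abstract_Topology.closure_of_subset_eq[of C "cstar_topology A"] by (simp add: cstar_topology_def)
qed

lemma complete_closedin:
  assumes "closedin (cstar_topology A) C"
  shows "Metric_space.mcomplete C (cstar_dist A)"
proof -
  interpret M: Metric_space "carrier A" "cstar_dist A" by (rule metric_space)
  have "C \<subseteq> carrier A" using closedin_subset[OF assms] by (simp add: cstar_topology_def)
  then interpret Submetric "carrier A" "cstar_dist A" C by unfold_locales
  show ?thesis
    using closedin_mcomplete_imp_mcomplete assms complete by (simp add: cstar_topology_def)
qed

text \<open>Working on a closed set lets the fixed point inherit the properties that define the set,
  such as self-adjointness in the construction of square roots.\<close>

lemma contraction_fixpoint:
  assumes C: "closedin (cstar_topology A) C" "C \<noteq> {}" and f: "\<And>x. x \<in> C \<Longrightarrow> f x \<in> C"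
    and k: "k < 1"
    and con: "\<And>x y. x \<in> C \<Longrightarrow> y \<in> C \<Longrightarrow> nrm A (f x \<ominus> f y) \<le> k * nrm A (x \<ominus> y)"
  obtains x where "x \<in> C" "f x = x"
proof -
  interpret M: Metric_space "carrier A" "cstar_dist A" by (rule metric_space)
  have sub: "C \<subseteq> carrier A" using closedin_subset[OF C(1)] by (simp add: cstar_topology_def)
  interpret N: Metric_space C "cstar_dist A" by (rule M.subspace) (rule sub)
  show thesis
  proof (rule N.Banach_fixedpoint_thm[OF complete_closedin[OF C(1)] C(2) _ k, of f])
    show "f \<in> C \<rightarrow> C" using f by blast
    show "cstar_dist A (f x) (f y) \<le> k * cstar_dist A x y" if "x \<in> C" "y \<in> C" for x y
      using con[OF that] that f sub by (simp add: cstar_dist_eq subset_iff)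
  qed (use that in blast)
qed


lemma nrm_mult_le:
  "x \<in> carrier A \<Longrightarrow> y \<in> carrier A \<Longrightarrow> nrm A x \<le> a \<Longrightarrow> nrm A y \<le> b \<Longrightarrow> nrm A (x \<otimes> y) \<le> a * b"
  using nrm_mult[of x y] nrm_nonneg[of x] nrm_nonneg[of y]
  by (meson mult_mono order_trans)

text \<open>The fixed-point form of the Neumann series:
  \<open>y = \<one> \<oplus> (\<one> \<ominus> x) \<otimes> y\<close> says just
  \<open>x \<otimes> y = \<one>\<close>.\<close>

lemma right_inverse_exists:
  assumes x: "x \<in> carrier A" and n: "nrm A (\<one> \<ominus> x) < 1"
  obtains y where "y \<in> carrier A" "x \<otimes> y = \<one>"
proof (rule contraction_fixpoint)
  let ?f = "\<lambda>y. \<one> \<oplus> (\<one> \<ominus> x) \<otimes> y"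
  show "closedin (cstar_topology A) (carrier A)" by (rule closedinI) auto
  show "carrier A \<noteq> {}" "nrm A (\<one> \<ominus> x) < 1" using n by auto
  show "?f y \<in> carrier A" if "y \<in> carrier A" for y using that x by simp
  show "nrm A (?f y \<ominus> ?f z) \<le> nrm A (\<one> \<ominus> x) * nrm A (y \<ominus> z)"
    if "y \<in> carrier A" "z \<in> carrier A" for y z
  proof -
    have "?f y \<ominus> ?f z = (\<one> \<ominus> x) \<otimes> (y \<ominus> z)"
      using that x by (simp add: add_diff_add diff_mult_right)
    then show ?thesis using that x by (simp add: nrm_mult)
  qed
  fix y assume y: "y \<in> carrier A" "?f y = y"
  then have "\<one> \<oplus> (y \<ominus> x \<otimes> y) = y" using x by (simp add: diff_mult_left)
  then have "\<one> \<oplus> (y \<ominus> x \<otimes> y) \<oplus> x \<otimes> y = y \<oplus> x \<otimes> y" by simp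
  then have "\<one> \<oplus> y = y \<oplus> x \<otimes> y" using x y by (simp add: a_assoc)
  also have "\<dots> = x \<otimes> y \<oplus> y" using x y by (simp add: a_comm)
  finally have "\<one> \<oplus> y = x \<otimes> y \<oplus> y" .
  then have "x \<otimes> y = \<one>" using x y add.r_cancel[of y \<one> "x \<otimes> y"] by simp
  then show thesis using that y by blast
qed

text \<open>The square root of \<open>1 - a\<close> is found as \<open>1 - b\<close> with \<open>b\<close> a fixed point of
  \<open>b \<mapsto> (a + b\<^sup>2)/2\<close>, a contraction on a ball of radius \<open>1 - sqrt (1 - \<parallel>a\<parallel>)\<close>.\<close>

lemma sqrt_one_minus:
  assumes a: "a \<in> carrier A" "star A a = a" "nrm A a < 1"
  obtains b where "b \<in> carrier A" "star A b = b" "b \<otimes> b = \<one> \<ominus> a"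
    "\<And>c. c \<in> carrier A \<Longrightarrow> c \<otimes> a = a \<otimes> c \<Longrightarrow> c \<otimes> b = b \<otimes> c"
proof -
  \<comment> \<open>\<open>r\<close> is the smaller root of
    \<open>(nrm A a + r * r) / 2 = r\<close>, so the ball of radius \<open>r\<close> is mapped into
    itself; \<open>r < 1\<close> makes the map a contraction there.\<close>
  define r where "r = 1 - sqrt (1 - nrm A a)"
  have r: "0 \<le> r" "r < 1" "(nrm A a + r * r) / 2 = r"
    using a nrm_nonneg[OF a(1)] by (simp_all add: r_def algebra_simps)
  \<comment> \<open>Self-adjointness and commutation with everything that commutes with
    \<open>a\<close> are built into \<open>C\<close>, so that the fixed point has them.\<close>
  define C where "C = {b \<in> carrier A. nrm A b \<le> r \<and> star A b = b \<and>
    (\<forall>c\<in>carrier A. c \<otimes> a = a \<otimes> c \<longrightarrow> c \<otimes> b = b \<otimes> c)}"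
  have Cc: "b \<in> carrier A" if "b \<in> C" for b using that by (simp add: C_def)
  define f where "f b = (1/2) \<odot> (a \<oplus> b \<otimes> b)" for b
  have "closedin (cstar_topology A) C"
  proof (rule closedinI)
    fix x assume x: "x \<in> carrier A" and lim: "\<And>e. 0 < e \<Longrightarrow> \<exists>y\<in>C. nrm A (x \<ominus> y) < e"
    have "nrm A x \<le> r + e" if e: "0 < e" for e
    proof -
      obtain y where y: "y \<in> C" "nrm A (x \<ominus> y) < e" using lim[OF e] by blast
      then show ?thesis using nrm_le_add_diff[OF x Cc[OF y(1)]] by (simp add: C_def)
    qed
    then have 1: "nrm A x \<le> r" by (rule field_le_epsilon)
    have "nrm A (star A x \<ominus> x) \<le> 0 + e" if e: "0 < e" for e
    proof -
      obtain y where y: "y \<in> C" "nrm A (x \<ominus> y) < e / 2" using lim[of "e/2"] e by auto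
      have "star A y = y" using y by (simp add: C_def)
      then have "star A x \<ominus> y = star A (x \<ominus> y)" using x Cc[OF y(1)] by (simp add: star_diff)
      then have "nrm A (star A x \<ominus> y) < e / 2" using y x Cc[OF y(1)] by simp
      then show ?thesis
        using nrm_diff_triangle[of "star A x" y x] x y Cc[OF y(1)] nrm_diff_commute[of x y] by simp
    qed
    then have "nrm A (star A x \<ominus> x) \<le> 0" by (rule field_le_epsilon)
    then have 2: "star A x = x"
      using x nrm_nonneg[of "star A x \<ominus> x"] by (simp add: nrm_eq_0_iff diff_eq_zero_iff)
    have 3: "c \<otimes> x = x \<otimes> c" if c: "c \<in> carrier A" "c \<otimes> a = a \<otimes> c" for c
    proof -
      have "nrm A (c \<otimes> x \<ominus> x \<otimes> c) \<le> 0 + e" if e: "0 < e" for e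
      proof -
        \<comment> \<open>The summand 1 avoids division by zero when \<open>c\<close> has norm
          0.\<close>
        define e' where "e' = e / (2 * nrm A c + 1)"
        have e': "e' > 0" "2 * nrm A c * e' \<le> e" using e nrm_nonneg[OF c(1)]
          by (auto simp: e'_def field_simps)
        obtain y where y: "y \<in> C" "nrm A (x \<ominus> y) < e'" using lim[OF e'(1)] by blast
        have yc: "y \<in> carrier A" "c \<otimes> y = y \<otimes> c" using y c by (auto simp: C_def)
        have "nrm A (c \<otimes> x \<ominus> c \<otimes> y) \<le> nrm A c * e'"
          unfolding diff_mult_right[OF x yc(1) c(1), symmetric]
          using c x y yc by (intro nrm_mult_le) auto
        moreover have "nrm A (y \<otimes> c \<ominus> x \<otimes> c) \<le> e' * nrm A c"
          unfolding diff_mult_left[OF yc(1) x c(1), symmetric]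
          using c x y yc by (intro nrm_mult_le) (auto simp: nrm_diff_commute)
        ultimately show ?thesis
          using nrm_diff_triangle[of "c \<otimes> x" "c \<otimes> y" "x \<otimes> c"] c x yc e'(2) by (simp add: mult.commute[of e'])
      qed
      then have "nrm A (c \<otimes> x \<ominus> x \<otimes> c) \<le> 0" by (rule field_le_epsilon)
      then show ?thesis
        using x c nrm_nonneg[of "c \<otimes> x \<ominus> x \<otimes> c"] by (simp add: nrm_eq_0_iff diff_eq_zero_iff)
    qed
    show "x \<in> C" using x 1 2 3 by (simp add: C_def)
  qed (auto simp: C_def)
  moreover have "C \<noteq> {}"
  proof -
    have "\<zero> \<in> C" using r by (simp add: C_def)
    then show ?thesis by blast
  qed
  moreover have "f b \<in> C" if b: "b \<in> C" for b
  proof -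
    have bc: "b \<in> carrier A" "nrm A b \<le> r" "star A b = b"
      "\<And>c. c \<in> carrier A \<Longrightarrow> c \<otimes> a = a \<otimes> c \<Longrightarrow> c \<otimes> b = b \<otimes> c"
      using b by (auto simp: C_def)
    have "nrm A (a \<oplus> b \<otimes> b) \<le> nrm A a + r * r"
      using nrm_triangle[of a "b \<otimes> b"] nrm_mult_le[OF bc(1,1) bc(2,2)] a bc(1) by simp
    then have "nrm A (f b) \<le> r" using a bc(1) r by (simp add: f_def nrm_smult)
    moreover have "star A (f b) = f b" using a bc(1,3) by (simp add: f_def star_smult star_add star_mult)
    moreover have "c \<otimes> f b = f b \<otimes> c" if c: "c \<in> carrier A" "c \<otimes> a = a \<otimes> c" for c
    proof -
      have "c \<otimes> (b \<otimes> b) = (b \<otimes> b) \<otimes> c" using c bc(1) bc(4)[OF c] by (metis m_assoc)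
      then show ?thesis
        using c a bc(1) by (simp add: f_def smult_mult_left smult_mult_right l_distr r_distr)
    qed
    ultimately show ?thesis unfolding C_def using a bc(1) by (auto simp: f_def)
  qed
  moreover have "nrm A (f x \<ominus> f y) \<le> r * nrm A (x \<ominus> y)" if "x \<in> C" "y \<in> C" for x y
  proof -
    have c: "x \<in> carrier A" "nrm A x \<le> r" "y \<in> carrier A" "nrm A y \<le> r"
      using that by (auto simp: C_def)
    have "f x \<ominus> f y = (1/2) \<odot> (x \<otimes> x \<ominus> y \<otimes> y)"
      using a c by (simp add: f_def add_diff_add flip: smult_diff_right)
    \<comment> \<open>A difference of squares without commutativity; both terms have norm at most
      \<open>r * nrm A (x \<ominus> y)\<close>, and the factor 1/2 in \<open>f\<close> absorbs that
      there are two.\<close>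
    also have "x \<otimes> x \<ominus> y \<otimes> y = x \<otimes> (x \<ominus> y) \<oplus> (x \<ominus> y) \<otimes> y"
      using c by (simp add: diff_mult_left diff_mult_right diff_add_diff)
    finally have "nrm A (f x \<ominus> f y) = nrm A (x \<otimes> (x \<ominus> y) \<oplus> (x \<ominus> y) \<otimes> y) / 2"
      using c by (simp add: nrm_smult)
    moreover have "nrm A (x \<otimes> (x \<ominus> y)) \<le> r * nrm A (x \<ominus> y)" "nrm A ((x \<ominus> y) \<otimes> y) \<le> nrm A (x \<ominus> y) * r"
      using c by (auto intro!: nrm_mult_le)
    ultimately show ?thesis
      using nrm_triangle[of "x \<otimes> (x \<ominus> y)" "(x \<ominus> y) \<otimes> y"] c by (simp add: mult.commute[of _ r])
  qed
  ultimately obtain b where b: "b \<in> C" "f b = b" using contraction_fixpoint r(2) by blast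
  have bc: "b \<in> carrier A" "star A b = b"
      "\<And>c. c \<in> carrier A \<Longrightarrow> c \<otimes> a = a \<otimes> c \<Longrightarrow> c \<otimes> b = b \<otimes> c"
    using b by (auto simp: C_def)
  have "2 \<odot> f b = a \<oplus> b \<otimes> b" using a bc(1) by (simp add: f_def smult_smult)
  \<comment> \<open>The fixed-point equation in this form says that
    \<open>\<one> \<ominus> b\<close> squares to \<open>\<one> \<ominus> a\<close>, which the next
    computation extracts.\<close>
  then have fb: "b \<oplus> b = a \<oplus> b \<otimes> b" using b(2) bc(1) smult_add_left[of b 1 1] by simp
  have "(\<one> \<ominus> b) \<otimes> (\<one> \<ominus> b) \<oplus> (b \<oplus> b) = \<one> \<oplus> b \<otimes> b"
  proof -
    have "(\<one> \<ominus> b) \<otimes> (\<one> \<ominus> b) \<oplus> (b \<oplus> b) = ((\<one> \<ominus> b) \<ominus> (b \<ominus> b \<otimes> b) \<oplus> (b \<ominus> b \<otimes> b)) \<oplus> b \<oplus> b \<otimes> b"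
      using bc(1) by (simp add: diff_mult_left diff_mult_right a_assoc)
        (simp add: a_minus_def minus_add a_assoc a_lcomm[of "b \<otimes> b"] a_comm[of "b \<otimes> b"] r_neg1)
    then show ?thesis using bc(1) by simp
  qed
  then have "(\<one> \<ominus> b) \<otimes> (\<one> \<ominus> b) \<oplus> a \<oplus> b \<otimes> b = \<one> \<oplus> b \<otimes> b"
    unfolding fb using a bc(1) by (simp add: a_assoc)
  then have "(\<one> \<ominus> b) \<otimes> (\<one> \<ominus> b) \<oplus> a = \<one>"
    using a bc(1) by (subst (asm) add.right_cancel) auto
  then have "(\<one> \<ominus> b) \<otimes> (\<one> \<ominus> b) = \<one> \<ominus> a"
    using a bc(1) by (metis add.inv_solve_right' a_minus_def m_closed minus_closed one_closed)
  moreover have "c \<otimes> (\<one> \<ominus> b) = (\<one> \<ominus> b) \<otimes> c" if "c \<in> carrier A" "c \<otimes> a = a \<otimes> c" for c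
    using that bc(1) bc(3)[OF that] by (simp add: diff_mult_left diff_mult_right)
  ultimately show thesis using bc(1,2) by (intro that[of "\<one> \<ominus> b"]) (auto simp: star_diff)
qed

end

text \<open>A self-adjoint \<open>a\<close> of norm less than \<open>1\<close> is the real part of the unitary \<open>a + \<i> b\<close> with
  \<open>b\<^sup>2 = 1 - a\<^sup>2\<close>; homomorphisms preserve this situation, and unitaries have norm at most \<open>1\<close>.\<close>

lemma (in cstar_algebra) nrm_real_part_le:
  assumes a: "a \<in> carrier A" "star A a = a" and b: "b \<in> carrier A" "star A b = b"
    and ab: "a \<otimes> b = b \<otimes> a" and one: "a \<otimes> a \<oplus> b \<otimes> b = \<one>"
  shows "nrm A a \<le> 1"
proof -
  define u where "u = a \<oplus> \<i> \<odot> b"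
  have su: "star A u = a \<oplus> (- \<i>) \<odot> b" using a b by (simp add: u_def star_add star_smult)
  have "star A u \<otimes> u = a \<otimes> a \<oplus> (\<i> \<odot> (a \<otimes> b) \<oplus> (- \<i>) \<odot> (b \<otimes> a)) \<oplus> b \<otimes> b"
    unfolding su using a b
    by (simp add: u_def l_distr r_distr smult_mult_left smult_mult_right smult_smult smult_add_right a_assoc)
       (simp add: a_ac)
  also have "\<i> \<odot> (a \<otimes> b) \<oplus> (- \<i>) \<odot> (b \<otimes> a) = \<zero>"
    using a b by (simp add: ab smult_minus_left r_neg)
  finally have "star A u \<otimes> u = \<one>" using a b one by simp
  then have u: "u \<in> carrier A" "nrm A u \<le> 1" using a b nrm_unitary_le[of u] by (auto simp: u_def)
  have "u \<oplus> star A u = 2 \<odot> a"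
  proof -
    have "u \<oplus> star A u = (a \<oplus> a) \<oplus> (\<i> \<odot> b \<oplus> (- \<i>) \<odot> b)"
      unfolding su unfolding u_def using a b by (simp add: a_ac)
    also have "\<dots> = 2 \<odot> a" using a b smult_add_left[of a 1 1] by (simp add: smult_minus_left r_neg)
    finally show ?thesis .
  qed
  then have "2 * nrm A a = nrm A (u \<oplus> star A u)" using a by (simp add: nrm_smult)
  also have "\<dots> \<le> 2" using nrm_triangle[of u "star A u"] u by simp
  finally show ?thesis by simp
qed

lemma unital_star_hom_nrm_le:
  assumes A: "cstar_algebra A" and B: "cstar_algebra B" and h: "h \<in> unital_star_hom A B"
    and x: "x \<in> carrier A"
  shows "nrm B (h x) \<le> nrm A x"
proof -
  interpret A: cstar_algebra A by fact
  interpret B: cstar_algebra B by fact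
  have hom: "h \<in> ring_hom A B" and hs: "\<And>c x. x \<in> carrier A \<Longrightarrow> h (c \<odot>\<^bsub>A\<^esub> x) = c \<odot>\<^bsub>B\<^esub> h x"
    and hstar: "\<And>x. x \<in> carrier A \<Longrightarrow> h (star A x) = star B (h x)"
    using h by (auto simp: unital_star_hom_def)
  note hm = ring_hom_closed[OF hom] ring_hom_mult[OF hom] ring_hom_add[OF hom] ring_hom_one[OF hom] hstar
  have sa: "nrm B (h a) \<le> 1" if a: "a \<in> carrier A" "star A a = a" "nrm A a < 1" for a
  proof -
    have lt: "nrm A (a \<otimes>\<^bsub>A\<^esub> a) < 1"
      using A.nrm_mult[OF a(1,1)] a A.nrm_nonneg[OF a(1)] mult_strict_mono[of "nrm A a" 1 "nrm A a" 1]
      by fastforce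
    have aa: "star A (a \<otimes>\<^bsub>A\<^esub> a) = a \<otimes>\<^bsub>A\<^esub> a" using a by (simp add: A.star_mult)
    obtain b where b: "b \<in> carrier A" "star A b = b" "b \<otimes>\<^bsub>A\<^esub> b = \<one>\<^bsub>A\<^esub> \<ominus>\<^bsub>A\<^esub> a \<otimes>\<^bsub>A\<^esub> a"
      "\<And>c. c \<in> carrier A \<Longrightarrow> c \<otimes>\<^bsub>A\<^esub> (a \<otimes>\<^bsub>A\<^esub> a) = (a \<otimes>\<^bsub>A\<^esub> a) \<otimes>\<^bsub>A\<^esub> c \<Longrightarrow> c \<otimes>\<^bsub>A\<^esub> b = b \<otimes>\<^bsub>A\<^esub> c"
      by (rule A.sqrt_one_minus[OF A.m_closed[OF a(1,1)] aa lt]) blast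
    \<comment> \<open>\<open>b\<close> commutes with whatever commutes with
      \<open>a \<otimes> a\<close>, in particular with \<open>a\<close>; this is what makes
      \<open>h a\<close> the real part of a unitary.\<close>
    have ab: "a \<otimes>\<^bsub>A\<^esub> b = b \<otimes>\<^bsub>A\<^esub> a" using b(4)[OF a(1)] a by (simp add: A.m_assoc)
    have "a \<otimes>\<^bsub>A\<^esub> a \<oplus>\<^bsub>A\<^esub> b \<otimes>\<^bsub>A\<^esub> b = \<one>\<^bsub>A\<^esub>" 
      using a(1) b(1) A.a_comm[of "a \<otimes>\<^bsub>A\<^esub> a" "b \<otimes>\<^bsub>A\<^esub> b"] by (simp add: b(3))
    then have "h a \<otimes>\<^bsub>B\<^esub> h a \<oplus>\<^bsub>B\<^esub> h b \<otimes>\<^bsub>B\<^esub> h b = \<one>\<^bsub>B\<^esub>"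
      using a b(1) hm(2-4) by (metis A.m_closed)
    moreover have "h a \<otimes>\<^bsub>B\<^esub> h b = h b \<otimes>\<^bsub>B\<^esub> h a" using a(1) b(1) ab hm(2) by metis
    moreover have "star B (h a) = h a" "star B (h b) = h b" using hstar[OF a(1)] hstar[OF b(1)] a(2) b(2) by simp_all
    ultimately show ?thesis using B.nrm_real_part_le[of "h a" "h b"] hm(1)[OF a(1)] hm(1)[OF b(1)] by blast
  qed
  \<comment> \<open>The square root needs norm strictly below 1, hence the rescaling by every
    \<open>t\<close> above the norm. The C*-identity then passes from self-adjoint elements to
    all.\<close>
  have sa': "nrm B (h a) \<le> nrm A a" if a: "a \<in> carrier A" "star A a = a" for a
  proof (rule dense_ge)
    fix t assume t: "nrm A a < t"
    then have t0: "0 < t" using A.nrm_nonneg[OF a(1)] by simp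
    define c where "c = complex_of_real (1 / t)"
    have c: "cmod c = 1 / t" "cnj c = c" using t0 by (auto simp: c_def norm_divide)
    have "nrm B (h (c \<odot>\<^bsub>A\<^esub> a)) \<le> 1"
      by (rule sa) (use a t t0 c in \<open>auto simp: A.star_smult A.nrm_smult\<close>)
    then show "nrm B (h a) \<le> t" using a t0 hs hm(1) c by (simp add: B.nrm_smult)
  qed
  have "(nrm B (h x))\<^sup>2 = nrm B (h (star A x \<otimes>\<^bsub>A\<^esub> x))"
    using x hm by (simp add: B.cstar_identity)
  also have "\<dots> \<le> nrm A (star A x \<otimes>\<^bsub>A\<^esub> x)"
    using x by (intro sa') (auto simp: A.star_mult A.star_star)
  also have "\<dots> = (nrm A x)\<^sup>2" using x by (simp add: A.cstar_identity)
  finally show ?thesis using A.nrm_nonneg[OF x] by (simp add: power2_le_iff_abs_le)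
qed

text \<open>Here \<open>p\<close>, \<open>q\<close>, \<open>r\<close> stand for the values of a
  state at \<open>star A x \<otimes> x\<close>, \<open>x\<close> and \<open>star A x\<close>, and
  the hypothesis is positivity at \<open>x\<close> plus a multiple of \<open>\<one>\<close>. The
  values 1 and \<open>\<i>\<close> of \<open>t\<close> force \<open>r = cnj q\<close>; the
  minimising \<open>t = - cnj q\<close> then gives the Cauchy-Schwarz inequality against
  \<open>\<one>\<close>.\<close>

lemma cauchy_schwarz_unit:
  fixes p q r :: complex
  assumes "\<And>t. p + t * q + cnj t * r + t * cnj t \<in> \<real>\<^sub>\<ge>\<^sub>0"
  shows "(cmod q)\<^sup>2 \<le> Re p"
proof -
  have Rp: "p \<in> \<real>\<^sub>\<ge>\<^sub>0" using assms[of 0] by simp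
  have 1: "Im (q + r) = 0" and i: "Re q = Re r"
    using assms[of 1] assms[of \<i>] Rp by (auto simp: complex_nonneg_Reals_iff)
  then have r: "r = cnj q" by (auto simp: complex_eq_iff)
  have "p + (- cnj q) * q + cnj (- cnj q) * r + (- cnj q) * cnj (- cnj q) \<in> \<real>\<^sub>\<ge>\<^sub>0" by (rule assms)
  then have "p - of_real ((cmod q)\<^sup>2) \<in> \<real>\<^sub>\<ge>\<^sub>0"
    unfolding complex_norm_square by (simp add: r)
  then show ?thesis by (simp add: complex_nonneg_Reals_iff)
qed

context cstar_algebra
begin

section \<open>States and their bound by the norm\<close>

context
  fixes \<phi> assumes st: "state A \<phi>"
begin

lemma state_add: "x \<in> carrier A \<Longrightarrow> y \<in> carrier A \<Longrightarrow> \<phi> (x \<oplus> y) = \<phi> x + \<phi> y"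
  and state_smult: "x \<in> carrier A \<Longrightarrow> \<phi> (c \<odot> x) = c * \<phi> x"
  and state_pos: "x \<in> carrier A \<Longrightarrow> \<phi> (star A x \<otimes> x) \<in> \<real>\<^sub>\<ge>\<^sub>0"
  and state_one: "\<phi> \<one> = 1"
  using st by (auto simp: state_def)

lemma state_zero: "\<phi> \<zero> = 0"
  using state_smult[of \<zero> 0] by simp

lemma state_diff: "x \<in> carrier A \<Longrightarrow> y \<in> carrier A \<Longrightarrow> \<phi> (x \<ominus> y) = \<phi> x - \<phi> y"
  using state_add[of x "\<ominus> y"] by (simp add: a_minus_def minus_conv_smult state_smult)

text \<open>For self-adjoint \<open>a\<close> of norm below 1, \<open>\<one> \<ominus> a\<close> is
  the square of a self-adjoint element, so positivity bounds \<open>Re (\<phi> a)\<close> by 1.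
  Scaling and Cauchy-Schwarz against \<open>\<one>\<close> do the rest.\<close>

lemma state_nrm_le:
  assumes x: "x \<in> carrier A"
  shows "cmod (\<phi> x) \<le> nrm A x"
proof -
  have sa: "Re (\<phi> a) \<le> 1" if a: "a \<in> carrier A" "star A a = a" "nrm A a < 1" for a
  proof -
    obtain b where "b \<in> carrier A" "star A b = b" "b \<otimes> b = \<one> \<ominus> a"
      using sqrt_one_minus[OF a] by metis
    then have "\<phi> (\<one> \<ominus> a) \<in> \<real>\<^sub>\<ge>\<^sub>0" using state_pos[of b] by simp
    then show ?thesis using a by (simp add: state_diff state_one complex_nonneg_Reals_iff)
  qed
  have sa': "Re (\<phi> a) \<le> nrm A a" if a: "a \<in> carrier A" "star A a = a" for a
  proof (rule dense_ge)
    fix t assume t: "nrm A a < t"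
    then have t0: "0 < t" using nrm_nonneg[OF a(1)] by simp
    define c where "c = complex_of_real (1 / t)"
    have c: "cmod c = 1 / t" "cnj c = c" using t0 by (auto simp: c_def norm_divide)
    have "Re (\<phi> (c \<odot> a)) \<le> 1"
      by (rule sa) (use a t t0 c in \<open>auto simp: star_smult nrm_smult\<close>)
    then show "Re (\<phi> a) \<le> t" using a t0 by (simp add: state_smult c_def)
  qed
  have "(cmod (\<phi> x))\<^sup>2 \<le> Re (\<phi> (star A x \<otimes> x))"
  proof (rule cauchy_schwarz_unit)
    fix t
    have "star A (x \<oplus> cnj t \<odot> \<one>) \<otimes> (x \<oplus> cnj t \<odot> \<one>) =
        star A x \<otimes> x \<oplus> t \<odot> x \<oplus> cnj t \<odot> star A x \<oplus> (t * cnj t) \<odot> \<one>"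
      using x by (simp add: star_add star_smult l_distr r_distr smult_mult_left smult_mult_right
        smult_smult smult_add_right a_assoc) (simp add: a_ac mult.commute)
    then have "\<phi> (star A x \<otimes> x) + t * \<phi> x + cnj t * \<phi> (star A x) + t * cnj t =
        \<phi> (star A (x \<oplus> cnj t \<odot> \<one>) \<otimes> (x \<oplus> cnj t \<odot> \<one>))"
      using x by (simp add: state_add state_smult state_one)
    then show "\<phi> (star A x \<otimes> x) + t * \<phi> x + cnj t * \<phi> (star A x) + t * cnj t \<in> \<real>\<^sub>\<ge>\<^sub>0"
      using state_pos[of "x \<oplus> cnj t \<odot> \<one>"] x by simp
  qed
  also have "\<dots> \<le> nrm A (star A x \<otimes> x)"
    using x by (intro sa') (auto simp: star_mult star_star)
  also have "\<dots> = (nrm A x)\<^sup>2" using x by (simp add: cstar_identity)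
  finally show ?thesis using nrm_nonneg[OF x] by (simp add: power2_le_iff_abs_le)
qed

end

section \<open>Closed unital subalgebras\<close>

lemma subalgebra_cstar_algebra:
  assumes sub: "star_subalgebra B A" and one: "\<one> \<in> B" and cl: "closedin (cstar_topology A) B"
  shows "cstar_algebra (A\<lparr>carrier := B\<rparr>)"
proof -
  have B: "x \<in> carrier A" if "x \<in> B" for x using sub that by (auto simp: star_subalgebra_def)
  have neg: "\<ominus> x \<in> B" if "x \<in> B" for x
    using sub that B[OF that] by (simp add: star_subalgebra_def minus_conv_smult)
  let ?B = "A\<lparr>carrier := B\<rparr>"
  have "subring B A"
    by (rule subringI) (use sub one neg in \<open>auto simp: star_subalgebra_def\<close>)
  then have R: "ring ?B" by (rule subring_is_ring)
  have "submodule B ring_of_type_algebra A"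
    by (rule scalars.submoduleI) (use sub neg in \<open>auto simp: star_subalgebra_def\<close>)
  then have M: "Module.module (ring_of_type_algebra :: complex ring) ?B"
    by (rule submodule.submodule_is_module) (rule scalars.module_axioms)
  interpret B: ring ?B by (rule R)
  \<comment> \<open>The additive inverse is defined by means of the carrier, so inverses, and with
    them distances, have to be compared before completeness can be transferred.\<close>
  have inv: "\<ominus>\<^bsub>?B\<^esub> x = \<ominus> x" if "x \<in> B" for x
    using that neg[OF that] B[OF that] by (intro B.minus_equality) (auto simp: l_neg)
  have dist: "cstar_dist ?B x y = cstar_dist A x y" if "x \<in> B" "y \<in> B" for x y
    using that B by (simp add: cstar_dist_def a_minus_def inv)
  have ms: "Metric_space B (cstar_dist A)"
    using Metric_space.subspace[OF metric_space] B by blast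
  have ms': "Metric_space B (cstar_dist ?B)"
  proof
    fix x y z
    show "0 \<le> cstar_dist ?B x y" "cstar_dist ?B x y = cstar_dist ?B y x"
      using Metric_space.nonneg[OF metric_space] Metric_space.commute[OF metric_space] dist
      by (auto simp: cstar_dist_def)
    show "x \<in> B \<Longrightarrow> y \<in> B \<Longrightarrow> (cstar_dist ?B x y = 0) = (x = y)"
      using Metric_space.zero[OF ms] dist by simp
    show "x \<in> B \<Longrightarrow> y \<in> B \<Longrightarrow> z \<in> B \<Longrightarrow> cstar_dist ?B x z \<le> cstar_dist ?B x y + cstar_dist ?B y z"
      using Metric_space.triangle[OF ms] dist by simp
  qed
  interpret M: Metric_space B "cstar_dist A" by (rule ms)
  interpret M': Metric_space B "cstar_dist ?B" by (rule ms')
  have "M'.mcomplete"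
    unfolding M'.mcomplete_def
  proof (intro allI impI)
    fix f assume f: "M'.MCauchy f"
    then have rf: "range f \<subseteq> B" by (simp add: M'.MCauchy_def)
    then have "cstar_dist ?B (f m) (f n) = cstar_dist A (f m) (f n)" for m n
      using dist by (simp add: image_subset_iff)
    with f have "M.MCauchy f"
      by (simp add: M'.MCauchy_def M.MCauchy_def)
    then obtain x where x: "limitin M.mtopology f x sequentially"
      using complete_closedin[OF cl] M.mcomplete_def by blast
    have "limitin M'.mtopology f x sequentially"
      using x rf dist unfolding M.limit_metric_sequentially M'.limit_metric_sequentially
      by (simp add: image_subset_iff)
    then show "\<exists>x. limitin M'.mtopology f x sequentially" by blast
  qed
  then have C: "Metric_space.mcomplete (carrier ?B) (cstar_dist ?B)" by simp
  show ?thesis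
    by (intro cstar_algebra.intro cstar_algebra_axioms.intro R M C)
      (use sub B in \<open>auto simp: star_subalgebra_def smult_mult_left smult_mult_right star_star
        star_add star_smult star_mult nrm_nonneg nrm_eq_0_iff nrm_triangle nrm_smult nrm_mult
        cstar_identity\<close>)
qed

lemma subalgebra_minus:
  assumes sub: "cstar_algebra (A\<lparr>carrier := B\<rparr>)" "B \<subseteq> carrier A" and x: "x \<in> B" "y \<in> B"
  shows "x \<ominus>\<^bsub>A\<lparr>carrier := B\<rparr>\<^esub> y = x \<ominus> y"
proof -
  interpret B: cstar_algebra "A\<lparr>carrier := B\<rparr>" by fact
  have "\<ominus>\<^bsub>A\<lparr>carrier := B\<rparr>\<^esub> y = \<ominus> y"
    using B.minus_conv_smult[of y] minus_conv_smult[of y] x sub(2) by auto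
  then show ?thesis by (simp add: a_minus_def)
qed

end

section \<open>Linear spans and closures\<close>

text \<open>The carrier does not occur in the rules, so that a span is the same set in
  \<open>A\<close> and in a subalgebra; induction over the rules replaces the handling of
  coefficients.\<close>

inductive_set lin_span :: "'a cstar_alg \<Rightarrow> 'a set \<Rightarrow> 'a set" for A G where
  zero: "\<zero>\<^bsub>A\<^esub> \<in> lin_span A G"
| base: "x \<in> G \<Longrightarrow> x \<in> lin_span A G"
| add: "x \<in> lin_span A G \<Longrightarrow> y \<in> lin_span A G \<Longrightarrow> x \<oplus>\<^bsub>A\<^esub> y \<in> lin_span A G"
| smult: "x \<in> lin_span A G \<Longrightarrow> c \<odot>\<^bsub>A\<^esub> x \<in> lin_span A G"

lemma lin_span_least:
  assumes "G \<subseteq> lin_span A Y" shows "lin_span A G \<subseteq> lin_span A Y"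
proof
  fix x assume "x \<in> lin_span A G"
  then show "x \<in> lin_span A Y"
    by induction (use assms in \<open>auto intro: lin_span.intros\<close>)
qed

lemma lin_span_mono: "G \<subseteq> Y \<Longrightarrow> lin_span A G \<subseteq> lin_span A Y"
  by (rule lin_span_least) (auto intro: lin_span.base)

lemma lin_span_finite_support:
  "x \<in> lin_span A G \<Longrightarrow> \<exists>Y. finite Y \<and> Y \<subseteq> G \<and> x \<in> lin_span A Y"
proof (induction rule: lin_span.induct)
  case zero
  then show ?case by (intro exI[of _ "{}"]) (auto intro: lin_span.zero)
next
  case (base x)
  then show ?case by (intro exI[of _ "{x}"]) (auto intro: lin_span.base)
next
  case (add x y)
  then obtain Y Z where "finite Y" "Y \<subseteq> G" "x \<in> lin_span A Y" "finite Z" "Z \<subseteq> G" "y \<in> lin_span A Z"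
    by blast
  then show ?case using lin_span_mono[of Y "Y \<union> Z" A] lin_span_mono[of Z "Y \<union> Z" A]
    by (intro exI[of _ "Y \<union> Z"]) (auto intro: lin_span.add)
next
  case (smult x c)
  then show ?case by (auto intro: lin_span.smult)
qed

lemma lin_span_carrier_update: "lin_span (A\<lparr>carrier := B\<rparr>) G = lin_span A G"
proof -
  have "x \<in> lin_span A G" if "x \<in> lin_span (A\<lparr>carrier := B\<rparr>) G" for x
    using that by induction (auto intro: lin_span.intros)
  moreover have "x \<in> lin_span (A\<lparr>carrier := B\<rparr>) G" if "x \<in> lin_span A G" for x
    using that
  proof induction
    case zero
    show ?case using lin_span.zero[of "A\<lparr>carrier := B\<rparr>" G] by simp
  next
    case (base x)
    then show ?case by (rule lin_span.base)
  next
    case (add x y)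
    then show ?case using lin_span.add[of x "A\<lparr>carrier := B\<rparr>" G y] by simp
  next
    case (smult x c)
    then show ?case using lin_span.smult[of x "A\<lparr>carrier := B\<rparr>" G c] by simp
  qed
  ultimately show ?thesis by blast
qed

context cstar_algebra
begin

lemma lin_span_carrier:
  assumes "G \<subseteq> carrier A" "x \<in> lin_span A G" shows "x \<in> carrier A"
  using assms(2) by induction (use assms(1) in auto)

lemma lin_span_finsum:
  assumes "finite I" "G \<subseteq> carrier A" "\<And>i. i \<in> I \<Longrightarrow> f i \<in> lin_span A G"
  shows "finsum A f I \<in> lin_span A G"
  using assms(1,3)
proof (induction I)
  case (insert i I)
  then have "finsum A f (insert i I) = f i \<oplus> finsum A f I"
    using lin_span_carrier[OF assms(2)] by (intro finsum_insert) auto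
  moreover have "f i \<in> lin_span A G" "finsum A f I \<in> lin_span A G" using insert by auto
  ultimately show ?case by (simp add: lin_span.add)
qed (auto intro: lin_span.zero)

text \<open>Indexed coefficients are wanted where the vectors form an orthonormal family;
  \<open>f\<close> need not be injective.\<close>

lemma lin_span_representation:
  assumes I: "finite I" and f: "\<And>i. i \<in> I \<Longrightarrow> f i \<in> carrier A" and x: "x \<in> lin_span A (f ` I)"
  obtains c where "x = (\<Oplus>i\<in>I. c i \<odot> f i)"
proof -
  have fc: "(\<lambda>i. c i \<odot> f i) \<in> I \<rightarrow> carrier A" for c using f by auto
  have "\<exists>c. x = (\<Oplus>i\<in>I. c i \<odot> f i)"
    using x
  proof induction
    case zero
    have "(\<Oplus>i\<in>I. 0 \<odot> f i) = \<zero>" using f by (intro add.finprod_one_eqI) auto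
    then show ?case by (intro exI[of _ "\<lambda>_. 0"]) (rule sym)
  next
    case (base x)
    then obtain j where j: "j \<in> I" "x = f j" by blast
    have "(\<Oplus>i\<in>I. (if j = i then 1 else 0) \<odot> f i) = (\<Oplus>i\<in>I. if j = i then f i else \<zero>)"
      using f by (intro add.finprod_cong') auto
    also have "\<dots> = x" using j I f by (subst add.finprod_singleton) auto
    finally show ?case by (intro exI[of _ "\<lambda>i. if j = i then 1 else 0"]) (rule sym)
  next
    case (add x y)
    then obtain c e where "x = (\<Oplus>i\<in>I. c i \<odot> f i)" "y = (\<Oplus>i\<in>I. e i \<odot> f i)" by blast
    then have "x \<oplus> y = (\<Oplus>i\<in>I. c i \<odot> f i \<oplus> e i \<odot> f i)"
      using finsum_addf[OF fc fc] by simp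
    also have "\<dots> = (\<Oplus>i\<in>I. (c i + e i) \<odot> f i)"
      using f by (intro add.finprod_cong') (auto simp: smult_add_left)
    finally show ?case by (rule exI[of _ "\<lambda>i. c i + e i"])
  next
    case (smult x a)
    then obtain c where "x = (\<Oplus>i\<in>I. c i \<odot> f i)" by blast
    then have "a \<odot> x = (\<Oplus>i\<in>I. a \<odot> (c i \<odot> f i))"
      using scalars.finsum_smult_ldistr[OF I _ fc, of a] by (simp add: ring_of_type_algebra_def)
    also have "\<dots> = (\<Oplus>i\<in>I. (a * c i) \<odot> f i)"
      using f by (intro add.finprod_cong') (auto simp: smult_smult)
    finally show ?case by (rule exI[of _ "\<lambda>i. a * c i"])
  qed
  then show thesis using that by blast
qed

lemma lin_span_finite_dimensional:
  assumes "finite G" "G \<subseteq> carrier A" shows "finite_dimensional A (lin_span A G)"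
  unfolding finite_dimensional_def
proof (intro exI[of _ G] conjI subsetI)
  fix x assume "x \<in> lin_span A G"
  then obtain c where "x = (\<Oplus>b\<in>G. c b \<odot> b)"
    using lin_span_representation[OF assms(1), of "\<lambda>x. x" x] assms(2) by auto
  then show "x \<in> {\<Oplus>b\<in>G. c b \<odot> b |c. True}" by blast
qed (insert assms, auto intro: lin_span.base)

text \<open>Three spans are kept apart because a column times a row is a matrix, whereas a row times
  a column is a scalar.\<close>

lemma lin_span_mult:
  assumes G: "G \<subseteq> carrier A" and Y: "Y \<subseteq> carrier A"
    and GY: "\<And>x y. x \<in> G \<Longrightarrow> y \<in> Y \<Longrightarrow> x \<otimes> y \<in> lin_span A Z"
    and x: "x \<in> lin_span A G" and y: "y \<in> lin_span A Y"
  shows "x \<otimes> y \<in> lin_span A Z"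
proof -
  have 1: "x \<otimes> y \<in> lin_span A Z" if x: "x \<in> G" for x
    using y
  proof induction
    case (add u v)
    then show ?case using G Y x lin_span_carrier[OF Y]
      by (auto simp: r_distr subset_iff intro!: lin_span.add)
  next
    case (smult u c)
    then show ?case using G Y x lin_span_carrier[OF Y]
      by (auto simp: smult_mult_right subset_iff intro!: lin_span.smult)
  qed (use G x GY in \<open>auto simp: subset_iff intro: lin_span.zero\<close>)
  have yc: "y \<in> carrier A" using lin_span_carrier[OF Y y] .
  show ?thesis
    using x
  proof induction
    case (add u v)
    then show ?case using G yc lin_span_carrier[OF G]
      by (auto simp: l_distr subset_iff intro!: lin_span.add)
  next
    case (smult u c)
    then show ?case using G yc lin_span_carrier[OF G]
      by (auto simp: smult_mult_left subset_iff intro!: lin_span.smult)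
  qed (use yc 1 in \<open>auto intro: lin_span.zero\<close>)
qed

lemma lin_span_star:
  assumes G: "G \<subseteq> carrier A" and GY: "\<And>x. x \<in> G \<Longrightarrow> star A x \<in> lin_span A Y"
    and x: "x \<in> lin_span A G"
  shows "star A x \<in> lin_span A Y"
  using x
proof induction
  case (add u v)
  then show ?case using lin_span_carrier[OF G] by (auto simp: star_add intro!: lin_span.add)
next
  case (smult u c)
  then show ?case using lin_span_carrier[OF G] by (auto simp: star_smult intro!: lin_span.smult)
qed (use GY in \<open>auto intro: lin_span.zero\<close>)

lemma lin_span_star_subalgebra:
  assumes G: "G \<subseteq> carrier A" and "\<And>x. x \<in> G \<Longrightarrow> star A x \<in> lin_span A G"
    and "\<And>x y. x \<in> G \<Longrightarrow> y \<in> G \<Longrightarrow> x \<otimes> y \<in> lin_span A G"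
  shows "star_subalgebra (lin_span A G) A"
  unfolding star_subalgebra_def
proof (intro conjI ballI allI subsetI)
  fix x y assume xy: "x \<in> lin_span A G" "y \<in> lin_span A G"
  show "x \<oplus> y \<in> lin_span A G" using xy by (rule lin_span.add)
  show "x \<otimes> y \<in> lin_span A G" using lin_span_mult[OF G G _ xy] assms(3) by blast
next
  fix x assume "x \<in> lin_span A G"
  then show "star A x \<in> lin_span A G" using lin_span_star[OF G assms(2)] by blast
qed (auto intro: lin_span_carrier[OF G] lin_span.zero lin_span.smult)

lemma closure_star_subalgebra:
  assumes B: "star_subalgebra B A"
  defines "C \<equiv> {x \<in> carrier A. \<forall>e>0. \<exists>y\<in>B. nrm A (x \<ominus> y) < e}"
  shows "star_subalgebra C A" "closedin (cstar_topology A) C"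
proof -
  have Bc: "y \<in> carrier A" if "y \<in> B" for y using B that by (auto simp: star_subalgebra_def)
  have approx: "\<exists>y\<in>B. nrm A (x \<ominus> y) < e" if "x \<in> C" "0 < e" for x e using that by (auto simp: C_def)
  have Cc: "x \<in> carrier A" if "x \<in> C" for x using that by (auto simp: C_def)
  have CI: "x \<in> C" if "x \<in> carrier A" "\<And>e. 0 < e \<Longrightarrow> \<exists>y\<in>B. nrm A (x \<ominus> y) < e" for x
    using that by (simp add: C_def)
  have "\<zero> \<in> C" by (rule CI) (use B in \<open>auto simp: star_subalgebra_def intro!: bexI[of _ \<zero>]\<close>)
  moreover have "x \<oplus> y \<in> C" if inC: "x \<in> C" "y \<in> C" for x y
  proof (rule CI)
    fix e :: real assume e: "0 < e"
    obtain u v where uv: "u \<in> B" "nrm A (x \<ominus> u) < e / 2" "v \<in> B" "nrm A (y \<ominus> v) < e / 2"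
      using approx[OF inC(1), of "e/2"] approx[OF inC(2), of "e/2"] e by auto
    have "nrm A ((x \<oplus> y) \<ominus> (u \<oplus> v)) < e"
      using nrm_triangle[of "x \<ominus> u" "y \<ominus> v"] uv inC[THEN Cc] Bc by (simp add: add_diff_add)
    then show "\<exists>z\<in>B. nrm A ((x \<oplus> y) \<ominus> z) < e"
      using uv B by (auto simp: star_subalgebra_def)
  qed (use inC Cc in auto)
  moreover have "x \<otimes> y \<in> C" if inC: "x \<in> C" "y \<in> C" for x y
  proof (rule CI)
    fix e :: real assume e: "0 < e"
    \<comment> \<open>\<open>K\<close> exceeds \<open>nrm A x\<close> and also bounds
      \<open>nrm A v\<close>, as \<open>v\<close> is chosen within 1 of \<open>y\<close>.\<close>
    define K where "K = nrm A x + nrm A y + 1"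
    have K: "0 < K" using inC[THEN Cc] nrm_nonneg[of x] nrm_nonneg[of y] by (simp add: K_def)
    obtain v where v: "v \<in> B" "nrm A (y \<ominus> v) < min 1 (e / (2 * K))"
      using approx[OF inC(2), of "min 1 (e / (2 * K))"] e K by auto
    obtain u where u: "u \<in> B" "nrm A (x \<ominus> u) < e / (2 * K)"
      using approx[OF inC(1), of "e / (2 * K)"] e K by auto
    have c: "x \<in> carrier A" "y \<in> carrier A" "u \<in> carrier A" "v \<in> carrier A"
      using inC[THEN Cc] u v Bc by auto
    have "nrm A v \<le> K" using nrm_le_add_diff[of v y] nrm_diff_commute[of v y] nrm_nonneg[of x] v c
      by (simp add: K_def)
    then have "nrm A ((x \<ominus> u) \<otimes> v) \<le> e / (2 * K) * K"
      using c u by (intro nrm_mult_le) auto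
    moreover have "nrm A (x \<otimes> (y \<ominus> v)) < K * (e / (2 * K))"
    proof -
      have "nrm A (x \<otimes> (y \<ominus> v)) \<le> nrm A x * nrm A (y \<ominus> v)" using c by (simp add: nrm_mult)
      also have "\<dots> \<le> nrm A x * (e / (2 * K))"
        using v nrm_nonneg[of x] c by (intro mult_left_mono) auto
      also have "\<dots> < K * (e / (2 * K))"
        using e K nrm_nonneg[of y] c by (intro mult_strict_right_mono) (auto simp: K_def)
      finally show ?thesis .
    qed
    moreover have "x \<otimes> y \<ominus> u \<otimes> v = x \<otimes> (y \<ominus> v) \<oplus> (x \<ominus> u) \<otimes> v"
      using c by (simp add: diff_mult_left diff_mult_right diff_add_diff)
    ultimately have "nrm A (x \<otimes> y \<ominus> u \<otimes> v) < e"
      using nrm_triangle[of "x \<otimes> (y \<ominus> v)" "(x \<ominus> u) \<otimes> v"] c K by simp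
    then show "\<exists>z\<in>B. nrm A (x \<otimes> y \<ominus> z) < e"
      using u v B by (auto simp: star_subalgebra_def)
  qed (use inC Cc in auto)
  moreover have "c \<odot> x \<in> C" if inC: "x \<in> C" for c x
  proof (rule CI)
    fix e :: real assume e: "0 < e"
    obtain u where u: "u \<in> B" "nrm A (x \<ominus> u) < e / (cmod c + 1)"
      using approx[OF inC, of "e / (cmod c + 1)"] e by (auto simp: add_nonneg_pos)
    have uc: "x \<in> carrier A" "u \<in> carrier A" using u inC Cc Bc by auto
    have "nrm A (c \<odot> x \<ominus> c \<odot> u) = cmod c * nrm A (x \<ominus> u)"
      using uc by (simp add: nrm_smult flip: smult_diff_right)
    also have "\<dots> \<le> (cmod c + 1) * nrm A (x \<ominus> u)"
      using uc nrm_nonneg[of "x \<ominus> u"] by (intro mult_right_mono) auto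
    also have "\<dots> < e"
    proof -
      have "0 < cmod c + 1" by (simp add: add_nonneg_pos)
      then show ?thesis using u(2) by (simp only: pos_less_divide_eq mult.commute)
    qed
    finally show "\<exists>z\<in>B. nrm A (c \<odot> x \<ominus> z) < e"
      using u B by (auto simp: star_subalgebra_def)
  qed (use inC Cc in auto)
  moreover have "star A x \<in> C" if inC: "x \<in> C" for x
  proof (rule CI)
    fix e :: real assume e: "0 < e"
    obtain u where u: "u \<in> B" "nrm A (x \<ominus> u) < e" using approx[OF inC e] by blast
    then have "nrm A (star A x \<ominus> star A u) < e"
      using inC Cc Bc by (simp flip: star_diff)
    then show "\<exists>z\<in>B. nrm A (star A x \<ominus> z) < e"
      using u B by (auto simp: star_subalgebra_def)
  qed (use inC Cc in auto)
  ultimately show "star_subalgebra C A" using Cc by (auto simp: star_subalgebra_def)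
  show "closedin (cstar_topology A) C"
  proof (rule closedinI)
    fix x assume x: "x \<in> carrier A" and ap: "\<And>e. 0 < e \<Longrightarrow> \<exists>y\<in>C. nrm A (x \<ominus> y) < e"
    show "x \<in> C"
    proof (rule CI[OF x])
      fix e :: real assume e: "0 < e"
      obtain y where y: "y \<in> C" "nrm A (x \<ominus> y) < e / 2" using ap[of "e / 2"] e by auto
      obtain z where z: "z \<in> B" "nrm A (y \<ominus> z) < e / 2" using approx[OF y(1), of "e / 2"] e by auto
      have "nrm A (x \<ominus> z) < e"
        using nrm_diff_triangle[of x y z] x y z Cc Bc by simp
      then show "\<exists>z\<in>B. nrm A (x \<ominus> z) < e" using z by blast
    qed
  qed (use Cc in auto)
qed

text \<open>Estimates at the single point \<open>x\<close> suffice, so the lemma serves for one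
  variable of a product as well as for states.\<close>

lemma eq_on_dense:
  fixes f g :: "'a \<Rightarrow> complex"
  assumes B: "B \<subseteq> carrier A" and dense: "\<And>e. 0 < e \<Longrightarrow> \<exists>y\<in>B. nrm A (x \<ominus> y) < e"
    and x: "x \<in> carrier A" and eq: "\<And>y. y \<in> B \<Longrightarrow> f y = g y"
    and f: "\<And>y. y \<in> carrier A \<Longrightarrow> cmod (f x - f y) \<le> K * nrm A (x \<ominus> y)"
    and g: "\<And>y. y \<in> carrier A \<Longrightarrow> cmod (g x - g y) \<le> M * nrm A (x \<ominus> y)"
  shows "f x = g x"
proof -
  have "cmod (f x - g x) \<le> 0 + e" if e: "0 < e" for e
  proof -
    define N where "N = max 1 (K + M)"
    obtain y where y: "y \<in> B" "nrm A (x \<ominus> y) < e / N"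
      using dense[of "e / N"] e by (auto simp: N_def)
    have yc: "y \<in> carrier A" using y B by auto
    have "cmod (f x - g x) = cmod ((f x - f y) - (g x - g y))" using eq y by simp
    also have "\<dots> \<le> cmod (f x - f y) + cmod (g x - g y)" by (rule norm_triangle_ineq4)
    also have "\<dots> \<le> (K + M) * nrm A (x \<ominus> y)" using f[OF yc] g[OF yc] by (simp add: algebra_simps)
    also have "\<dots> \<le> N * nrm A (x \<ominus> y)"
      using x yc by (intro mult_right_mono) (auto simp: N_def nrm_nonneg)
    also have "\<dots> \<le> e" using y(2) by (simp add: N_def field_simps)
    finally show ?thesis by simp
  qed
  then have "cmod (f x - g x) \<le> 0" by (rule field_le_epsilon)
  then show ?thesis by simp
qed

end

section \<open>Words in a Cuntz family\<close>

locale weighted_cuntz_family = cstar_algebra A for A :: "'a cstar_alg" (structure) +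
  fixes d :: nat and s :: "nat \<Rightarrow> 'a" and L :: "nat \<Rightarrow> nat"
  assumes family: "cuntz_family d A s"
    and nonzero: "\<one> \<noteq> \<zero>"
    and weight_pos: "i \<in> {1..d} \<Longrightarrow> 0 < L i"
begin

section \<open>Products of words and of the elements \<open>unit \<alpha> \<gamma>\<close>\<close>

lemma gen_closed [simp, intro]: "i \<in> {1..d} \<Longrightarrow> s i \<in> carrier A"
  using family by (simp add: cuntz_family_def)

lemma star_gen_gen:
  "i \<in> {1..d} \<Longrightarrow> j \<in> {1..d} \<Longrightarrow> star A (s i) \<otimes> s j = (if i = j then \<one> else \<zero>)"
  using family by (simp add: cuntz_family_def)

lemma sum_gen: "(\<Oplus>i\<in>{1..d}. s i \<otimes> star A (s i)) = \<one>"
  using family by (simp add: cuntz_family_def)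

lemma mult_eq_finsum:
  assumes "x \<in> carrier A" "y \<in> carrier A"
  shows "x \<otimes> y = (\<Oplus>i\<in>{1..d}. (x \<otimes> s i) \<otimes> (star A (s i) \<otimes> y))"
proof -
  have c: "(\<lambda>i. s i \<otimes> star A (s i)) \<in> {1..d} \<rightarrow> carrier A" by auto
  have "x \<otimes> y = x \<otimes> (\<Oplus>i\<in>{1..d}. s i \<otimes> star A (s i)) \<otimes> y" using assms sum_gen by simp
  also have "\<dots> = (\<Oplus>i\<in>{1..d}. x \<otimes> (s i \<otimes> star A (s i))) \<otimes> y"
    using finsum_rdistr[OF _ assms(1) c] by simp
  also have "\<dots> = (\<Oplus>i\<in>{1..d}. x \<otimes> (s i \<otimes> star A (s i)) \<otimes> y)"
    using assms by (intro finsum_ldistr) auto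
  also have "\<dots> = (\<Oplus>i\<in>{1..d}. (x \<otimes> s i) \<otimes> (star A (s i) \<otimes> y))"
    using assms by (intro finsum_cong') (auto simp: m_assoc)
  finally show ?thesis .
qed

definition words :: "nat list set" where "words = lists {1..d}"

lemma words_simps [simp]:
  "[] \<in> words" "i # \<alpha> \<in> words \<longleftrightarrow> i \<in> {1..d} \<and> \<alpha> \<in> words"
  "\<alpha> @ \<gamma> \<in> words \<longleftrightarrow> \<alpha> \<in> words \<and> \<gamma> \<in> words"
  by (auto simp: words_def)

lemma words_butlast: "\<alpha> \<in> words \<Longrightarrow> butlast \<alpha> \<in> words"
  by (auto simp: words_def dest: in_set_butlastD)

abbreviation w :: "nat list \<Rightarrow> 'a" where "w \<equiv> word A s"

abbreviation unit :: "nat list \<Rightarrow> nat list \<Rightarrow> 'a" where "unit \<alpha> \<gamma> \<equiv> w \<alpha> \<otimes> star A (w \<gamma>)"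

definition weight :: "nat list \<Rightarrow> nat" where "weight \<alpha> = (\<Sum>i\<leftarrow>\<alpha>. L i)"

lemma weight_simps [simp]:
  "weight [] = 0" "weight (i # \<alpha>) = L i + weight \<alpha>" "weight (\<alpha> @ \<gamma>) = weight \<alpha> + weight \<gamma>"
  by (auto simp: weight_def)

lemma word_Nil [simp]: "w [] = \<one>" by (simp add: word_def)

lemma word_Cons: "w (i # \<alpha>) = s i \<otimes> w \<alpha>" by (simp add: word_def)

lemma word_closed [simp, intro]: "\<alpha> \<in> words \<Longrightarrow> w \<alpha> \<in> carrier A"
  by (induction \<alpha>) (auto simp: word_Cons)

lemma unit_closed [simp, intro]: "\<alpha> \<in> words \<Longrightarrow> \<gamma> \<in> words \<Longrightarrow> unit \<alpha> \<gamma> \<in> carrier A"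
  by simp

lemma word_append: "\<alpha> \<in> words \<Longrightarrow> \<gamma> \<in> words \<Longrightarrow> w (\<alpha> @ \<gamma>) = w \<alpha> \<otimes> w \<gamma>"
  by (induction \<alpha>) (auto simp: word_Cons m_assoc)

lemma word_snoc: "\<alpha> \<in> words \<Longrightarrow> i \<in> {1..d} \<Longrightarrow> w (\<alpha> @ [i]) = w \<alpha> \<otimes> s i"
  by (simp add: word_append word_Cons)

lemma star_word_Cons_word_Cons:
  assumes "i \<in> {1..d}" "j \<in> {1..d}" "\<alpha> \<in> words" "\<gamma> \<in> words"
  shows "star A (w (i # \<alpha>)) \<otimes> w (j # \<gamma>) = (if i = j then star A (w \<alpha>) \<otimes> w \<gamma> else \<zero>)"
proof -
  have "star A (w (i # \<alpha>)) \<otimes> w (j # \<gamma>) = star A (w \<alpha>) \<otimes> (star A (s i) \<otimes> s j) \<otimes> w \<gamma>"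
    using assms by (simp add: word_Cons star_mult m_assoc)
  then show ?thesis using assms by (simp add: star_gen_gen)
qed

lemma star_word_word [simp]: "\<alpha> \<in> words \<Longrightarrow> star A (w \<alpha>) \<otimes> w \<alpha> = \<one>"
  by (induction \<alpha>) (auto simp: star_word_Cons_word_Cons)

lemma star_unit: "\<alpha> \<in> words \<Longrightarrow> \<gamma> \<in> words \<Longrightarrow> star A (unit \<alpha> \<gamma>) = unit \<gamma> \<alpha>"
  by (simp add: star_mult star_star)

lemma unit_mult_unit:
  assumes "\<alpha> \<in> words" "\<gamma> \<in> words" "\<mu> \<in> words" "\<nu> \<in> words"
  shows "unit \<alpha> \<gamma> \<otimes> unit \<mu> \<nu> = w \<alpha> \<otimes> (star A (w \<gamma>) \<otimes> w \<mu>) \<otimes> star A (w \<nu>)"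
  using assms by (simp add: m_assoc)

lemma unit_mult_unit_same:
  assumes "\<alpha> \<in> words" "\<gamma> \<in> words" "\<nu> \<in> words"
  shows "unit \<alpha> \<gamma> \<otimes> unit \<gamma> \<nu> = unit \<alpha> \<nu>"
  using assms by (simp add: unit_mult_unit)

text \<open>The sum of the \<open>s i \<otimes> star A (s i)\<close> is inserted between the two
  words. This splitting embeds each matrix algebra in the next and makes the values of a trace
  harmonic.\<close>

lemma unit_eq_finsum:
  assumes "\<alpha> \<in> words" "\<gamma> \<in> words"
  shows "unit \<alpha> \<gamma> = (\<Oplus>i\<in>{1..d}. unit (\<alpha> @ [i]) (\<gamma> @ [i]))"
proof -
  have "unit \<alpha> \<gamma> = (\<Oplus>i\<in>{1..d}. (w \<alpha> \<otimes> s i) \<otimes> (star A (s i) \<otimes> star A (w \<gamma>)))"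
    using assms by (intro mult_eq_finsum) auto
  also have "\<dots> = (\<Oplus>i\<in>{1..d}. unit (\<alpha> @ [i]) (\<gamma> @ [i]))"
    using assms by (intro finsum_cong') (auto simp: word_snoc star_mult)
  finally show ?thesis .
qed

lemma nrm_isometry: "x \<in> carrier A \<Longrightarrow> star A x \<otimes> x = \<one> \<Longrightarrow> nrm A x = 1"
  using cstar_identity[of x] nrm_one[OF nonzero] nrm_nonneg[of x] by (simp add: power2_eq_1_iff)

lemma nrm_word [simp]: "\<alpha> \<in> words \<Longrightarrow> nrm A (w \<alpha>) = 1"
  by (rule nrm_isometry) auto

text \<open>Equal first letters cancel and different ones give \<open>\<zero>\<close>; without a
  mismatch one word is a prefix of the other, and the remainder of the longer one survives.\<close>

lemma star_word_word_cases:
  assumes "\<gamma> \<in> words" "\<mu> \<in> words"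
  shows "star A (w \<gamma>) \<otimes> w \<mu> = \<zero> \<or>
    (\<exists>\<kappa>\<in>words. \<mu> = \<gamma> @ \<kappa> \<and> star A (w \<gamma>) \<otimes> w \<mu> = w \<kappa>) \<or>
    (\<exists>\<kappa>\<in>words. \<gamma> = \<mu> @ \<kappa> \<and> star A (w \<gamma>) \<otimes> w \<mu> = star A (w \<kappa>))"
  using assms
proof (induction \<gamma> arbitrary: \<mu>)
  case Nil
  then show ?case by auto
next
  case (Cons i \<gamma>)
  show ?case
  proof (cases \<mu>)
    case Nil
    then show ?thesis using Cons.prems by auto
  next
    case (Cons j \<nu>)
    then show ?thesis using Cons.IH[of \<nu>] Cons.prems \<open>i # \<gamma> \<in> words\<close>
      by (auto simp: star_word_Cons_word_Cons)
  qed
qed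

section \<open>The span of the units and its density\<close>

definition units :: "'a set" where "units = {unit \<alpha> \<gamma> |\<alpha> \<gamma>. \<alpha> \<in> words \<and> \<gamma> \<in> words}"

lemma unit_in_units: "\<alpha> \<in> words \<Longrightarrow> \<gamma> \<in> words \<Longrightarrow> unit \<alpha> \<gamma> \<in> units"
  unfolding units_def by blast

lemma units_closed: "units \<subseteq> carrier A" by (auto simp: units_def)

lemma units_mult:
  assumes "\<alpha> \<in> words" "\<gamma> \<in> words" "\<mu> \<in> words" "\<nu> \<in> words"
  shows "unit \<alpha> \<gamma> \<otimes> unit \<mu> \<nu> \<in> insert \<zero> units"
proof -
  consider "star A (w \<gamma>) \<otimes> w \<mu> = \<zero>"
    | \<kappa> where "\<kappa> \<in> words" "star A (w \<gamma>) \<otimes> w \<mu> = w \<kappa>"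
    | \<kappa> where "\<kappa> \<in> words" "star A (w \<gamma>) \<otimes> w \<mu> = star A (w \<kappa>)"
    using star_word_word_cases[OF assms(2,3)] by blast
  then show ?thesis
  proof cases
    case 1
    then show ?thesis using assms by (simp add: unit_mult_unit)
  next
    case 2
    then have "unit \<alpha> \<gamma> \<otimes> unit \<mu> \<nu> = unit (\<alpha> @ \<kappa>) \<nu>"
      using assms by (simp add: unit_mult_unit word_append)
    then show ?thesis using assms 2 unit_in_units[of "\<alpha> @ \<kappa>" \<nu>] by simp
  next
    case 3
    then have "unit \<alpha> \<gamma> \<otimes> unit \<mu> \<nu> = unit \<alpha> (\<nu> @ \<kappa>)"
      unfolding unit_mult_unit[OF assms] using assms by (simp add: word_append star_mult m_assoc)
    then show ?thesis using assms 3 unit_in_units[of \<alpha> "\<nu> @ \<kappa>"] by simp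
  qed
qed

lemma span_units_star_subalgebra: "star_subalgebra (lin_span A units) A"
proof (rule lin_span_star_subalgebra[OF units_closed])
  show "star A x \<in> lin_span A units" if xu: "x \<in> units" for x
  proof -
    obtain \<alpha> \<gamma> where "\<alpha> \<in> words" "\<gamma> \<in> words" "x = unit \<alpha> \<gamma>"
      using xu unfolding units_def by blast
    then show ?thesis using unit_in_units by (auto simp: star_unit intro: lin_span.base)
  qed
  show "x \<otimes> y \<in> lin_span A units" if xu: "x \<in> units" "y \<in> units" for x y
  proof -
    obtain \<alpha> \<gamma> \<mu> \<nu> where "\<alpha> \<in> words" "\<gamma> \<in> words" "\<mu> \<in> words" "\<nu> \<in> words"
      "x = unit \<alpha> \<gamma>" "y = unit \<mu> \<nu>" using xu unfolding units_def by blast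
    then have "x \<otimes> y \<in> insert \<zero> units" using units_mult by simp
    then show ?thesis by (auto intro: lin_span.zero lin_span.base)
  qed
qed

lemma gen_in_units: "i \<in> {1..d} \<Longrightarrow> s i \<in> units"
  using unit_in_units[of "[i]" "[]"] by (simp add: word_Cons)

text \<open>The closure of the span is a closed star-subalgebra containing the generators, hence
  everything.\<close>

lemma span_units_dense:
  assumes gen: "\<And>B. star_subalgebra B A \<Longrightarrow> closedin (cstar_topology A) B \<Longrightarrow> s ` {1..d} \<subseteq> B \<Longrightarrow> B = carrier A"
    and x: "x \<in> carrier A" and e: "0 < e"
  shows "\<exists>y\<in>lin_span A units. nrm A (x \<ominus> y) < e"
proof -
  define C where "C = {x \<in> carrier A. \<forall>e>0. \<exists>y\<in>lin_span A units. nrm A (x \<ominus> y) < e}"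
  have "s ` {1..d} \<subseteq> C"
  proof clarify
    fix i assume i: "i \<in> {1..d}"
    then have "s i \<in> lin_span A units" "nrm A (s i \<ominus> s i) = 0"
      using gen_in_units by (auto intro: lin_span.base)
    then show "s i \<in> C" using i unfolding C_def by (intro CollectI conjI allI impI bexI[of _ "s i"]) auto
  qed
  then have "C = carrier A"
    using gen closure_star_subalgebra[OF span_units_star_subalgebra] unfolding C_def by blast
  then show ?thesis using x e by (auto simp: C_def)
qed

text \<open>\<open>stop n\<close> consists of the words that are stopped when their weight first reaches \<open>n\<close>; it is a
  complete prefix code.\<close>

definition stop :: "nat \<Rightarrow> nat list set" where
  "stop n = {\<alpha> \<in> words. n \<le> weight \<alpha> \<and> (\<alpha> = [] \<or> weight (butlast \<alpha>) < n)}"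

lemma stop_words: "\<alpha> \<in> stop n \<Longrightarrow> \<alpha> \<in> words" by (simp add: stop_def)

text \<open>Letters have positive weight, so dropping the last one makes a word lighter. Stopping
  each word at its own weight puts every unit with words of equal weight into some block.\<close>

lemma stop_weight: "\<alpha> \<in> words \<Longrightarrow> \<alpha> \<in> stop (weight \<alpha>)"
proof -
  assume a: "\<alpha> \<in> words"
  have "weight (butlast \<alpha>) < weight \<alpha>" if "\<alpha> \<noteq> []"
  proof -
    have "weight \<alpha> = weight (butlast \<alpha>) + L (last \<alpha>)"
      by (subst append_butlast_last_id[OF that, symmetric]) (simp only: weight_simps add_0_right)
    moreover have "last \<alpha> \<in> {1..d}" using a last_in_set[OF that] by (auto simp: words_def)
    ultimately show ?thesis using weight_pos by force
  qed
  then show ?thesis using a by (auto simp: stop_def)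
qed

text \<open>Truncated subtraction is intended: a letter of weight at least \<open>n\<close> leaves
  level 0, at which only the empty word is stopped.\<close>

lemma stop_Cons:
  assumes "0 < n"
  shows "i # \<alpha> \<in> stop n \<longleftrightarrow> i \<in> {1..d} \<and> \<alpha> \<in> stop (n - L i)"
  using assms weight_pos[of i] by (auto simp: stop_def)

lemma stop_prefix_free:
  "\<alpha> \<in> stop n \<Longrightarrow> \<gamma> \<in> stop n \<Longrightarrow> \<alpha> \<noteq> \<gamma> \<Longrightarrow> star A (w \<alpha>) \<otimes> w \<gamma> = \<zero>"
proof (induction \<alpha> arbitrary: \<gamma> n)
  case Nil
  then show ?case by (auto simp: stop_def)
next
  case (Cons i \<alpha>)
  have n: "0 < n" using Cons.prems by (auto simp: stop_def)
  then obtain j \<nu> where g: "\<gamma> = j # \<nu>" using Cons.prems by (cases \<gamma>) (auto simp: stop_def)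
  show ?case
    using Cons.prems Cons.IH[of "n - L i" \<nu>] n unfolding g
    by (auto simp: stop_Cons star_word_Cons_word_Cons stop_words)
qed

lemma star_stop_stop:
  "\<alpha> \<in> stop n \<Longrightarrow> \<gamma> \<in> stop n \<Longrightarrow> star A (w \<alpha>) \<otimes> w \<gamma> = (if \<alpha> = \<gamma> then \<one> else \<zero>)"
  using stop_prefix_free stop_words by auto

lemma finite_stop: "finite (stop n)"
proof (rule finite_subset)
  \<comment> \<open>Letters weigh at least 1, so weight bounds length; a nonempty stopped word
    without its last letter weighs less than \<open>n\<close>.\<close>
  have len: "length \<alpha> \<le> weight \<alpha>" if "\<alpha> \<in> words" for \<alpha>
    using that
  proof (induction \<alpha>)
    case (Cons i \<alpha>)
    then show ?case using weight_pos[of i] by auto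
  qed simp
  have "length \<alpha> \<le> n + 1" if "\<alpha> \<in> stop n" for \<alpha>
  proof (cases "\<alpha> = []")
    case False
    then have "length (butlast \<alpha>) < n"
      using that len[of "butlast \<alpha>"] by (simp add: stop_def words_butlast)
    then show ?thesis by simp
  qed simp
  then show "stop n \<subseteq> {\<alpha>. set \<alpha> \<subseteq> {1..d} \<and> length \<alpha> \<le> n + 1}"
    by (auto simp: stop_def words_def)
qed (rule finite_lists_length_le, simp)

section \<open>The matrix algebra of a level\<close>

definition block_units :: "nat \<Rightarrow> 'a set" where
  "block_units n = {unit \<alpha> \<gamma> |\<alpha> \<gamma>. \<alpha> \<in> stop n \<and> \<gamma> \<in> stop n \<and> weight \<alpha> = weight \<gamma>}"

definition block :: "nat \<Rightarrow> 'a set" where "block n = lin_span A (block_units n)"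

lemma block_unitsI:
  "\<alpha> \<in> stop n \<Longrightarrow> \<gamma> \<in> stop n \<Longrightarrow> weight \<alpha> = weight \<gamma> \<Longrightarrow> unit \<alpha> \<gamma> \<in> block_units n"
  unfolding block_units_def by blast

lemma block_unitsE:
  assumes "x \<in> block_units n"
  obtains \<alpha> \<gamma> where "\<alpha> \<in> stop n" "\<gamma> \<in> stop n" "weight \<alpha> = weight \<gamma>" "x = unit \<alpha> \<gamma>"
  using assms unfolding block_units_def by blast

lemma block_units_closed: "block_units n \<subseteq> carrier A"
  using stop_words by (auto elim!: block_unitsE)

lemma block_carrier: "x \<in> block n \<Longrightarrow> x \<in> carrier A"
  unfolding block_def by (rule lin_span_carrier[OF block_units_closed])

lemma unit_in_block:
  "\<alpha> \<in> stop n \<Longrightarrow> \<gamma> \<in> stop n \<Longrightarrow> weight \<alpha> = weight \<gamma> \<Longrightarrow> unit \<alpha> \<gamma> \<in> block n"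
  unfolding block_def by (intro lin_span.base block_unitsI)

lemma unit_mult_unit_stop:
  assumes "\<alpha> \<in> words" "\<gamma> \<in> stop n" "\<mu> \<in> stop n" "\<nu> \<in> words"
  shows "unit \<alpha> \<gamma> \<otimes> unit \<mu> \<nu> = (if \<gamma> = \<mu> then unit \<alpha> \<nu> else \<zero>)"
  using assms by (simp add: unit_mult_unit star_stop_stop stop_words)

lemma block_star_subalgebra: "star_subalgebra (block n) A"
  unfolding block_def
proof (rule lin_span_star_subalgebra[OF block_units_closed])
  fix x assume "x \<in> block_units n"
  then obtain \<alpha> \<gamma> where x: "\<alpha> \<in> stop n" "\<gamma> \<in> stop n" "weight \<alpha> = weight \<gamma>" "x = unit \<alpha> \<gamma>"
    by (rule block_unitsE)
  then show "star A x \<in> lin_span A (block_units n)"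
    using unit_in_block[of \<gamma> n \<alpha>] by (simp add: star_unit stop_words block_def)
  fix y assume "y \<in> block_units n"
  then obtain \<mu> \<nu> where y: "\<mu> \<in> stop n" "\<nu> \<in> stop n" "weight \<mu> = weight \<nu>" "y = unit \<mu> \<nu>"
    by (rule block_unitsE)
  then have "x \<otimes> y = (if \<gamma> = \<mu> then unit \<alpha> \<nu> else \<zero>)"
    using x by (simp only: unit_mult_unit_stop stop_words)
  then show "x \<otimes> y \<in> lin_span A (block_units n)"
    using x y unit_in_block[of \<alpha> n \<nu>] by (simp add: lin_span.zero block_def)
qed

lemma finite_block_units: "finite (block_units n)"
proof (rule finite_subset)
  show "block_units n \<subseteq> (\<lambda>(\<alpha>, \<gamma>). unit \<alpha> \<gamma>) ` (stop n \<times> stop n)"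
    by (auto elim!: block_unitsE)
qed (simp add: finite_stop)

lemma block_units_subset: "block_units n \<subseteq> block n"
  by (auto simp: block_def intro: lin_span.base)

text \<open>A stopped word of weight above \<open>n\<close> is still stopped at the next level. Only
  words of weight exactly \<open>n\<close> have to be extended, and as both words of a unit receive
  the same letter, their weights remain equal.\<close>

lemma block_Suc: "block n \<subseteq> block (Suc n)"
proof -
  have "x \<in> block (Suc n)" if "x \<in> block_units n" for x
    using that
  proof (rule block_unitsE)
    fix \<alpha> \<gamma>
    assume a: "\<alpha> \<in> stop n" "\<gamma> \<in> stop n" "weight \<alpha> = weight \<gamma>" and x: "x = unit \<alpha> \<gamma>"
    show "x \<in> block (Suc n)"
    proof (cases "weight \<alpha> = n")
      case False
      then have "\<alpha> \<in> stop (Suc n)" "\<gamma> \<in> stop (Suc n)" using a by (auto simp: stop_def)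
      then show ?thesis unfolding x using a by (intro unit_in_block) auto
    next
      case True
      have "(\<Oplus>i\<in>{1..d}. unit (\<alpha> @ [i]) (\<gamma> @ [i])) \<in> block (Suc n)"
        unfolding block_def
      proof (rule lin_span_finsum[OF _ block_units_closed], simp)
        fix i assume i: "i \<in> {1..d}"
        then have "\<alpha> @ [i] \<in> stop (Suc n)" "\<gamma> @ [i] \<in> stop (Suc n)"
          using a True weight_pos[of i] by (auto simp: stop_def)
        then show "unit (\<alpha> @ [i]) (\<gamma> @ [i]) \<in> lin_span A (block_units (Suc n))"
          unfolding block_def[symmetric] using a by (intro unit_in_block) auto
      qed
      then show ?thesis unfolding x using a by (simp only: unit_eq_finsum stop_words)
    qed
  qed
  then show ?thesis unfolding block_def[of n]
    unfolding block_def by (intro lin_span_least) blast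
qed

lemma block_mono: "m \<le> n \<Longrightarrow> block m \<subseteq> block n"
  using lift_Suc_mono_le[of block, OF block_Suc] .

lemma one_in_block: "\<one> \<in> block n"
proof -
  have "unit [] [] \<in> block 0" by (rule unit_in_block) (auto simp: stop_def)
  then show ?thesis using block_mono[of 0 n] by auto
qed

lemma unit_in_block_weight:
  "\<alpha> \<in> words \<Longrightarrow> \<gamma> \<in> words \<Longrightarrow> weight \<alpha> = weight \<gamma> \<Longrightarrow> unit \<alpha> \<gamma> \<in> block (weight \<alpha>)"
  using stop_weight[of \<alpha>] stop_weight[of \<gamma>] by (intro unit_in_block) auto

end

section \<open>Finite sums and roots of unity\<close>

lemma (in cstar_algebra) nrm_finsum_le:
  assumes "finite I" "\<And>i. i \<in> I \<Longrightarrow> f i \<in> carrier A"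
  shows "nrm A (finsum A f I) \<le> (\<Sum>i\<in>I. nrm A (f i))"
  using assms
proof (induction I)
  case (insert i I)
  then have "finsum A f (insert i I) = f i \<oplus> finsum A f I" by (intro finsum_insert) auto
  moreover have "finsum A f I \<in> carrier A" using insert by (intro finsum_closed) auto
  ultimately show ?case using insert nrm_triangle[of "f i" "finsum A f I"] by auto
qed simp

lemma (in cstar_algebra) finsum_smult_const:
  assumes "finite I" "x \<in> carrier A"
  shows "(\<Oplus>i\<in>I. c i \<odot> x) = (\<Sum>i\<in>I. c i) \<odot> x"
  using assms(1)
proof (induction I)
  case (insert i I)
  then have "(\<Oplus>i\<in>insert i I. c i \<odot> x) = c i \<odot> x \<oplus> (\<Oplus>i\<in>I. c i \<odot> x)"
    using assms(2) by (intro finsum_insert) auto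
  then show ?case using insert assms(2) by (simp add: smult_add_left)
qed (use assms in simp)

text \<open>A geometric sum over \<open>N\<close>-th roots of unity; the bound on \<open>k\<close>
  prevents \<open>N\<close> from dividing it, so the ratio is not 1.\<close>

lemma sum_roots_of_unity_eq_0:
  fixes k :: int
  assumes "k \<noteq> 0" "\<bar>k\<bar> < int N"
  shows "(\<Sum>j<N. exp (\<i> * complex_of_real (2 * pi * real j / real N * real_of_int k))) = 0"
proof -
  define z where "z = exp (\<i> * complex_of_real (2 * pi * real_of_int k / real N))"
  have N: "0 < N" using assms by auto
  have "(\<Sum>j<N. exp (\<i> * complex_of_real (2 * pi * real j / real N * real_of_int k))) = (\<Sum>j<N. z ^ j)"
    unfolding z_def by (intro sum.cong refl) (simp add: exp_of_nat_mult[symmetric] algebra_simps)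
  moreover have "z \<noteq> 1"
  proof
    assume "z = 1"
    then obtain n :: int where "2 * pi * real_of_int k / real N = of_int (2 * n) * pi"
      by (auto simp: z_def exp_eq_1)
    then have "real_of_int k = real_of_int (n * int N)" using N by (simp add: field_simps)
    then have k: "k = n * int N" by (simp only: of_int_eq_iff)
    then have "n \<noteq> 0" using assms(1) by auto
    then have "1 * int N \<le> \<bar>n\<bar> * int N" by (intro mult_right_mono) auto
    then show False using assms(2) k by (simp add: abs_mult)
  qed
  moreover have "z ^ N = 1"
  proof -
    have "z ^ N = exp (\<i> * complex_of_real (2 * pi * real_of_int k))"
      unfolding z_def using N by (simp add: exp_of_nat_mult[symmetric])
    also have "\<dots> = 1" unfolding exp_eq_1 by (auto intro!: exI[of _ k])
    finally show ?thesis .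
  qed
  ultimately show ?thesis by (simp add: geometric_sum)
qed

section \<open>The fixed-point algebra\<close>

locale cuntz_gauge = weighted_cuntz_family A d s L
  for A :: "'a cstar_alg" (structure) and d s L +
  fixes \<sigma> :: "real \<Rightarrow> 'a \<Rightarrow> 'a"
  assumes generated: "\<And>B. star_subalgebra B A \<Longrightarrow> closedin (cstar_topology A) B \<Longrightarrow>
      s ` {1..d} \<subseteq> B \<Longrightarrow> B = carrier A"
    and automorphism: "\<And>t. star_automorphism A (\<sigma> t)"
    and gauge: "\<And>t j. j \<in> {1..d} \<Longrightarrow> \<sigma> t (s j) = exp (\<i> * complex_of_real (t * real (L j))) \<odot> s j"
    and gcd_weights: "Gcd (L ` {1..d}) = 1"
begin

section \<open>The action on words and its fixed points\<close>

lemma sigma_hom: "\<sigma> t \<in> unital_star_hom A A"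
  using automorphism[of t] by (simp add: star_automorphism_def)

lemma sigma_closed [simp, intro]: "x \<in> carrier A \<Longrightarrow> \<sigma> t x \<in> carrier A"
  and sigma_add: "x \<in> carrier A \<Longrightarrow> y \<in> carrier A \<Longrightarrow> \<sigma> t (x \<oplus> y) = \<sigma> t x \<oplus> \<sigma> t y"
  and sigma_mult: "x \<in> carrier A \<Longrightarrow> y \<in> carrier A \<Longrightarrow> \<sigma> t (x \<otimes> y) = \<sigma> t x \<otimes> \<sigma> t y"
  and sigma_one [simp]: "\<sigma> t \<one> = \<one>"
  and sigma_smult: "x \<in> carrier A \<Longrightarrow> \<sigma> t (c \<odot> x) = c \<odot> \<sigma> t x"
  and sigma_star: "x \<in> carrier A \<Longrightarrow> \<sigma> t (star A x) = star A (\<sigma> t x)"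
  using sigma_hom[of t] by (auto simp: unital_star_hom_def ring_hom_def Pi_iff)

lemma sigma_zero [simp]: "\<sigma> t \<zero> = \<zero>"
  using sigma_smult[of \<zero> t 0] by simp

lemma sigma_diff: "x \<in> carrier A \<Longrightarrow> y \<in> carrier A \<Longrightarrow> \<sigma> t (x \<ominus> y) = \<sigma> t x \<ominus> \<sigma> t y"
  by (simp add: a_minus_def minus_conv_smult sigma_add sigma_smult)

lemma sigma_nrm_le: "x \<in> carrier A \<Longrightarrow> nrm A (\<sigma> t x) \<le> nrm A x"
  using unital_star_hom_nrm_le[OF cstar_algebra_axioms cstar_algebra_axioms sigma_hom] .

lemma sigma_word:
  "\<alpha> \<in> words \<Longrightarrow> \<sigma> t (w \<alpha>) = exp (\<i> * complex_of_real (t * real (weight \<alpha>))) \<odot> w \<alpha>"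
proof (induction \<alpha>)
  case (Cons i \<alpha>)
  then show ?case
    by (simp add: word_Cons sigma_mult gauge smult_mult_left smult_mult_right smult_smult
        mult_exp_exp algebra_simps)
qed simp

lemma sigma_unit:
  assumes "\<alpha> \<in> words" "\<gamma> \<in> words"
  shows "\<sigma> t (unit \<alpha> \<gamma>) =
    exp (\<i> * complex_of_real (t * real_of_int (int (weight \<alpha>) - int (weight \<gamma>)))) \<odot> unit \<alpha> \<gamma>"
  using assms
  by (simp add: sigma_mult sigma_star sigma_word star_smult smult_mult_left smult_mult_right
      smult_smult exp_cnj mult_exp_exp algebra_simps)

definition fixed :: "'a set" where "fixed = {x \<in> carrier A. \<forall>t. \<sigma> t x = x}"

lemma fixed_carrier: "x \<in> fixed \<Longrightarrow> x \<in> carrier A" by (simp add: fixed_def)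

lemma fixed_star_subalgebra: "star_subalgebra fixed A"
  unfolding star_subalgebra_def fixed_def
  by (auto simp: sigma_add sigma_mult sigma_smult sigma_star)

lemma one_fixed: "\<one> \<in> fixed" by (simp add: fixed_def)

text \<open>Each \<open>\<sigma> t\<close> is contractive, so a limit of fixed elements is
  fixed.\<close>

lemma closedin_fixed: "closedin (cstar_topology A) fixed"
proof (rule closedinI)
  fix x assume x: "x \<in> carrier A" and ap: "\<And>e. 0 < e \<Longrightarrow> \<exists>y\<in>fixed. nrm A (x \<ominus> y) < e"
  have "\<sigma> t x = x" for t
  proof -
    have "nrm A (\<sigma> t x \<ominus> x) \<le> 0 + e" if e: "0 < e" for e
    proof -
      obtain y where y: "y \<in> fixed" "nrm A (x \<ominus> y) < e / 2" using ap[of "e / 2"] e by auto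
      then have yc: "y \<in> carrier A" "\<sigma> t y = y" by (auto simp: fixed_def)
      have "nrm A (\<sigma> t x \<ominus> y) \<le> nrm A (x \<ominus> y)"
        using sigma_nrm_le[of "x \<ominus> y" t] x yc by (simp add: sigma_diff)
      then show ?thesis
        using nrm_diff_triangle[of "\<sigma> t x" y x] nrm_diff_commute[of x y] x yc y by simp
    qed
    then have "nrm A (\<sigma> t x \<ominus> x) \<le> 0" by (rule field_le_epsilon)
    then show ?thesis
      using x nrm_nonneg[of "\<sigma> t x \<ominus> x"] by (simp add: nrm_eq_0_iff diff_eq_zero_iff)
  qed
  then show "x \<in> fixed" using x by (simp add: fixed_def)
qed (auto simp: fixed_def)

lemma fixed_point_algebra_eq: "fixed_point_algebra A \<sigma> = A\<lparr>carrier := fixed\<rparr>"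
  by (simp add: fixed_point_algebra_def fixed_def)

lemma cstar_fixed: "cstar_algebra (A\<lparr>carrier := fixed\<rparr>)"
  by (rule subalgebra_cstar_algebra[OF fixed_star_subalgebra one_fixed closedin_fixed])

lemma fixed_minus: "x \<in> fixed \<Longrightarrow> y \<in> fixed \<Longrightarrow> x \<ominus>\<^bsub>A\<lparr>carrier := fixed\<rparr>\<^esub> y = x \<ominus> y"
  by (rule subalgebra_minus[OF cstar_fixed]) (auto simp: fixed_def)

lemma unit_fixed:
  "\<alpha> \<in> words \<Longrightarrow> \<gamma> \<in> words \<Longrightarrow> weight \<alpha> = weight \<gamma> \<Longrightarrow> unit \<alpha> \<gamma> \<in> fixed"
  unfolding fixed_def using sigma_unit[of \<alpha> \<gamma>] by simp

lemma block_fixed: "block n \<subseteq> fixed"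
proof
  fix x assume "x \<in> block n"
  then show "x \<in> fixed"
    unfolding block_def
  proof induction
    case (base x)
    then show ?case using unit_fixed stop_words by (auto elim!: block_unitsE)
  qed (use fixed_star_subalgebra in \<open>auto simp: star_subalgebra_def\<close>)
qed

section \<open>Averaging onto the union of the matrix algebras\<close>

definition blocks :: "'a set" where "blocks = (\<Union>n. block n)"

lemma blocks_closed:
  "\<zero> \<in> blocks" "x \<in> blocks \<Longrightarrow> y \<in> blocks \<Longrightarrow> x \<oplus> y \<in> blocks" "x \<in> blocks \<Longrightarrow> c \<odot> x \<in> blocks"
proof -
  show "\<zero> \<in> blocks" unfolding blocks_def block_def using lin_span.zero by blast
  show "c \<odot> x \<in> blocks" if xb: "x \<in> blocks"
  proof -
    obtain n where "x \<in> block n" using xb by (auto simp: blocks_def)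
    then have "c \<odot> x \<in> block n" unfolding block_def by (rule lin_span.smult)
    then show ?thesis by (auto simp: blocks_def)
  qed
  show "x \<oplus> y \<in> blocks" if xy: "x \<in> blocks" "y \<in> blocks"
  proof -
    obtain m n where "x \<in> block m" "y \<in> block n" using xy by (auto simp: blocks_def)
    then have "x \<in> block (max m n)" "y \<in> block (max m n)"
      using block_mono[of m "max m n"] block_mono[of n "max m n"] by auto
    then have "x \<oplus> y \<in> block (max m n)" unfolding block_def by (rule lin_span.add)
    then show ?thesis by (auto simp: blocks_def)
  qed
qed

text \<open>A discrete substitute for the average of \<open>\<sigma>\<close> over a period.\<close>

definition avg :: "nat \<Rightarrow> 'a \<Rightarrow> 'a" where
  "avg N x = (\<Oplus>j\<in>{..<N}. complex_of_real (1 / real N) \<odot> \<sigma> (2 * pi * real j / real N) x)"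

lemma avg_closed: "x \<in> carrier A \<Longrightarrow> avg N x \<in> carrier A"
  unfolding avg_def by (intro finsum_closed) auto

lemma avg_add: "x \<in> carrier A \<Longrightarrow> y \<in> carrier A \<Longrightarrow> avg N (x \<oplus> y) = avg N x \<oplus> avg N y"
  unfolding avg_def by (subst finsum_addf[symmetric]) (auto simp: sigma_add smult_add_right)

lemma avg_smult:
  assumes "x \<in> carrier A" shows "avg N (c \<odot> x) = c \<odot> avg N x"
proof -
  have "c \<odot> avg N x = (\<Oplus>j\<in>{..<N}. c \<odot> (complex_of_real (1 / real N) \<odot> \<sigma> (2 * pi * real j / real N) x))"
    using scalars.finsum_smult_ldistr[of "{..<N}" c] assms
    by (simp add: avg_def ring_of_type_algebra_def)
  then show ?thesis unfolding avg_def
    using assms by (simp add: sigma_smult smult_smult mult.commute)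
qed

lemma avg_fixed:
  assumes "x \<in> fixed" "0 < N" shows "avg N x = x"
  unfolding avg_def using assms finsum_smult_const[of "{..<N}" x "\<lambda>_. complex_of_real (1 / real N)"]
  by (simp add: fixed_def)

lemma avg_nrm_le:
  assumes "x \<in> carrier A" "0 < N" shows "nrm A (avg N x) \<le> nrm A x"
proof -
  have "nrm A (avg N x) \<le>
      (\<Sum>j<N. nrm A (complex_of_real (1 / real N) \<odot> \<sigma> (2 * pi * real j / real N) x))"
    unfolding avg_def using assms by (intro nrm_finsum_le) auto
  also have "\<dots> \<le> (\<Sum>j<N. 1 / real N * nrm A x)"
    using assms by (intro sum_mono) (auto simp: nrm_smult norm_divide intro!: divide_right_mono sigma_nrm_le)
  also have "\<dots> = nrm A x" using assms by simp
  finally show ?thesis .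
qed

text \<open>\<open>N\<close> exceeds the difference of the weights, so the phases of a unit with
  unequal weights average to exactly 0, while a unit with equal weights is left alone.\<close>

lemma avg_unit:
  assumes a: "\<alpha> \<in> words" "\<gamma> \<in> words" and N: "weight \<alpha> + weight \<gamma> < N"
  shows "avg N (unit \<alpha> \<gamma>) \<in> blocks"
proof (cases "weight \<alpha> = weight \<gamma>")
  case True
  then have "avg N (unit \<alpha> \<gamma>) = unit \<alpha> \<gamma>" using a N unit_fixed by (intro avg_fixed) auto
  then show ?thesis using unit_in_block_weight[OF a True] unfolding blocks_def by auto
next
  case False
  let ?k = "int (weight \<alpha>) - int (weight \<gamma>)"
  let ?e = "\<lambda>j. exp (\<i> * complex_of_real (2 * pi * real j / real N * real_of_int ?k))"
  have "avg N (unit \<alpha> \<gamma>) = (\<Oplus>j\<in>{..<N}. (complex_of_real (1 / real N) * ?e j) \<odot> unit \<alpha> \<gamma>)"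
    unfolding avg_def sigma_unit[OF a] using a by (simp add: smult_smult)
  also have "\<dots> = (complex_of_real (1 / real N) * (\<Sum>j<N. ?e j)) \<odot> unit \<alpha> \<gamma>"
    using a by (subst finsum_smult_const) (auto simp: sum_distrib_left)
  also have "(\<Sum>j<N. ?e j) = 0" using False N by (intro sum_roots_of_unity_eq_0) auto
  finally show ?thesis using a blocks_closed(1) by simp
qed

text \<open>A statement about all large \<open>N\<close>, since a sum needs a threshold common to
  its terms; positivity of \<open>M\<close> keeps the average meaningful.\<close>

lemma avg_in_blocks: "y \<in> lin_span A units \<Longrightarrow> \<exists>M>0. \<forall>N\<ge>M. avg N y \<in> blocks"
proof (induction rule: lin_span.induct)
  case zero
  have "avg N \<zero> = \<zero>" for N using avg_smult[of \<zero> N 0] avg_closed[of \<zero> N] by simp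
  then show ?case using blocks_closed(1) by auto
next
  case (base y)
  then obtain \<alpha> \<gamma> where "\<alpha> \<in> words" "\<gamma> \<in> words" "y = unit \<alpha> \<gamma>" unfolding units_def by blast
  then show ?case using avg_unit by (intro exI[of _ "Suc (weight \<alpha> + weight \<gamma>)"]) auto
next
  case (add x y)
  then obtain M K where "M > 0" "\<And>N. M \<le> N \<Longrightarrow> avg N x \<in> blocks" "\<And>N. K \<le> N \<Longrightarrow> avg N y \<in> blocks"
    by blast
  moreover have "x \<in> carrier A" "y \<in> carrier A" using add lin_span_carrier[OF units_closed] by auto
  ultimately show ?case by (intro exI[of _ "max M K"]) (auto simp: avg_add blocks_closed)
next
  case (smult x c)
  moreover have "x \<in> carrier A" using smult lin_span_carrier[OF units_closed] by auto
  ultimately show ?case using blocks_closed(3) by (auto simp: avg_smult)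
qed

text \<open>Averaging leaves \<open>x\<close> alone and is contractive, so the average of an
  approximant from the span is at least as close to \<open>x\<close>.\<close>

lemma blocks_dense:
  assumes x: "x \<in> fixed" and e: "0 < e"
  shows "\<exists>y\<in>blocks. nrm A (x \<ominus> y) < e"
proof -
  have xc: "x \<in> carrier A" using x fixed_carrier by blast
  obtain y where y: "y \<in> lin_span A units" "nrm A (x \<ominus> y) < e"
    using span_units_dense[OF generated xc e] by blast
  then have yc: "y \<in> carrier A" using lin_span_carrier[OF units_closed] by blast
  obtain N where N: "0 < N" "avg N y \<in> blocks" using avg_in_blocks[OF y(1)] by blast
  have "x \<ominus> avg N y = avg N (x \<ominus> y)"
    using x xc yc avg_fixed[OF x N(1)] avg_closed[OF yc]
    by (simp add: a_minus_def minus_conv_smult avg_add avg_smult)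
  then have "nrm A (x \<ominus> avg N y) \<le> nrm A (x \<ominus> y)" using avg_nrm_le[of "x \<ominus> y" N] xc yc N by simp
  then show ?thesis using N y(2) by (intro bexI[of _ "avg N y"]) auto
qed

lemma AF_fixed: "AF_algebra (A\<lparr>carrier := fixed\<rparr>)"
proof -
  interpret F: cstar_algebra "A\<lparr>carrier := fixed\<rparr>" by (rule cstar_fixed)
  have "star_subalgebra (block n) (A\<lparr>carrier := fixed\<rparr>)" for n
    using block_star_subalgebra[of n] block_fixed[of n] by (simp add: star_subalgebra_def)
  moreover have "finite_dimensional (A\<lparr>carrier := fixed\<rparr>) (block n)" for n
  proof -
    have eq: "block n = lin_span (A\<lparr>carrier := fixed\<rparr>) (block_units n)"
      by (simp add: block_def lin_span_carrier_update)
    have "block_units n \<subseteq> fixed" using block_units_subset block_fixed by (rule order_trans)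
    then show ?thesis unfolding eq
      by (intro F.lin_span_finite_dimensional finite_block_units) simp
  qed
  moreover have "Abstract_Topology.closure_of (cstar_topology (A\<lparr>carrier := fixed\<rparr>)) (\<Union>n. block n) = fixed"
  proof -
    have "\<exists>y\<in>\<Union>n. block n. y \<in> fixed \<and> nrm A (x \<ominus>\<^bsub>A\<lparr>carrier := fixed\<rparr>\<^esub> y) < e"
      if x: "x \<in> fixed" and e: "0 < e" for x e
    proof -
      obtain y where y: "y \<in> blocks" "nrm A (x \<ominus> y) < e" using blocks_dense[OF x e] by blast
      then have "y \<in> fixed" using block_fixed by (auto simp: blocks_def)
      then show ?thesis
        using y x by (intro bexI[of _ y]) (auto simp: blocks_def fixed_minus)
    qed
    then show ?thesis unfolding F.closure_of_eq by auto
  qed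
  ultimately show ?thesis unfolding AF_algebra_def
    using cstar_fixed block_Suc by (intro conjI exI[of _ block]) auto
qed

end

section \<open>Simplicity of the fixed-point algebra\<close>

context cstar_algebra
begin

lemma lin_span_one: "x \<in> lin_span A {\<one>} \<Longrightarrow> \<exists>c. x = c \<odot> \<one>"
proof (induction rule: lin_span.induct)
  case zero
  show ?case by (intro exI[of _ 0]) simp
next
  case (base x)
  then show ?case by (intro exI[of _ 1]) simp
next
  case (add x y)
  then obtain a b where "x = a \<odot> \<one>" "y = b \<odot> \<one>" by blast
  then show ?case by (intro exI[of _ "a + b"]) (simp add: smult_add_left)
next
  case (smult x c)
  then obtain a where "x = a \<odot> \<one>" by blast
  then show ?case by (intro exI[of _ "c * a"]) (simp add: smult_smult)
qed

lemma lin_span_empty: "x \<in> lin_span A {} \<Longrightarrow> x = \<zero>"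
  by (induction rule: lin_span.induct) auto

end

context weighted_cuntz_family
begin

text \<open>The columns of the matrix algebra spanned by the units \<open>unit \<alpha> \<gamma>\<close> with
  \<open>\<alpha>, \<gamma> \<in> stop n\<close> of weight \<open>m\<close>; products \<open>v\<^sup>* u\<close> of columns are scalars.\<close>

definition col_units :: "nat \<Rightarrow> nat \<Rightarrow> 'a set" where
  "col_units n m = w ` {\<alpha> \<in> stop n. weight \<alpha> = m}"

definition cols :: "nat \<Rightarrow> nat \<Rightarrow> 'a set" where "cols n m = lin_span A (col_units n m)"

lemma col_units_closed: "col_units n m \<subseteq> carrier A"
  using stop_words by (auto simp: col_units_def)

lemma cols_carrier: "v \<in> cols n m \<Longrightarrow> v \<in> carrier A"
  unfolding cols_def by (rule lin_span_carrier[OF col_units_closed])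

lemma star_col_col:
  assumes u: "u \<in> cols n m" and v: "v \<in> cols n m"
  shows "\<exists>c. star A u \<otimes> v = c \<odot> \<one>"
proof (rule lin_span_one)
  have su: "star A u \<in> lin_span A (star A ` col_units n m)"
    using u unfolding cols_def
    by (rule lin_span_star[OF col_units_closed, rotated]) (auto intro: lin_span.base)
  have c: "star A ` col_units n m \<subseteq> carrier A" using col_units_closed by auto
  show "star A u \<otimes> v \<in> lin_span A {\<one>}"
  proof (rule lin_span_mult[OF c col_units_closed _ su v[unfolded cols_def]])
    fix x y assume "x \<in> star A ` col_units n m" "y \<in> col_units n m"
    then obtain \<alpha> \<gamma> where "\<alpha> \<in> stop n" "\<gamma> \<in> stop n" "x = star A (w \<alpha>)" "y = w \<gamma>"
      by (auto simp: col_units_def)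
    then have "x \<otimes> y = (if \<alpha> = \<gamma> then \<one> else \<zero>)" by (simp add: star_stop_stop)
    then show "x \<otimes> y \<in> lin_span A {\<one>}" by (auto intro: lin_span.zero lin_span.base)
  qed
qed

lemma block_mult_col:
  assumes y: "y \<in> block n" and v: "v \<in> cols n m"
  shows "y \<otimes> v \<in> cols n m"
  using y v unfolding block_def cols_def
proof (rule lin_span_mult[OF block_units_closed col_units_closed, rotated])
  fix x z assume "x \<in> block_units n" and z: "z \<in> col_units n m"
  then obtain \<alpha> \<gamma> where x: "\<alpha> \<in> stop n" "\<gamma> \<in> stop n" "weight \<alpha> = weight \<gamma>" "x = unit \<alpha> \<gamma>"
    using block_unitsE by blast
  from z obtain \<mu> where \<mu>: "\<mu> \<in> stop n" "weight \<mu> = m" "z = w \<mu>" by (auto simp: col_units_def)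
  have "x \<otimes> z = w \<alpha> \<otimes> (star A (w \<gamma>) \<otimes> w \<mu>)" using x \<mu> by (simp add: m_assoc stop_words)
  also have "\<dots> = (if \<gamma> = \<mu> then w \<alpha> else \<zero>)" using x \<mu> by (simp add: star_stop_stop stop_words)
  finally show "x \<otimes> z \<in> lin_span A (col_units n m)"
    using x \<mu> by (auto simp: col_units_def intro: lin_span.zero lin_span.base)
qed

lemma col_mult_star:
  assumes v: "v \<in> cols n m" and a: "\<alpha> \<in> stop n" "weight \<alpha> = m"
  shows "v \<otimes> star A (w \<alpha>) \<in> block n"
  unfolding block_def
proof (rule lin_span_mult[OF col_units_closed _ _ v[unfolded cols_def]])
  show "{star A (w \<alpha>)} \<subseteq> carrier A" using a by (simp add: stop_words)
  show "star A (w \<alpha>) \<in> lin_span A {star A (w \<alpha>)}" by (rule lin_span.base) simp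
  fix x y assume x: "x \<in> col_units n m" and y: "y \<in> {star A (w \<alpha>)}"
  from x obtain \<mu> where "\<mu> \<in> stop n" "weight \<mu> = m" "x = w \<mu>" by (auto simp: col_units_def)
  then show "x \<otimes> y \<in> lin_span A (block_units n)"
    using y a by (auto intro!: lin_span.base block_unitsI)
qed

text \<open>A bound for the operator norm of left multiplication on columns. As the product of an
  adjoint column and a column is a scalar, \<open>nrm A v\<close> is a Hilbert norm there.\<close>

definition col_bound :: "nat \<Rightarrow> real \<Rightarrow> 'a \<Rightarrow> bool" where
  "col_bound n C y \<longleftrightarrow> (\<forall>m. \<forall>v\<in>cols n m. nrm A (y \<otimes> v) \<le> C * nrm A v)"

lemma col_boundD: "col_bound n C y \<Longrightarrow> v \<in> cols n m \<Longrightarrow> nrm A (y \<otimes> v) \<le> C * nrm A v"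
  unfolding col_bound_def by blast

text \<open>The Hilbert space argument for adjoints: with \<open>u = star A y \<otimes> v\<close>
  again a column, the square of \<open>nrm A u\<close> is the norm of
  \<open>star A v \<otimes> (y \<otimes> u)\<close>, to which the bound for \<open>y\<close>
  applies; then one factor \<open>nrm A u\<close> cancels.\<close>

lemma col_bound_star:
  assumes y: "y \<in> block n" and b: "col_bound n C y" and C: "0 \<le> C"
  shows "col_bound n C (star A y)"
  unfolding col_bound_def
proof (intro allI ballI)
  fix m v assume v: "v \<in> cols n m"
  define u where "u = star A y \<otimes> v"
  have "star A y \<in> block n" using y block_star_subalgebra by (auto simp: star_subalgebra_def)
  then have u: "u \<in> cols n m" unfolding u_def using v by (rule block_mult_col)
  have c: "y \<in> carrier A" "v \<in> carrier A" "u \<in> carrier A"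
    using y v u block_carrier cols_carrier by auto
  have "star A u = star A v \<otimes> y" using c by (simp add: u_def star_mult star_star)
  then have "nrm A u * nrm A u = nrm A (star A v \<otimes> (y \<otimes> u))"
    using cstar_identity[OF c(3)] c by (simp add: power2_eq_square m_assoc)
  also have "\<dots> \<le> nrm A v * (C * nrm A u)"
    using c by (intro nrm_mult_le col_boundD[OF b u]) auto
  finally have "nrm A u * nrm A u \<le> (C * nrm A v) * nrm A u" by (simp add: mult_ac)
  then show "nrm A u \<le> C * nrm A v"
    using nrm_nonneg[OF c(3)] nrm_nonneg[OF c(2)] C
    by (cases "nrm A u = 0") (auto simp: mult_le_cancel_right)
qed

lemma col_bound_mult:
  assumes y: "y \<in> carrier A" "col_bound n C y" "0 \<le> C" and z: "z \<in> block n" "col_bound n D z"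
  shows "col_bound n (C * D) (y \<otimes> z)"
  unfolding col_bound_def
proof (intro allI ballI)
  fix m v assume v: "v \<in> cols n m"
  have "nrm A (y \<otimes> z \<otimes> v) = nrm A (y \<otimes> (z \<otimes> v))"
    using y z v block_carrier cols_carrier by (simp add: m_assoc)
  also have "\<dots> \<le> C * nrm A (z \<otimes> v)"
    using block_mult_col[OF z(1) v] by (rule col_boundD[OF y(2)])
  also have "\<dots> \<le> C * (D * nrm A v)"
    using col_boundD[OF z(2) v] y(3) by (intro mult_left_mono)
  finally show "nrm A (y \<otimes> z \<otimes> v) \<le> C * D * nrm A v" by (simp add: mult_ac)
qed

text \<open>\<open>\<one>\<close> is a combination of units of the block, and multiplying
  \<open>y\<close> by one of them gives norm at most \<open>C\<close>, since the left word of the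
  unit is a column of norm 1. The induction runs over all \<open>z\<close> in the span and is used
  at \<open>z = \<one>\<close>.\<close>

lemma col_bound_nrm:
  "\<exists>D. \<forall>y\<in>carrier A. \<forall>C\<ge>0. col_bound n C y \<longrightarrow> nrm A y \<le> D * C"
proof -
  have "\<exists>D. \<forall>y\<in>carrier A. \<forall>C\<ge>0. col_bound n C y \<longrightarrow> nrm A (y \<otimes> z) \<le> D * C"
    if "z \<in> lin_span A (block_units n)" for z
    using that
  proof (induction rule: lin_span.induct)
    case zero
    show ?case by (intro exI[of _ 0]) simp
  next
    case (base z)
    then obtain \<alpha> \<gamma> where z: "\<alpha> \<in> stop n" "\<gamma> \<in> stop n" "weight \<alpha> = weight \<gamma>" "z = unit \<alpha> \<gamma>"
      by (rule block_unitsE)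
    have "nrm A (y \<otimes> z) \<le> 1 * C" if y: "y \<in> carrier A" "col_bound n C y" for y C
    proof -
      have "w \<alpha> \<in> cols n (weight \<alpha>)"
        using z unfolding cols_def col_units_def by (intro lin_span.base) auto
      from col_boundD[OF y(2) this] have "nrm A (y \<otimes> w \<alpha>) \<le> C"
        using z by (simp add: stop_words)
      then have "nrm A (y \<otimes> w \<alpha> \<otimes> star A (w \<gamma>)) \<le> C * 1"
        using y z by (intro nrm_mult_le) (auto simp: stop_words)
      then show ?thesis using y z by (simp add: m_assoc stop_words)
    qed
    then show ?case by blast
  next
    case (add u v)
    then obtain D E where DE:
      "\<And>y C. y \<in> carrier A \<Longrightarrow> 0 \<le> C \<Longrightarrow> col_bound n C y \<Longrightarrow> nrm A (y \<otimes> u) \<le> D * C"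
      "\<And>y C. y \<in> carrier A \<Longrightarrow> 0 \<le> C \<Longrightarrow> col_bound n C y \<Longrightarrow> nrm A (y \<otimes> v) \<le> E * C" by blast
    have uv: "u \<in> carrier A" "v \<in> carrier A"
      using add lin_span_carrier[OF block_units_closed] by auto
    have "nrm A (y \<otimes> (u \<oplus> v)) \<le> (D + E) * C" if y: "y \<in> carrier A" "0 \<le> C" "col_bound n C y" for y C
      using DE(1)[OF y] DE(2)[OF y] nrm_triangle[of "y \<otimes> u" "y \<otimes> v"] uv y(1)
      by (simp add: r_distr algebra_simps)
    then show ?case by blast
  next
    case (smult u c)
    then obtain D where D:
      "\<And>y C. y \<in> carrier A \<Longrightarrow> 0 \<le> C \<Longrightarrow> col_bound n C y \<Longrightarrow> nrm A (y \<otimes> u) \<le> D * C" by blast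
    have u: "u \<in> carrier A" using smult lin_span_carrier[OF block_units_closed] by auto
    have "nrm A (y \<otimes> (c \<odot> u)) \<le> (cmod c * D) * C" if y: "y \<in> carrier A" "0 \<le> C" "col_bound n C y" for y C
      using mult_left_mono[OF D[OF y], of "cmod c"] u y(1)
      by (simp add: smult_mult_right nrm_smult mult_ac)
    then show ?case by blast
  qed
  from this[OF one_in_block[unfolded block_def]] show ?thesis by fastforce
qed

text \<open>A priori \<open>\<parallel>y\<parallel> \<le> D C\<close> with \<open>D\<close> depending on \<open>n\<close>; applied to \<open>(y\<^sup>* y)\<close> raised to the
  powers \<open>2\<^sup>k\<close>, whose norms are powers of \<open>\<parallel>y\<parallel>\<close>, this removes \<open>D\<close>.\<close>

lemma nrm_le_col_bound:
  assumes y: "y \<in> block n" and b: "col_bound n C y" and C: "0 < C"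
  shows "nrm A y \<le> C"
proof (rule ccontr)
  assume "\<not> nrm A y \<le> C"
  then have r: "1 < nrm A y / C" using C by simp
  obtain D where D: "\<And>y C. y \<in> carrier A \<Longrightarrow> 0 \<le> C \<Longrightarrow> col_bound n C y \<Longrightarrow> nrm A y \<le> D * C"
    using col_bound_nrm by blast
  have mult: "u \<otimes> v \<in> block n" if "u \<in> block n" "v \<in> block n" for u v
    using that block_star_subalgebra by (auto simp: star_subalgebra_def)
  have sy: "star A y \<in> block n" using y block_star_subalgebra by (auto simp: star_subalgebra_def)
  have yc: "y \<in> carrier A" using y by (rule block_carrier)
  have "\<exists>z\<in>block n. star A z = z \<and> nrm A z = nrm A y ^ (2 ^ Suc k) \<and> col_bound n (C ^ (2 ^ Suc k)) z" for k
  proof (induction k)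
    case 0
    show ?case
      using mult[OF sy y] yc cstar_identity[OF yc] C
        col_bound_mult[OF _ col_bound_star[OF y b] _ y b]
      by (intro bexI[of _ "star A y \<otimes> y"]) (auto simp: star_mult star_star power2_eq_square)
  next
    case (Suc k)
    then obtain z where z: "z \<in> block n" "star A z = z" "nrm A z = nrm A y ^ (2 ^ Suc k)"
      "col_bound n (C ^ (2 ^ Suc k)) z" by blast
    have zc: "z \<in> carrier A" using z(1) by (rule block_carrier)
    have "nrm A (z \<otimes> z) = (nrm A y ^ (2 ^ Suc k))\<^sup>2"
      using cstar_identity[OF zc] z by simp
    moreover have "col_bound n (C ^ (2 ^ Suc k) * C ^ (2 ^ Suc k)) (z \<otimes> z)"
      using C by (intro col_bound_mult zc z) auto
    moreover have "star A (z \<otimes> z) = z \<otimes> z" using z zc by (simp add: star_mult)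
    ultimately show ?case using mult[OF z(1,1)]
      by (intro bexI[of _ "z \<otimes> z"]) (auto simp flip: power_mult power_add mult_2 simp: mult.commute)
  qed
  then have bound: "(nrm A y / C) ^ (2 ^ Suc k) \<le> D" for k
  proof -
    obtain z where z: "z \<in> block n" "nrm A z = nrm A y ^ (2 ^ Suc k)" "col_bound n (C ^ (2 ^ Suc k)) z"
      using \<open>\<And>k. \<exists>z\<in>block n. star A z = z \<and> nrm A z = nrm A y ^ (2 ^ Suc k) \<and>
        col_bound n (C ^ (2 ^ Suc k)) z\<close> by blast
    have "nrm A y ^ (2 ^ Suc k) \<le> D * C ^ (2 ^ Suc k)"
      using D[OF block_carrier[OF z(1)] _ z(3)] C z(2) by simp
    then show ?thesis using C by (simp add: power_divide pos_divide_le_eq)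
  qed
  obtain N where N: "D < (nrm A y / C) ^ N" using real_arch_pow[OF r] by blast
  also have "\<dots> \<le> (nrm A y / C) ^ (2 ^ Suc N)"
    using r less_exp[of "Suc N"] by (intro power_increasing) auto
  also have "\<dots> \<le> D" by (rule bound)
  finally show False by simp
qed

end

context cuntz_gauge
begin

section \<open>Ideals of the fixed-point algebra\<close>

lemma words_of_large_weight: obtains N where "\<And>n. N \<le> n \<Longrightarrow> \<exists>\<kappa>\<in>words. weight \<kappa> = n"
proof -
  have "Gcd (weight ` words) = 1"
  proof -
    have "L i \<in> weight ` words" if "i \<in> {1..d}" for i
      using that by (intro image_eqI[of _ _ "[i]"]) auto
    then have "Gcd (weight ` words) dvd Gcd (L ` {1..d})"
      by (intro Gcd_greatest) (auto intro: Gcd_dvd)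
    then show ?thesis using gcd_weights by simp
  qed
  moreover have "0 \<in> weight ` words" by (rule image_eqI[of _ _ "[]"]) auto
  moreover have "a + b \<in> weight ` words" if "a \<in> weight ` words" "b \<in> weight ` words" for a b
    using that
  proof clarify
    fix \<alpha> \<gamma> assume "\<alpha> \<in> words" "\<gamma> \<in> words"
    then show "weight \<alpha> + weight \<gamma> \<in> weight ` words" by (intro image_eqI[of _ _ "\<alpha> @ \<gamma>"]) auto
  qed
  ultimately obtain N where "\<And>n. N \<le> n \<Longrightarrow> n \<in> weight ` words"
    using coprime_submonoid_cofinite by metis
  then show thesis using that by force
qed

text \<open>Ideals of rings do not mention scalars; multiplication by
  \<open>c \<odot> \<one>\<close> supplies them.\<close>

lemma left_ideal_smult:
  assumes sub: "I \<subseteq> fixed" and left: "\<And>x a. x \<in> fixed \<Longrightarrow> a \<in> I \<Longrightarrow> x \<otimes> a \<in> I" and x: "x \<in> I"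
  shows "c \<odot> x \<in> I"
proof -
  have "c \<odot> \<one> \<in> fixed" using one_fixed fixed_star_subalgebra by (auto simp: star_subalgebra_def)
  then have "(c \<odot> \<one>) \<otimes> x \<in> I" using left x by blast
  then show ?thesis using x sub fixed_carrier by (auto simp: smult_mult_left subset_iff)
qed

text \<open>Below \<open>unit \<alpha> \<alpha>\<close> there are projections
  \<open>unit \<nu> \<nu>\<close> of every large weight, and projections of equal weight are
  equivalent within the fixed-point algebra. So the ideal contains all diagonal units of a high
  level, hence that block and \<open>\<one>\<close>.\<close>

lemma ideal_eq_fixed_if_unit:
  assumes sub: "I \<subseteq> fixed" and zero: "\<zero> \<in> I" and add: "\<And>x y. x \<in> I \<Longrightarrow> y \<in> I \<Longrightarrow> x \<oplus> y \<in> I"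
    and left: "\<And>x a. x \<in> fixed \<Longrightarrow> a \<in> I \<Longrightarrow> x \<otimes> a \<in> I"
    and right: "\<And>x a. x \<in> fixed \<Longrightarrow> a \<in> I \<Longrightarrow> a \<otimes> x \<in> I"
    and a: "\<alpha> \<in> words" and e: "unit \<alpha> \<alpha> \<in> I"
  shows "I = fixed"
proof -
  obtain N where N: "\<And>n. N \<le> n \<Longrightarrow> \<exists>\<kappa>\<in>words. weight \<kappa> = n"
    by (rule words_of_large_weight) blast
  have long: "unit \<mu> \<mu> \<in> I" if m: "\<mu> \<in> words" "weight \<alpha> + N \<le> weight \<mu>" for \<mu>
  proof -
    have "N \<le> weight \<mu> - weight \<alpha>" using m by linarith
    then obtain \<kappa> where k: "\<kappa> \<in> words" "weight \<kappa> = weight \<mu> - weight \<alpha>"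
      using N by blast
    \<comment> \<open>\<open>\<nu>\<close> extends \<open>\<alpha>\<close>, so its projection lies
      below that of \<open>\<alpha>\<close>, and it has the weight of \<open>\<mu>\<close>, so
      \<open>unit \<mu> \<nu>\<close> is fixed and links the two.\<close>
    define \<nu> where "\<nu> = \<alpha> @ \<kappa>"
    have \<nu>: "\<nu> \<in> words" "weight \<nu> = weight \<mu>" using a k m by (auto simp: \<nu>_def)
    have "unit \<alpha> \<alpha> \<otimes> unit \<nu> \<nu> = unit \<nu> \<nu>"
    proof -
      have "star A (w \<alpha>) \<otimes> w \<nu> = w \<kappa>"
        using a k by (simp add: \<nu>_def word_append flip: m_assoc)
      then show ?thesis unfolding unit_mult_unit[OF a a \<nu>(1,1)]
        using a k by (simp add: \<nu>_def word_append)
    qed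
    then have "unit \<nu> \<nu> \<in> I" using right[OF unit_fixed[OF \<nu>(1,1) refl] e] by simp
    then have "unit \<mu> \<nu> \<otimes> unit \<nu> \<nu> \<otimes> unit \<nu> \<mu> \<in> I"
      using unit_fixed m \<nu> left right by simp
    then show ?thesis using m \<nu> by (simp only: unit_mult_unit_same)
  qed
  note smult = left_ideal_smult[OF sub left]
  \<comment> \<open>From this level on, \<open>long\<close> applies to every stopped word.\<close>
  define M where "M = weight \<alpha> + N"
  have "x \<in> I" if "x \<in> lin_span A (block_units M)" for x
    using that
  proof induction
    case (base x)
    then obtain \<mu> \<nu> where x: "\<mu> \<in> stop M" "\<nu> \<in> stop M" "weight \<mu> = weight \<nu>" "x = unit \<mu> \<nu>"
      by (rule block_unitsE)
    have "unit \<mu> \<mu> \<in> I" using x by (intro long) (auto simp: stop_def M_def)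
    then have "unit \<mu> \<mu> \<otimes> unit \<mu> \<nu> \<in> I" using right unit_fixed x stop_words by blast
    then show ?case using x stop_words by (simp only: unit_mult_unit_same)
  qed (use zero add smult in auto)
  then have one: "\<one> \<in> I" using one_in_block[of M] unfolding block_def by blast
  have "x \<in> I" if "x \<in> fixed" for x using left[OF that one] that fixed_carrier by simp
  then show ?thesis using sub by blast
qed

text \<open>A nonzero \<open>x\<close> in the ideal is close to some \<open>y\<close> in a matrix algebra, hence \<open>v\<^sup>* x\<^sup>* x v\<close> is
  close to a nonzero scalar for a suitable column \<open>v\<close>. Transported to a corner \<open>e\<close> of the
  fixed-point algebra, it becomes invertible there, so \<open>e\<close> lies in the ideal.\<close>

lemma ideal_contains_unit:
  assumes sub: "I \<subseteq> fixed" and left: "\<And>x a. x \<in> fixed \<Longrightarrow> a \<in> I \<Longrightarrow> x \<otimes> a \<in> I"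
    and right: "\<And>x a. x \<in> fixed \<Longrightarrow> a \<in> I \<Longrightarrow> a \<otimes> x \<in> I"
    and x0: "x0 \<in> I" "x0 \<noteq> \<zero>"
  shows "\<exists>\<alpha>\<in>words. unit \<alpha> \<alpha> \<in> I"
proof -
  note F = fixed_star_subalgebra[unfolded star_subalgebra_def]
  note smult = left_ideal_smult[OF sub left]
  have x0c: "x0 \<in> carrier A" using x0 sub fixed_carrier by auto
  have n0: "0 < nrm A x0" using x0 x0c nrm_nonneg[OF x0c] nrm_eq_0_iff[OF x0c] by linarith
  define x where "x = complex_of_real (1 / nrm A x0) \<odot> x0"
  have x: "x \<in> I" "nrm A x = 1" using smult x0 x0c n0 by (auto simp: x_def nrm_smult norm_divide)
  have xf: "x \<in> fixed" "x \<in> carrier A" using x sub fixed_carrier by auto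
  \<comment> \<open>With \<open>nrm A x = 1\<close>, the norm of \<open>y\<close> exceeds 9/10, so
    some column \<open>v\<close> of norm \<open>r\<close> is not shrunk to 8/10 of its norm, and
    \<open>c\<close> has modulus above 64/100 of \<open>r * r\<close>. The error of \<open>Q\<close>
    is at most (1/10 + 11/100) times \<open>r * r\<close>, which is smaller.\<close>
  obtain y where "y \<in> blocks" and xy: "nrm A (x \<ominus> y) < 1 / 10"
    using blocks_dense[OF xf(1), of "1 / 10"] by auto
  then obtain n where y: "y \<in> block n" by (auto simp: blocks_def)
  have yc: "y \<in> carrier A" using y by (rule block_carrier)
  have "nrm A y \<le> 11 / 10"
    using nrm_le_add_diff[OF yc xf(2)] nrm_diff_commute[OF xf(2) yc] xy x by simp
  have "9 / 10 < nrm A y" using nrm_le_add_diff[OF xf(2) yc] xy x by simp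
  then have "\<not> col_bound n (8 / 10) y" using nrm_le_col_bound[OF y, of "8 / 10"] by auto
  then obtain m v where v: "v \<in> cols n m" and big: "8 / 10 * nrm A v < nrm A (y \<otimes> v)"
    unfolding col_bound_def by (auto simp: not_le)
  have vc: "v \<in> carrier A" using v by (rule cols_carrier)
  have "v \<noteq> \<zero>" using big yc by auto
  \<comment> \<open>A nonzero column guarantees a stopped word \<open>\<alpha>\<close> of weight
    \<open>m\<close>; its projection will be the corner.\<close>
  then have "col_units n m \<noteq> {}" using v lin_span_empty unfolding cols_def by auto
  then obtain \<alpha> where a: "\<alpha> \<in> stop n" "weight \<alpha> = m" by (auto simp: col_units_def)
  have aw: "\<alpha> \<in> words" using a stop_words by auto
  obtain c where c: "star A (y \<otimes> v) \<otimes> (y \<otimes> v) = c \<odot> \<one>"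
    using star_col_col block_mult_col[OF y v] by blast
  define r where "r = nrm A v"
  have r: "0 < r" using vc \<open>v \<noteq> \<zero>\<close> nrm_nonneg[OF vc] nrm_eq_0_iff[OF vc] by (auto simp: r_def)
  have "cmod c = (nrm A (y \<otimes> v))\<^sup>2"
    using cstar_identity[of "y \<otimes> v"] yc vc nrm_one[OF nonzero] by (simp add: c nrm_smult)
  moreover have "(8 / 10 * r)\<^sup>2 < (nrm A (y \<otimes> v))\<^sup>2"
    using big r by (intro power_strict_mono) (auto simp: r_def)
  ultimately have cbig: "64 / 100 * (r * r) < cmod c" by (simp add: power2_eq_square)
  have rr: "0 < r * r" using r by simp
  then have cpos: "0 < cmod c" using cbig by linarith
  define Q where "Q = star A (x \<otimes> v) \<otimes> (x \<otimes> v)"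
  have Qc: "Q \<in> carrier A" using xf vc by (simp add: Q_def)
  have near: "nrm A (Q \<ominus> c \<odot> \<one>) \<le> 21 / 100 * (r * r)"
  proof -
    have d: "nrm A (x \<otimes> v \<ominus> y \<otimes> v) \<le> 1 / 10 * r"
      unfolding diff_mult_left[OF xf(2) yc vc, symmetric] r_def
      using xf yc vc xy by (intro nrm_mult_le) auto
    have "Q \<ominus> c \<odot> \<one> = star A (x \<otimes> v) \<otimes> (x \<otimes> v \<ominus> y \<otimes> v) \<oplus> star A (x \<otimes> v \<ominus> y \<otimes> v) \<otimes> (y \<otimes> v)"
      unfolding Q_def c[symmetric] using xf yc vc
      by (simp add: star_diff diff_mult_left diff_mult_right diff_add_diff)
    moreover have "nrm A (star A (x \<otimes> v) \<otimes> (x \<otimes> v \<ominus> y \<otimes> v)) \<le> (1 * r) * (1 / 10 * r)"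
      using xf yc vc d x nrm_mult_le[OF xf(2) vc, of 1 r] by (intro nrm_mult_le) (auto simp: r_def)
    moreover have "nrm A (star A (x \<otimes> v \<ominus> y \<otimes> v) \<otimes> (y \<otimes> v)) \<le> (1 / 10 * r) * (11 / 10 * r)"
    proof (rule nrm_mult_le)
      show "nrm A (y \<otimes> v) \<le> 11 / 10 * r"
        using nrm_mult_le[OF yc vc \<open>nrm A y \<le> 11 / 10\<close>, of r] by (simp add: r_def)
    qed (use xf yc vc d in auto)
    ultimately show ?thesis
      using nrm_triangle[of "star A (x \<otimes> v) \<otimes> (x \<otimes> v \<ominus> y \<otimes> v)" "star A (x \<otimes> v \<ominus> y \<otimes> v) \<otimes> (y \<otimes> v)"]
        xf yc vc by simp
  qed
  define q where "q = (1 / c) \<odot> Q"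
  have qc: "q \<in> carrier A" using Qc by (simp add: q_def)
  have q: "nrm A (\<one> \<ominus> q) < 1"
  proof -
    have "q \<ominus> \<one> = (1 / c) \<odot> (Q \<ominus> c \<odot> \<one>)"
      using Qc cpos by (auto simp: q_def smult_diff_right smult_smult)
    then have "nrm A (\<one> \<ominus> q) = nrm A (Q \<ominus> c \<odot> \<one>) / cmod c"
      using Qc qc nrm_diff_commute[of q \<one>] by (simp add: nrm_smult norm_divide)
    also have "nrm A (Q \<ominus> c \<odot> \<one>) < cmod c" using near cbig rr by linarith
    then have "nrm A (Q \<ominus> c \<odot> \<one>) / cmod c < 1" using cpos by simp
    finally show ?thesis .
  qed
  define z where "z = w \<alpha> \<otimes> q \<otimes> star A (w \<alpha>)"
  define e where "e = unit \<alpha> \<alpha>"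
  have ef: "e \<in> fixed" "e \<in> carrier A" using aw unit_fixed by (auto simp: e_def)
  have zI: "z \<in> I"
  proof -
    \<comment> \<open>\<open>\<sigma>\<close> multiplies \<open>v\<close> by a phase; the factor
      \<open>star A (w \<alpha>)\<close>, whose word has the same weight \<open>m\<close>, cancels
      it, so that \<open>u\<close> is fixed.\<close>
    define u where "u = v \<otimes> star A (w \<alpha>)"
    have u: "u \<in> fixed" using col_mult_star[OF v a] block_fixed by (auto simp: u_def)
    have "star A (x \<otimes> u) \<otimes> x \<otimes> u \<in> I"
      using u xf x F left right by auto
    moreover have "star A (x \<otimes> u) \<otimes> x \<otimes> u = w \<alpha> \<otimes> Q \<otimes> star A (w \<alpha>)"
      using xf vc aw by (simp add: u_def Q_def star_mult star_star m_assoc)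
    moreover have "z = (1 / c) \<odot> (w \<alpha> \<otimes> Q \<otimes> star A (w \<alpha>))"
      using aw Qc by (simp add: z_def q_def smult_mult_left smult_mult_right)
    ultimately show ?thesis using smult by simp
  qed
  then have zf: "z \<in> fixed" "z \<in> carrier A" using sub fixed_carrier by auto
  have ez: "nrm A (e \<ominus> z) < 1"
  proof -
    have "e \<ominus> z = w \<alpha> \<otimes> (\<one> \<ominus> q) \<otimes> star A (w \<alpha>)"
      using aw qc by (simp add: e_def z_def diff_mult_left diff_mult_right)
    moreover have "nrm A (w \<alpha> \<otimes> (\<one> \<ominus> q) \<otimes> star A (w \<alpha>)) \<le> (1 * nrm A (\<one> \<ominus> q)) * 1"
      using aw qc by (intro nrm_mult_le) auto
    ultimately show ?thesis using q by simp
  qed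
  \<comment> \<open>Adding \<open>\<one> \<ominus> e\<close> turns \<open>z\<close>, which is close
    to \<open>e\<close>, into an element close to \<open>\<one>\<close>; conversely
    \<open>e \<otimes> g = z\<close>.\<close>
  define g where "g = (\<one> \<ominus> e) \<oplus> z"
  have minusf: "a \<ominus> b \<in> fixed" if "a \<in> fixed" "b \<in> fixed" for a b
    using that F fixed_carrier by (auto simp: a_minus_def minus_conv_smult)
  have gf: "g \<in> fixed" "g \<in> carrier A"
    using minusf[OF one_fixed ef(1)] zf(1) F fixed_carrier by (auto simp: g_def)
  have "\<one> \<ominus> g = e \<ominus> z"
  proof -
    have "\<one> \<ominus> g = (\<one> \<ominus> (\<one> \<ominus> e)) \<oplus> \<ominus> z" using ef zf by (simp add: g_def a_minus_def minus_add a_assoc)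
    also have "\<one> \<ominus> (\<one> \<ominus> e) = e" using ef by (simp add: a_minus_def minus_add r_neg2)
    finally show ?thesis by (simp add: a_minus_def)
  qed
  then have g1: "nrm A (\<one> \<ominus> g) < 1" using ez by simp
  \<comment> \<open>The inverse of \<open>g\<close> is taken inside the fixed-point algebra, because
    the ideal absorbs fixed elements only.\<close>
  interpret Fx: cstar_algebra "A\<lparr>carrier := fixed\<rparr>" by (rule cstar_fixed)
  obtain h where h: "h \<in> fixed" "g \<otimes> h = \<one>"
    using Fx.right_inverse_exists[of g] gf g1 fixed_minus[OF one_fixed gf(1)] by auto
  have hc: "h \<in> carrier A" using h fixed_carrier by auto
  have ee: "e \<otimes> e = e" unfolding e_def using aw by (rule unit_mult_unit_same[OF _ _ aw]) (rule aw)
  have eza: "e \<otimes> z = z"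
    using aw qc by (simp add: e_def z_def m_assoc) (simp add: aw qc flip: m_assoc)
  have "e \<otimes> g = z" using ef zf by (simp add: g_def r_distr diff_mult_right ee eza)
  then have "e = z \<otimes> h" using h hc ef gf m_assoc[of e g h] by simp
  then have "e \<in> I" using right[OF h(1) zI] by simp
  then show ?thesis using aw by (auto simp: e_def)
qed

lemma simple_fixed: "simple_cstar_algebra (A\<lparr>carrier := fixed\<rparr>)"
  unfolding simple_cstar_algebra_def
proof (intro conjI allI impI)
  show "cstar_algebra (A\<lparr>carrier := fixed\<rparr>)" by (rule cstar_fixed)
  show "carrier (A\<lparr>carrier := fixed\<rparr>) \<noteq> {\<zero>\<^bsub>A\<lparr>carrier := fixed\<rparr>\<^esub>}"
    using one_fixed nonzero by auto
  fix I assume "ideal I (A\<lparr>carrier := fixed\<rparr>) \<and> closedin (cstar_topology (A\<lparr>carrier := fixed\<rparr>)) I"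
  then interpret I: ideal I "A\<lparr>carrier := fixed\<rparr>" by blast
  have sub: "I \<subseteq> fixed" using I.a_subset by simp
  have left: "x \<otimes> a \<in> I" and right: "a \<otimes> x \<in> I" if "x \<in> fixed" "a \<in> I" for x a
    using I.I_l_closed[of a x] I.I_r_closed[of a x] that by auto
  have zero: "\<zero> \<in> I" using additive_subgroup.zero_closed[OF I.is_additive_subgroup] by simp
  have add: "x \<oplus> y \<in> I" if "x \<in> I" "y \<in> I" for x y
    using additive_subgroup.a_closed[OF I.is_additive_subgroup that] by simp
  have "I = fixed" if "x \<in> I" "x \<noteq> \<zero>" for x
    using ideal_contains_unit[OF sub left right that] ideal_eq_fixed_if_unit[OF sub zero add left right]
    by blast
  then show "I = {\<zero>\<^bsub>A\<lparr>carrier := fixed\<rparr>\<^esub>} \<or> I = carrier (A\<lparr>carrier := fixed\<rparr>)"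
    using zero by auto
qed

end

section \<open>The state\<close>

lemma (in cstar_algebra) linear_functional_finsum:
  fixes \<phi> :: "'a \<Rightarrow> complex"
  assumes add: "\<And>x y. x \<in> carrier A \<Longrightarrow> y \<in> carrier A \<Longrightarrow> \<phi> (x \<oplus> y) = \<phi> x + \<phi> y"
    and smult: "\<And>c x. x \<in> carrier A \<Longrightarrow> \<phi> (c \<odot> x) = c * \<phi> x"
    and "finite I" "\<And>i. i \<in> I \<Longrightarrow> f i \<in> carrier A"
  shows "\<phi> (\<Oplus>i\<in>I. c i \<odot> f i) = (\<Sum>i\<in>I. c i * \<phi> (f i))"
  using assms(3,4)
proof (induction I)
  case empty
  then show ?case using smult[of \<zero> 0] by simp
next
  case (insert i I)
  then have "(\<Oplus>i\<in>insert i I. c i \<odot> f i) = c i \<odot> f i \<oplus> (\<Oplus>i\<in>I. c i \<odot> f i)"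
    by (intro finsum_insert) auto
  moreover have "(\<Oplus>i\<in>I. c i \<odot> f i) \<in> carrier A" using insert by (intro finsum_closed) auto
  ultimately show ?case using insert by (simp add: add smult)
qed

lemma (in cstar_algebra) star_finsum:
  "finite I \<Longrightarrow> (\<And>i. i \<in> I \<Longrightarrow> f i \<in> carrier A) \<Longrightarrow> star A (finsum A f I) = (\<Oplus>i\<in>I. star A (f i))"
proof (induction I rule: finite_induct)
  case (insert i I)
  then have "finsum A f (insert i I) = f i \<oplus> finsum A f I" by (intro finsum_insert) auto
  moreover have "(\<Oplus>i\<in>insert i I. star A (f i)) = star A (f i) \<oplus> (\<Oplus>i\<in>I. star A (f i))"
    using insert by (intro finsum_insert) auto
  moreover have "finsum A f I \<in> carrier A" using insert by (intro finsum_closed) auto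
  ultimately show ?case using insert by (simp add: star_add)
qed simp

lemma sum_nonneg_Reals:
  "(\<And>i. i \<in> I \<Longrightarrow> f i \<in> \<real>\<^sub>\<ge>\<^sub>0) \<Longrightarrow> (\<Sum>i\<in>I. f i) \<in> (\<real>\<^sub>\<ge>\<^sub>0 :: complex set)"
  by (induction I rule: infinite_finite_induct) auto

locale cuntz_kms = cuntz_gauge A d s L \<sigma>
  for A :: "'a cstar_alg" (structure) and d s L \<sigma> +
  fixes \<beta> :: real
  assumes beta_pos: "0 < \<beta>" and sum_p: "(\<Sum>i=1..d. exp (- \<beta> * real (L i))) = 1"
begin

section \<open>The transfer operator \<open>\<Phi>\<close>\<close>

definition p :: "nat \<Rightarrow> real" where "p i = exp (- \<beta> * real (L i))"

lemma p_pos: "0 < p i" by (simp add: p_def)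

lemma sum_p_1: "(\<Sum>i=1..d. p i) = 1" using sum_p by (simp add: p_def)

text \<open>On a unit with two nonempty words this removes both first letters: equal letters
  \<open>i\<close> contribute the factor \<open>p i\<close>, different ones give
  \<open>\<zero>\<close>. The prescribed values are invariant under \<open>\<Phi>\<close>, which
  suggests recovering the state from the iterates.\<close>

definition \<Phi> :: "'a \<Rightarrow> 'a" where
  "\<Phi> x = (\<Oplus>i\<in>{1..d}. complex_of_real (p i) \<odot> (star A (s i) \<otimes> x \<otimes> s i))"

lemma Phi_closed [simp, intro]: "x \<in> carrier A \<Longrightarrow> \<Phi> x \<in> carrier A"
  unfolding \<Phi>_def by (intro finsum_closed) auto

lemma Phi_add:
  assumes "x \<in> carrier A" "y \<in> carrier A" shows "\<Phi> (x \<oplus> y) = \<Phi> x \<oplus> \<Phi> y"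
proof -
  let ?f = "\<lambda>x i. complex_of_real (p i) \<odot> (star A (s i) \<otimes> x \<otimes> s i)"
  have "\<Phi> (x \<oplus> y) = (\<Oplus>i\<in>{1..d}. ?f x i \<oplus> ?f y i)"
    unfolding \<Phi>_def using assms
    by (intro finsum_cong') (auto simp: l_distr r_distr smult_add_right simp del: finsum_addf)
  also have "\<dots> = \<Phi> x \<oplus> \<Phi> y"
    unfolding \<Phi>_def using assms by (intro finsum_addf) auto
  finally show ?thesis .
qed

lemma Phi_smult:
  assumes "x \<in> carrier A" shows "\<Phi> (c \<odot> x) = c \<odot> \<Phi> x"
proof -
  have "c \<odot> \<Phi> x = (\<Oplus>i\<in>{1..d}. c \<odot> (complex_of_real (p i) \<odot> (star A (s i) \<otimes> x \<otimes> s i)))"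
    using scalars.finsum_smult_ldistr[of "{1..d}" c] assms
    by (simp add: \<Phi>_def ring_of_type_algebra_def)
  also have "\<dots> = \<Phi> (c \<odot> x)" unfolding \<Phi>_def
    using assms by (intro finsum_cong')
      (auto simp: smult_smult smult_mult_left smult_mult_right mult.commute)
  finally show ?thesis by simp
qed

lemma Phi_star:
  assumes "x \<in> carrier A" shows "\<Phi> (star A x) = star A (\<Phi> x)"
proof -
  have "star A (\<Phi> x) = (\<Oplus>i\<in>{1..d}. star A (complex_of_real (p i) \<odot> (star A (s i) \<otimes> x \<otimes> s i)))"
    unfolding \<Phi>_def using assms by (intro star_finsum) auto
  also have "\<dots> = \<Phi> (star A x)" unfolding \<Phi>_def
    using assms by (intro finsum_cong') (auto simp: star_smult star_mult star_star m_assoc)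
  finally show ?thesis by simp
qed

lemma Phi_nrm_le:
  assumes x: "x \<in> carrier A" shows "nrm A (\<Phi> x) \<le> nrm A x"
proof -
  have g: "nrm A (s i) = 1" if "i \<in> {1..d}" for i
    using that by (intro nrm_isometry) (auto simp: star_gen_gen)
  have "nrm A (\<Phi> x) \<le> (\<Sum>i=1..d. nrm A (complex_of_real (p i) \<odot> (star A (s i) \<otimes> x \<otimes> s i)))"
    unfolding \<Phi>_def using x by (intro nrm_finsum_le) auto
  also have "\<dots> \<le> (\<Sum>i=1..d. p i * nrm A x)"
  proof (rule sum_mono)
    fix i assume i: "i \<in> {1..d}"
    have "nrm A (star A (s i) \<otimes> x \<otimes> s i) \<le> (1 * nrm A x) * 1"
      using i x g[OF i] by (intro nrm_mult_le) auto
    then show "nrm A (complex_of_real (p i) \<odot> (star A (s i) \<otimes> x \<otimes> s i)) \<le> p i * nrm A x"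
      using i x p_pos[of i] by (simp add: nrm_smult)
  qed
  also have "\<dots> = nrm A x" using sum_p_1 by (simp flip: sum_distrib_right)
  finally show ?thesis .
qed

lemma Phi_one: "\<Phi> \<one> = \<one>"
proof -
  have "\<Phi> \<one> = (\<Oplus>i\<in>{1..d}. complex_of_real (p i) \<odot> \<one>)"
    unfolding \<Phi>_def by (intro finsum_cong') (auto simp: star_gen_gen)
  also have "\<dots> = complex_of_real (\<Sum>i=1..d. p i) \<odot> \<one>"
    by (subst finsum_smult_const) auto
  also have "\<dots> = complex_of_real 1 \<odot> \<one>" by (simp only: sum_p_1)
  finally show ?thesis by simp
qed

lemma finsum_delta:
  assumes "i \<in> {1..d}" "\<And>k. k \<in> {1..d} \<Longrightarrow> f k = (if i = k then x else \<zero>)" "x \<in> carrier A"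
  shows "finsum A f {1..d} = x"
proof -
  have "finsum A f {1..d} = (\<Oplus>k\<in>{1..d}. if i = k then x else \<zero>)"
    using assms by (intro finsum_cong') auto
  then show ?thesis using assms add.finprod_singleton[of i "{1..d}" "\<lambda>_. x"] by simp
qed

lemma star_gen_word:
  "k \<in> {1..d} \<Longrightarrow> i # \<alpha> \<in> words \<Longrightarrow> star A (s k) \<otimes> w (i # \<alpha>) = (if i = k then w \<alpha> else \<zero>)"
  using star_word_Cons_word_Cons[of k i "[]" \<alpha>] by (auto simp: word_Cons)

lemma Phi_unit_Cons_Cons:
  assumes "i # \<alpha> \<in> words" "j # \<gamma> \<in> words"
  shows "\<Phi> (unit (i # \<alpha>) (j # \<gamma>)) = (if i = j then complex_of_real (p i) \<odot> unit \<alpha> \<gamma> else \<zero>)"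
proof -
  have i: "i \<in> {1..d}" "\<alpha> \<in> words" "\<gamma> \<in> words" using assms by auto
  have *: "star A (s k) \<otimes> unit (i # \<alpha>) (j # \<gamma>) \<otimes> s k = (if i = k \<and> j = k then unit \<alpha> \<gamma> else \<zero>)"
    if k: "k \<in> {1..d}" for k
  proof -
    have "star A (s k) \<otimes> unit (i # \<alpha>) (j # \<gamma>) \<otimes> s k =
        (star A (s k) \<otimes> w (i # \<alpha>)) \<otimes> star A (star A (s k) \<otimes> w (j # \<gamma>))"
      using assms k by (simp only: m_assoc star_mult star_star word_closed gen_closed star_closed m_closed)
    also have "\<dots> = (if i = k \<and> j = k then unit \<alpha> \<gamma> else \<zero>)"
      unfolding star_gen_word[OF k assms(1)] star_gen_word[OF k assms(2)] using i by simp
    finally show ?thesis .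
  qed
  show ?thesis unfolding \<Phi>_def
    by (rule finsum_delta[OF i(1)]) (use i in \<open>auto simp: *\<close>)
qed

text \<open>A word without a right-hand partner is rotated instead of shortened, but each
  application costs a factor \<open>p i\<close>, so its iterates tend to
  \<open>\<zero>\<close>.\<close>

lemma Phi_word_Cons:
  assumes "i # \<alpha> \<in> words"
  shows "\<Phi> (w (i # \<alpha>)) = complex_of_real (p i) \<odot> w (\<alpha> @ [i])"
proof -
  have i: "i \<in> {1..d}" "\<alpha> \<in> words" using assms by auto
  show ?thesis unfolding \<Phi>_def
    by (rule finsum_delta[OF i(1)]) (use i in \<open>auto simp: star_gen_word[OF _ assms] word_snoc\<close>)
qed

section \<open>Iterates of \<open>\<Phi>\<close> and their scalar limits\<close>

abbreviation iter :: "nat \<Rightarrow> 'a \<Rightarrow> 'a" where "iter n \<equiv> \<Phi> ^^ n"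

lemma iter_closed [simp, intro]: "x \<in> carrier A \<Longrightarrow> iter n x \<in> carrier A"
  by (induction n) auto

lemma iter_add: "x \<in> carrier A \<Longrightarrow> y \<in> carrier A \<Longrightarrow> iter n (x \<oplus> y) = iter n x \<oplus> iter n y"
  by (induction n) (auto simp: Phi_add)

lemma iter_smult: "x \<in> carrier A \<Longrightarrow> iter n (c \<odot> x) = c \<odot> iter n x"
  by (induction n) (auto simp: Phi_smult)

lemma iter_star: "x \<in> carrier A \<Longrightarrow> iter n (star A x) = star A (iter n x)"
  by (induction n) (auto simp: Phi_star)

lemma iter_one: "iter n \<one> = \<one>"
  by (induction n) (auto simp: Phi_one)

lemma iter_nrm_le: "x \<in> carrier A \<Longrightarrow> nrm A (iter n x) \<le> nrm A x"
proof (induction n)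
  case (Suc n)
  then show ?case using Phi_nrm_le[of "iter n x"] by simp
qed simp

lemma iter_diff: "x \<in> carrier A \<Longrightarrow> y \<in> carrier A \<Longrightarrow> iter n (x \<ominus> y) = iter n x \<ominus> iter n y"
  by (simp add: a_minus_def minus_conv_smult iter_add iter_smult)

text \<open>The state is obtained from the unital completely positive map \<open>\<Phi>\<close>: on every element, the
  iterates of \<open>\<Phi>\<close> converge to a scalar.\<close>

definition lim_scalar :: "'a \<Rightarrow> complex \<Rightarrow> bool" where
  "lim_scalar x c \<longleftrightarrow> (\<lambda>n. nrm A (iter n x \<ominus> c \<odot> \<one>)) \<longlonglongrightarrow> 0"

lemma lim_scalar_add:
  assumes x: "x \<in> carrier A" "lim_scalar x a" and y: "y \<in> carrier A" "lim_scalar y b"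
  shows "lim_scalar (x \<oplus> y) (a + b)"
  unfolding lim_scalar_def
proof (rule tendsto_sandwich[of "\<lambda>_. 0"])
  show "(\<lambda>n. nrm A (iter n x \<ominus> a \<odot> \<one>) + nrm A (iter n y \<ominus> b \<odot> \<one>)) \<longlonglongrightarrow> 0"
    using tendsto_add[of _ 0 _ _ 0] x y by (simp add: lim_scalar_def)
  have "nrm A (iter n (x \<oplus> y) \<ominus> (a + b) \<odot> \<one>) \<le> nrm A (iter n x \<ominus> a \<odot> \<one>) + nrm A (iter n y \<ominus> b \<odot> \<one>)" for n
    using x y nrm_triangle[of "iter n x \<ominus> a \<odot> \<one>" "iter n y \<ominus> b \<odot> \<one>"]
    by (simp add: iter_add smult_add_left add_diff_add)
  then show "\<forall>\<^sub>F n in sequentially. nrm A (iter n (x \<oplus> y) \<ominus> (a + b) \<odot> \<one>)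
      \<le> nrm A (iter n x \<ominus> a \<odot> \<one>) + nrm A (iter n y \<ominus> b \<odot> \<one>)" by simp
qed (use x y in \<open>auto simp: nrm_nonneg\<close>)

lemma lim_scalar_smult:
  assumes "x \<in> carrier A" "lim_scalar x a" shows "lim_scalar (c \<odot> x) (c * a)"
proof -
  have "nrm A (iter n (c \<odot> x) \<ominus> (c * a) \<odot> \<one>) = cmod c * nrm A (iter n x \<ominus> a \<odot> \<one>)" for n
  proof -
    have "iter n (c \<odot> x) \<ominus> (c * a) \<odot> \<one> = c \<odot> (iter n x \<ominus> a \<odot> \<one>)"
      using assms by (simp add: iter_smult smult_diff_right smult_smult)
    then show ?thesis using assms by (simp add: nrm_smult)
  qed
  then show ?thesis using assms(2) tendsto_mult_left[of _ 0 _ "cmod c"] by (simp add: lim_scalar_def)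
qed

lemma lim_scalar_star:
  assumes "x \<in> carrier A" "lim_scalar x a" shows "lim_scalar (star A x) (cnj a)"
proof -
  have "nrm A (iter n (star A x) \<ominus> cnj a \<odot> \<one>) = nrm A (iter n x \<ominus> a \<odot> \<one>)" for n
  proof -
    have "iter n (star A x) \<ominus> cnj a \<odot> \<one> = star A (iter n x \<ominus> a \<odot> \<one>)"
      using assms by (simp add: iter_star star_diff star_smult)
    then show ?thesis using assms by simp
  qed
  then show ?thesis using assms(2) by (simp add: lim_scalar_def)
qed

lemma lim_scalar_Phi: "lim_scalar (\<Phi> x) c \<longleftrightarrow> lim_scalar x c"
  unfolding lim_scalar_def
  using filterlim_sequentially_Suc[of "\<lambda>n. nrm A (iter n x \<ominus> c \<odot> \<one>)"]
  by (simp add: funpow_swap1)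

lemma lim_scalar_one: "lim_scalar \<one> 1"
  by (simp add: lim_scalar_def iter_one)

lemma lim_scalar_zero: "lim_scalar \<zero> 0"
  using lim_scalar_smult[OF _ lim_scalar_one, of 0] by simp

text \<open>The iterates are contractive. Uniqueness of the limit, continuity of the functional and
  its extension from the dense span all rest on this bound.\<close>

lemma lim_scalar_bound:
  assumes x: "x \<in> carrier A" and c: "lim_scalar x c"
  shows "cmod c \<le> nrm A x"
proof (rule LIMSEQ_le_const)
  show "(\<lambda>n. nrm A x + nrm A (iter n x \<ominus> c \<odot> \<one>)) \<longlonglongrightarrow> nrm A x"
    using tendsto_add[OF tendsto_const[of "nrm A x"] c[unfolded lim_scalar_def]] by simp
  have "cmod c \<le> nrm A x + nrm A (iter n x \<ominus> c \<odot> \<one>)" for n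
  proof -
    have "cmod c = nrm A (c \<odot> \<one>)" by (simp add: nrm_smult nrm_one[OF nonzero])
    also have "\<dots> \<le> nrm A (iter n x) + nrm A (c \<odot> \<one> \<ominus> iter n x)"
      using x by (intro nrm_le_add_diff) auto
    also have "\<dots> \<le> nrm A x + nrm A (iter n x \<ominus> c \<odot> \<one>)"
      using x iter_nrm_le[OF x, of n] nrm_diff_commute[of "c \<odot> \<one>" "iter n x"] by simp
    finally show ?thesis .
  qed
  then show "\<exists>N. \<forall>n\<ge>N. cmod c \<le> nrm A x + nrm A (iter n x \<ominus> c \<odot> \<one>)" by blast
qed

lemma lim_scalar_diff:
  assumes "x \<in> carrier A" "lim_scalar x a" "y \<in> carrier A" "lim_scalar y b"
  shows "lim_scalar (x \<ominus> y) (a - b)"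
  using lim_scalar_add[OF assms(1,2) _ lim_scalar_smult[OF assms(3,4), of "- 1"]] assms
  by (simp add: a_minus_def minus_conv_smult)

lemma lim_scalar_unique:
  assumes "x \<in> carrier A" "lim_scalar x a" "lim_scalar x b" shows "a = b"
  using lim_scalar_bound[OF _ lim_scalar_diff[OF assms(1,2) assms(1,3)]] assms(1) by simp

lemma lim_scalar_word:
  assumes "\<alpha> \<in> words" "\<alpha> \<noteq> []" shows "lim_scalar (w \<alpha>) 0"
proof -
  \<comment> \<open>All weights are at least 1, so \<open>q\<close> bounds every \<open>p i\<close>
    at once.\<close>
  define q where "q = exp (- \<beta>)"
  have q: "0 < q" "q < 1" using beta_pos by (auto simp: q_def)
  have bound: "nrm A (iter n (w \<alpha>)) \<le> q ^ n" if "\<alpha> \<in> words" "\<alpha> \<noteq> []" for n \<alpha>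
    using that
  proof (induction n arbitrary: \<alpha>)
    case (Suc n)
    then obtain i \<gamma> where a: "\<alpha> = i # \<gamma>" by (cases \<alpha>) auto
    have i: "i \<in> {1..d}" "\<gamma> \<in> words" using Suc.prems a by auto
    have pq: "p i \<le> q" using beta_pos weight_pos[OF i(1)] by (simp add: p_def q_def)
    have "iter (Suc n) (w \<alpha>) = iter n (\<Phi> (w \<alpha>))" by (simp add: funpow_swap1)
    also have "\<dots> = complex_of_real (p i) \<odot> iter n (w (\<gamma> @ [i]))"
      using Suc.prems i by (simp add: a Phi_word_Cons iter_smult)
    finally have "nrm A (iter (Suc n) (w \<alpha>)) = p i * nrm A (iter n (w (\<gamma> @ [i])))"
      using i p_pos[of i] by (simp add: nrm_smult)
    also have "\<dots> \<le> q * q ^ n"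
      using Suc.IH[of "\<gamma> @ [i]"] i pq p_pos[of i] q nrm_nonneg[of "iter n (w (\<gamma> @ [i]))"]
      by (intro mult_mono) auto
    finally show ?case by simp
  qed (use nrm_word in simp)
  have "(\<lambda>n. nrm A (iter n (w \<alpha>))) \<longlonglongrightarrow> 0"
  proof (rule tendsto_sandwich[of "\<lambda>_. 0"])
    show "(\<lambda>n. q ^ n) \<longlonglongrightarrow> 0" using q by (intro LIMSEQ_power_zero) auto
  qed (use bound[OF assms] assms in \<open>auto simp: nrm_nonneg\<close>)
  moreover have "iter n (w \<alpha>) \<ominus> 0 \<odot> \<one> = iter n (w \<alpha>)" for n
    using assms by (simp add: a_minus_def)
  ultimately show ?thesis by (simp add: lim_scalar_def)
qed

text \<open>\<open>\<Phi>\<close> strips equal first letters and collects their factors until a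
  mismatch gives \<open>\<zero>\<close> or a word is exhausted; what is then left is
  \<open>\<one>\<close> or a nonempty word or its adjoint, with limit 0.\<close>

lemma lim_scalar_unit:
  "\<alpha> \<in> words \<Longrightarrow> \<gamma> \<in> words \<Longrightarrow>
    lim_scalar (unit \<alpha> \<gamma>) (if \<alpha> = \<gamma> then complex_of_real (\<Prod>i\<leftarrow>\<alpha>. p i) else 0)"
proof (induction \<alpha> arbitrary: \<gamma>)
  case Nil
  then show ?case
    using lim_scalar_one lim_scalar_star[OF _ lim_scalar_word[of \<gamma>]] by auto
next
  case (Cons i \<alpha>)
  show ?case
  proof (cases \<gamma>)
    case Nil
    then show ?thesis using lim_scalar_word[of "i # \<alpha>"] Cons.prems by simp
  next
    case (Cons j \<nu>)
    have w: "i \<in> {1..d}" "\<alpha> \<in> words" "j \<in> {1..d}" "\<nu> \<in> words" using Cons.prems \<open>\<gamma> = j # \<nu>\<close> by auto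
    have "lim_scalar (\<Phi> (unit (i # \<alpha>) (j # \<nu>)))
        (if i # \<alpha> = j # \<nu> then complex_of_real (\<Prod>k\<leftarrow>i # \<alpha>. p k) else 0)"
      using lim_scalar_smult[OF _ Cons.IH[OF w(2,4)], of "complex_of_real (p i)"] w lim_scalar_zero
      by (subst Phi_unit_Cons_Cons) (auto split: if_splits)
    then show ?thesis by (simp only: lim_scalar_Phi Cons)
  qed
qed

lemma lim_scalar_span: "y \<in> lin_span A units \<Longrightarrow> \<exists>c. lim_scalar y c"
proof (induction rule: lin_span.induct)
  case zero
  show ?case using lim_scalar_zero by blast
next
  case (base y)
  then show ?case using lim_scalar_unit unfolding units_def by blast
next
  case (add x y)
  then show ?case using lim_scalar_add lin_span_carrier[OF units_closed] by blast
next
  case (smult x c)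
  then show ?case using lim_scalar_smult lin_span_carrier[OF units_closed] by blast
qed

lemma lim_scalar_exists:
  assumes x: "x \<in> carrier A" shows "\<exists>c. lim_scalar x c"
proof -
  have "\<exists>y c. y \<in> carrier A \<and> nrm A (x \<ominus> y) < 1 / Suc k \<and> lim_scalar y c" for k
    using span_units_dense[OF generated x, of "1 / Suc k"] lim_scalar_span
      lin_span_carrier[OF units_closed] by fastforce
  then obtain y c where y: "\<And>k. y k \<in> carrier A" "\<And>k. nrm A (x \<ominus> y k) < 1 / Suc k"
    "\<And>k. lim_scalar (y k) (c k)" by metis
  \<comment> \<open>Differences of the limits are bounded by distances of the approximants, so the
    limits form a Cauchy sequence.\<close>
  have dist: "cmod (c k - c l) \<le> 1 / Suc k + 1 / Suc l" for k l
  proof -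
    have "cmod (c k - c l) \<le> nrm A (y k \<ominus> y l)"
      using y by (intro lim_scalar_bound lim_scalar_diff) auto
    also have "\<dots> \<le> nrm A (x \<ominus> y k) + nrm A (x \<ominus> y l)"
      using nrm_diff_triangle[of "y k" x "y l"] y x nrm_diff_commute[of x "y k"] by simp
    finally show ?thesis using y(2)[of k] y(2)[of l] by simp
  qed
  have small: "1 / real (Suc k) \<le> 1 / real (Suc n)" if "n \<le> k" for n k
    using that by (simp add: frac_le)
  have "Cauchy c"
  proof (rule CauchyI)
    fix e :: real assume e: "0 < e"
    obtain M where M: "1 / real (Suc M) < e / 2" using nat_approx_posE[of "e / 2"] e by auto
    have "norm (c m - c n) < e" if "M \<le> m" "M \<le> n" for m n
      using dist[of m n] small[OF that(1)] small[OF that(2)] M by linarith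
    then show "\<exists>M. \<forall>m\<ge>M. \<forall>n\<ge>M. norm (c m - c n) < e" by blast
  qed
  then obtain a where a: "c \<longlonglongrightarrow> a" using Cauchy_convergent convergent_def by blast
  have "lim_scalar x a"
    unfolding lim_scalar_def
  proof (rule LIMSEQ_I)
    fix e :: real assume e: "0 < e"
    obtain M where M: "\<And>k. M \<le> k \<Longrightarrow> norm (c k - a) < e / 3"
      using LIMSEQ_D[OF a, of "e / 3"] e by auto
    obtain K where K: "1 / real (Suc K) < e / 3" using nat_approx_posE[of "e / 3"] e by auto
    define k where "k = max M K"
    have k: "cmod (c k - a) < e / 3" "nrm A (x \<ominus> y k) < e / 3"
      using M[of k] small[of K k] K y(2)[of k] by (auto simp: k_def)
    obtain N where N: "\<And>n. N \<le> n \<Longrightarrow> \<bar>nrm A (iter n (y k) \<ominus> c k \<odot> \<one>)\<bar> < e / 3"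
      using LIMSEQ_D[OF y(3)[of k, unfolded lim_scalar_def], of "e / 3"] e by auto
    have "norm (nrm A (iter n x \<ominus> a \<odot> \<one>) - 0) < e" if n: "N \<le> n" for n
    proof -
      have "nrm A (iter n x \<ominus> iter n (y k)) < e / 3"
        using iter_nrm_le[of "x \<ominus> y k" n] x y(1) k by (simp add: iter_diff)
      moreover have "nrm A (c k \<odot> \<one> \<ominus> a \<odot> \<one>) < e / 3"
        using k by (simp add: nrm_smult nrm_one[OF nonzero] flip: smult_diff_left)
      moreover have "nrm A (iter n x \<ominus> a \<odot> \<one>) \<le> nrm A (iter n x \<ominus> iter n (y k)) +
          (nrm A (iter n (y k) \<ominus> c k \<odot> \<one>) + nrm A (c k \<odot> \<one> \<ominus> a \<odot> \<one>))"
        using nrm_diff_triangle[of "iter n x" "iter n (y k)" "a \<odot> \<one>"]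
          nrm_diff_triangle[of "iter n (y k)" "c k \<odot> \<one>" "a \<odot> \<one>"] x y(1)[of k] by simp
      ultimately show ?thesis
        using N[OF n] x nrm_nonneg[of "iter n x \<ominus> a \<odot> \<one>"] by simp
    qed
    then show "\<exists>no. \<forall>n\<ge>no. norm (nrm A (iter n x \<ominus> a \<odot> \<one>) - 0) < e" by blast
  qed
  then show ?thesis by blast
qed

definition \<omega> :: "'a \<Rightarrow> complex" where
  "\<omega> = restrict (\<lambda>x. THE c. lim_scalar x c) (carrier A)"

lemma lim_scalar_omega: "x \<in> carrier A \<Longrightarrow> lim_scalar x (\<omega> x)"
proof -
  assume x: "x \<in> carrier A"
  then obtain c where c: "lim_scalar x c" using lim_scalar_exists by blast
  then have "(THE c. lim_scalar x c) = c"
    by (rule the_equality) (rule lim_scalar_unique[OF x _ c])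
  then show ?thesis using x c by (simp add: \<omega>_def)
qed

lemma omega_eqI: "x \<in> carrier A \<Longrightarrow> lim_scalar x c \<Longrightarrow> \<omega> x = c"
  using lim_scalar_omega lim_scalar_unique by blast

lemma omega_add: "x \<in> carrier A \<Longrightarrow> y \<in> carrier A \<Longrightarrow> \<omega> (x \<oplus> y) = \<omega> x + \<omega> y"
  by (intro omega_eqI lim_scalar_add lim_scalar_omega) auto

lemma omega_smult: "x \<in> carrier A \<Longrightarrow> \<omega> (c \<odot> x) = c * \<omega> x"
  by (intro omega_eqI lim_scalar_smult lim_scalar_omega) auto

lemma omega_star: "x \<in> carrier A \<Longrightarrow> \<omega> (star A x) = cnj (\<omega> x)"
  by (intro omega_eqI lim_scalar_star lim_scalar_omega) auto

lemma omega_Phi: "x \<in> carrier A \<Longrightarrow> \<omega> (\<Phi> x) = \<omega> x"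
  by (intro omega_eqI) (auto simp: lim_scalar_Phi lim_scalar_omega)

lemma omega_one: "\<omega> \<one> = 1"
  by (intro omega_eqI lim_scalar_one) auto

lemma omega_zero: "\<omega> \<zero> = 0"
  by (intro omega_eqI lim_scalar_zero) auto

lemma omega_unit:
  "\<alpha> \<in> words \<Longrightarrow> \<gamma> \<in> words \<Longrightarrow>
    \<omega> (unit \<alpha> \<gamma>) = (if \<alpha> = \<gamma> then complex_of_real (\<Prod>i\<leftarrow>\<alpha>. p i) else 0)"
  by (intro omega_eqI lim_scalar_unit) auto

lemma omega_diff_le:
  "x \<in> carrier A \<Longrightarrow> y \<in> carrier A \<Longrightarrow> cmod (\<omega> x - \<omega> y) \<le> nrm A (x \<ominus> y)"
  by (intro lim_scalar_bound lim_scalar_diff lim_scalar_omega) auto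

section \<open>Positivity of \<open>\<omega>\<close>\<close>

lemma omega_star_word_word:
  assumes a: "\<alpha> \<in> words" "\<gamma> \<in> words"
  shows "\<omega> (star A (w \<alpha>) \<otimes> w \<gamma>) = (if \<alpha> = \<gamma> then 1 else 0)"
proof -
  have word: "\<omega> (w \<kappa>) = (if \<kappa> = [] then 1 else 0)" if "\<kappa> \<in> words" for \<kappa>
    using omega_unit[of \<kappa> "[]"] that by simp
  \<comment> \<open>Distinct words leave \<open>\<zero>\<close>, a nonempty word or its adjoint, on
    all of which \<open>\<omega>\<close> vanishes; thus words are orthonormal for the form
    \<open>\<omega> (star A x \<otimes> y)\<close>.\<close>
  consider "\<alpha> = \<gamma>" | "\<alpha> \<noteq> \<gamma>" "star A (w \<alpha>) \<otimes> w \<gamma> = \<zero>"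
    | \<kappa> where "\<alpha> \<noteq> \<gamma>" "\<kappa> \<in> words" "\<kappa> \<noteq> []" "star A (w \<alpha>) \<otimes> w \<gamma> = w \<kappa>"
    | \<kappa> where "\<alpha> \<noteq> \<gamma>" "\<kappa> \<in> words" "\<kappa> \<noteq> []" "star A (w \<alpha>) \<otimes> w \<gamma> = star A (w \<kappa>)"
    using star_word_word_cases[OF a] by (metis append_Nil2)
  then show ?thesis
    by cases (use a in \<open>simp_all add: omega_one omega_zero omega_star word\<close>)
qed

text \<open>Positivity on the span of the units: \<open>\<omega> (x\<^sup>* x) = (\<Sum>i. p\<^sub>i \<omega> ((x s\<^sub>i)\<^sup>* (x s\<^sub>i)))\<close> reduces the
  length of the right-hand words until \<open>x\<close> is a combination of words, which are orthonormal.\<close>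

lemma omega_pos_words:
  assumes y: "y \<in> lin_span A (w ` words)" shows "\<omega> (star A y \<otimes> y) \<in> \<real>\<^sub>\<ge>\<^sub>0"
proof -
  obtain Y where "finite Y" "Y \<subseteq> w ` words" "y \<in> lin_span A Y"
    using lin_span_finite_support[OF y] by blast
  then obtain T where T: "finite T" "T \<subseteq> words" "y \<in> lin_span A (w ` T)"
    using finite_subset_image by metis
  have Tc: "w t \<in> carrier A" if "t \<in> T" for t using that T by auto
  obtain c where c: "y = (\<Oplus>t\<in>T. c t \<odot> w t)"
    using lin_span_representation[OF T(1) Tc T(3)] by blast
  have yc: "y \<in> carrier A" unfolding c using Tc by (intro finsum_closed) auto
  have lin: "\<omega> (star A x \<otimes> y) = (\<Sum>t\<in>T. c t * \<omega> (star A x \<otimes> w t))" if x: "x \<in> carrier A" for x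
    unfolding c using x Tc T(1)
    by (intro linear_functional_finsum[of "\<lambda>z. \<omega> (star A x \<otimes> z)"])
      (auto simp: r_distr omega_add smult_mult_right omega_smult)
  have coef: "\<omega> (star A y \<otimes> w t) = cnj (c t)" if t: "t \<in> T" for t
  proof -
    have "\<omega> (star A (w t) \<otimes> y) = (\<Sum>u\<in>T. c u * (if t = u then 1 else 0))"
      unfolding lin[OF Tc[OF t]] using T t
      by (intro sum.cong) (auto simp: omega_star_word_word subset_iff)
    also have "\<dots> = c t" using T t by (simp add: sum.delta if_distrib cong: if_cong)
    finally have "\<omega> (star A (w t) \<otimes> y) = c t" .
    moreover have "star A y \<otimes> w t = star A (star A (w t) \<otimes> y)"
      using yc Tc[OF t] by (simp add: star_mult star_star)
    ultimately show ?thesis using yc Tc[OF t] by (simp only: omega_star m_closed star_closed)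
  qed
  have "\<omega> (star A y \<otimes> y) = (\<Sum>t\<in>T. c t * cnj (c t))"
    unfolding lin[OF yc] using coef by (intro sum.cong) auto
  also have "\<dots> \<in> \<real>\<^sub>\<ge>\<^sub>0"
    by (intro sum_nonneg_Reals) (simp flip: complex_norm_square)
  finally show ?thesis .
qed

definition units_upto :: "nat \<Rightarrow> 'a set" where
  "units_upto k = {unit \<alpha> \<gamma> |\<alpha> \<gamma>. \<alpha> \<in> words \<and> \<gamma> \<in> words \<and> length \<gamma> \<le> k}"

lemma units_upto_closed: "units_upto k \<subseteq> carrier A"
  by (auto simp: units_upto_def)

lemma unit_in_units_upto:
  "\<alpha> \<in> words \<Longrightarrow> \<gamma> \<in> words \<Longrightarrow> length \<gamma> \<le> k \<Longrightarrow> unit \<alpha> \<gamma> \<in> units_upto k"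
  unfolding units_upto_def by blast

text \<open>A generator on the right cancels the first letter of the right-hand word or gives
  \<open>\<zero>\<close>; if that word is empty, it is appended to the left-hand one, whose length
  is not counted.\<close>

lemma units_upto_mult_gen:
  assumes x: "x \<in> lin_span A (units_upto (Suc k))" and i: "i \<in> {1..d}"
  shows "x \<otimes> s i \<in> lin_span A (units_upto k)"
proof (rule lin_span_mult[OF units_upto_closed _ _ x])
  show "{s i} \<subseteq> carrier A" using i by auto
  show "s i \<in> lin_span A {s i}" by (rule lin_span.base) simp
  fix x y assume "x \<in> units_upto (Suc k)" and y: "y \<in> {s i}"
  then obtain \<alpha> \<gamma> where a: "\<alpha> \<in> words" "\<gamma> \<in> words" "length \<gamma> \<le> Suc k" "x = unit \<alpha> \<gamma>"
    unfolding units_upto_def by blast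
  show "x \<otimes> y \<in> lin_span A (units_upto k)"
  proof (cases \<gamma>)
    case Nil
    then have "x \<otimes> y = unit (\<alpha> @ [i]) []" using a y i by (simp add: word_snoc)
    then show ?thesis using unit_in_units_upto[of "\<alpha> @ [i]" "[]" k] a i by (simp add: lin_span.base)
  next
    case (Cons j \<nu>)
    have "x \<otimes> y = w \<alpha> \<otimes> star A (star A (s i) \<otimes> w \<gamma>)"
      using a y i by (simp add: m_assoc star_mult star_star)
    also have "\<dots> = (if j = i then unit \<alpha> \<nu> else \<zero>)"
      using a i by (simp add: Cons star_gen_word)
    finally show ?thesis
      using a Cons unit_in_units_upto[of \<alpha> \<nu> k] by (simp add: lin_span.base lin_span.zero)
  qed
qed

lemma omega_pos_upto: "x \<in> lin_span A (units_upto k) \<Longrightarrow> \<omega> (star A x \<otimes> x) \<in> \<real>\<^sub>\<ge>\<^sub>0"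
proof (induction k arbitrary: x)
  case 0
  have "units_upto 0 \<subseteq> w ` words" by (auto simp: units_upto_def)
  then show ?case using 0 lin_span_mono omega_pos_words by blast
next
  case (Suc k)
  have xc: "x \<in> carrier A" using lin_span_carrier[OF units_upto_closed Suc.prems] .
  have "\<omega> (star A x \<otimes> x) = \<omega> (\<Phi> (star A x \<otimes> x))" using xc by (simp add: omega_Phi)
  also have "\<dots> = (\<Sum>i=1..d. complex_of_real (p i) * \<omega> (star A (s i) \<otimes> (star A x \<otimes> x) \<otimes> s i))"
    unfolding \<Phi>_def using xc
    by (intro linear_functional_finsum) (auto simp: omega_add omega_smult)
  also have "\<dots> \<in> \<real>\<^sub>\<ge>\<^sub>0"
  proof (rule sum_nonneg_Reals)
    fix i assume i: "i \<in> {1..d}"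
    have "star A (s i) \<otimes> (star A x \<otimes> x) \<otimes> s i = star A (x \<otimes> s i) \<otimes> (x \<otimes> s i)"
      using i xc by (simp add: star_mult m_assoc)
    moreover have "\<omega> (star A (x \<otimes> s i) \<otimes> (x \<otimes> s i)) \<in> \<real>\<^sub>\<ge>\<^sub>0"
      using Suc.IH units_upto_mult_gen[OF Suc.prems i] by blast
    moreover have "complex_of_real (p i) \<in> \<real>\<^sub>\<ge>\<^sub>0" using p_pos[of i] by simp
    ultimately show "complex_of_real (p i) * \<omega> (star A (s i) \<otimes> (star A x \<otimes> x) \<otimes> s i) \<in> \<real>\<^sub>\<ge>\<^sub>0"
      by simp
  qed
  finally show ?case .
qed

lemma span_units_upto: "x \<in> lin_span A units \<Longrightarrow> \<exists>k. x \<in> lin_span A (units_upto k)"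
proof (induction rule: lin_span.induct)
  case zero
  show ?case by (intro exI[of _ 0] lin_span.zero)
next
  case (base x)
  then obtain \<alpha> \<gamma> where x: "\<alpha> \<in> words" "\<gamma> \<in> words" "x = unit \<alpha> \<gamma>" unfolding units_def by blast
  show ?case unfolding x(3)
    by (rule exI[of _ "length \<gamma>"], rule lin_span.base, rule unit_in_units_upto) (use x in auto)
next
  case (add x y)
  then obtain k l where kl: "x \<in> lin_span A (units_upto k)" "y \<in> lin_span A (units_upto l)" by blast
  have "units_upto k \<subseteq> units_upto (max k l)" "units_upto l \<subseteq> units_upto (max k l)"
    by (force simp: units_upto_def)+
  from this[THEN lin_span_mono, of A]
  have "x \<in> lin_span A (units_upto (max k l))" "y \<in> lin_span A (units_upto (max k l))"
    using kl by auto
  then show ?case by (intro exI[of _ "max k l"] lin_span.add)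
next
  case (smult x c)
  then obtain k where "x \<in> lin_span A (units_upto k)" by blast
  then show ?case by (intro exI[of _ k] lin_span.smult)
qed

lemma omega_pos:
  assumes x: "x \<in> carrier A" shows "\<omega> (star A x \<otimes> x) \<in> \<real>\<^sub>\<ge>\<^sub>0"
proof -
  have "\<exists>y. y \<in> lin_span A units \<and> nrm A (x \<ominus> y) < 1 / Suc k" for k
    using span_units_dense[OF generated x, of "1 / Suc k"] by auto
  then obtain y where y: "\<And>k. y k \<in> lin_span A units" "\<And>k. nrm A (x \<ominus> y k) < 1 / Suc k" by metis
  have yc: "y k \<in> carrier A" for k using y lin_span_carrier[OF units_closed] by blast
  have lim: "(\<lambda>k. \<omega> (star A (y k) \<otimes> y k)) \<longlonglongrightarrow> \<omega> (star A x \<otimes> x)"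
  proof (rule Lim_null_comparison[THEN LIM_zero_cancel])
    \<comment> \<open>The sum of the bounds \<open>nrm A x + 1\<close> for \<open>y k\<close> and
      \<open>nrm A x\<close> for \<open>x\<close> in the two terms of the difference.\<close>
    let ?K = "2 * nrm A x + 1"
    have "norm (\<omega> (star A (y k) \<otimes> y k) - \<omega> (star A x \<otimes> x)) \<le> ?K * (1 / Suc k)" for k
    proof -
      define e where "e = nrm A (y k \<ominus> x)"
      have e: "e < 1 / Suc k" using y(2)[of k] nrm_diff_commute[OF x yc[of k]] by (simp add: e_def)
      also have "\<dots> \<le> 1" by simp
      finally have ny: "nrm A (y k) \<le> nrm A x + 1"
        using nrm_le_add_diff[OF yc[of k] x] by (simp add: e_def)
      have "star A (y k) \<otimes> y k \<ominus> star A x \<otimes> x =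
          star A (y k \<ominus> x) \<otimes> y k \<oplus> star A x \<otimes> (y k \<ominus> x)"
        using x yc[of k] by (simp add: star_diff diff_mult_left diff_mult_right diff_add_diff)
      moreover have "nrm A (star A (y k \<ominus> x) \<otimes> y k) \<le> e * (nrm A x + 1)"
        using x yc[of k] ny by (intro nrm_mult_le) (auto simp: e_def)
      moreover have "nrm A (star A x \<otimes> (y k \<ominus> x)) \<le> nrm A x * e"
        using x yc[of k] by (intro nrm_mult_le) (auto simp: e_def)
      ultimately have "nrm A (star A (y k) \<otimes> y k \<ominus> star A x \<otimes> x) \<le> ?K * e"
        using nrm_triangle[of "star A (y k \<ominus> x) \<otimes> y k" "star A x \<otimes> (y k \<ominus> x)"] x yc[of k]
        by (simp add: algebra_simps)
      also have "\<dots> \<le> ?K * (1 / Suc k)"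
        using e nrm_nonneg[OF x] by (intro mult_left_mono) auto
      finally show ?thesis using omega_diff_le[of "star A (y k) \<otimes> y k" "star A x \<otimes> x"] x yc[of k] by simp
    qed
    then show "\<forall>\<^sub>F k in sequentially. norm (\<omega> (star A (y k) \<otimes> y k) - \<omega> (star A x \<otimes> x)) \<le> ?K * (1 / Suc k)"
      by simp
    show "(\<lambda>k. ?K * (1 / Suc k)) \<longlonglongrightarrow> 0"
      using tendsto_mult_left[OF LIMSEQ_inverse_real_of_nat, of ?K] by (simp add: inverse_eq_divide)
  qed
  have pos: "\<omega> (star A (y k) \<otimes> y k) \<in> \<real>\<^sub>\<ge>\<^sub>0" for k
    using span_units_upto[OF y(1)] omega_pos_upto by blast
  show ?thesis by (rule closed_sequentially[OF closed_nonneg_Reals_complex pos lim])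
qed

lemma omega_state: "state A \<omega>"
  unfolding state_def
  using omega_add omega_smult omega_pos omega_one by (simp add: \<omega>_def)

lemma cuntz_state_omega: "cuntz_state d A s p \<omega>"
  unfolding cuntz_state_def using omega_state omega_unit by (auto simp: words_def)

end

section \<open>Traces\<close>

lemma (in cstar_algebra) states_eq_on_span:
  assumes \<phi>: "state A \<phi>" and \<psi>: "state A \<psi>" and G: "G \<subseteq> carrier A"
    and eq: "\<And>x. x \<in> G \<Longrightarrow> \<phi> x = \<psi> x" and x: "x \<in> lin_span A G"
  shows "\<phi> x = \<psi> x"
  using x
proof induction
  case (add x y)
  then show ?case
    using lin_span_carrier[OF G] by (simp add: state_add[OF \<phi>] state_add[OF \<psi>])
next
  case (smult x c)
  then show ?case
    using lin_span_carrier[OF G] by (simp add: state_smult[OF \<phi>] state_smult[OF \<psi>])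
qed (simp_all add: eq state_zero[OF \<phi>] state_zero[OF \<psi>])

lemma (in cstar_algebra) state_diff_le:
  assumes "state A \<phi>" "x \<in> carrier A" "y \<in> carrier A"
  shows "cmod (\<phi> x - \<phi> y) \<le> 1 * nrm A (x \<ominus> y)"
  using state_nrm_le[OF assms(1), of "x \<ominus> y"] assms by (simp add: state_diff)

lemma (in cstar_algebra) states_eqI:
  assumes \<phi>: "state A \<phi>" and \<psi>: "state A \<psi>" and B: "B \<subseteq> carrier A"
    and dense: "\<And>x e. x \<in> carrier A \<Longrightarrow> 0 < e \<Longrightarrow> \<exists>y\<in>B. nrm A (x \<ominus> y) < e"
    and eq: "\<And>x. x \<in> B \<Longrightarrow> \<phi> x = \<psi> x"
  shows "\<phi> = \<psi>"
proof (rule extensionalityI)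
  show "\<phi> \<in> extensional (carrier A)" "\<psi> \<in> extensional (carrier A)"
    using \<phi> \<psi> by (auto simp: state_def)
  fix x assume x: "x \<in> carrier A"
  show "\<phi> x = \<psi> x"
    by (rule eq_on_dense[OF B dense[OF x] x eq state_diff_le[OF \<phi> x] state_diff_le[OF \<psi> x]])
qed

context cuntz_kms
begin

section \<open>The trace given by \<open>\<omega>\<close>\<close>

lemma prod_p: "(\<Prod>i\<leftarrow>\<alpha>. p i) = exp (- \<beta> * real (weight \<alpha>))"
  by (induction \<alpha>) (auto simp: p_def algebra_simps simp flip: exp_add)

lemma cuntz_state_unique:
  assumes "cuntz_state d A s p \<phi>" shows "\<phi> = \<omega>"
proof (rule states_eqI)
  show \<phi>: "state A \<phi>" using assms by (simp add: cuntz_state_def)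
  show \<omega>: "state A \<omega>" by (rule omega_state)
  show "lin_span A units \<subseteq> carrier A" using lin_span_carrier[OF units_closed] by blast
  show "\<exists>y\<in>lin_span A units. nrm A (x \<ominus> y) < e" if "x \<in> carrier A" "0 < e" for x e
    using span_units_dense[OF generated that] by blast
  have "\<phi> u = \<omega> u" if "u \<in> units" for u
  proof -
    obtain \<alpha> \<gamma> where "\<alpha> \<in> words" "\<gamma> \<in> words" "u = unit \<alpha> \<gamma>" using \<open>u \<in> units\<close> unfolding units_def by blast
    then show ?thesis using assms omega_unit[of \<alpha> \<gamma>] by (simp add: cuntz_state_def words_def)
  qed
  then show "\<phi> x = \<omega> x" if "x \<in> lin_span A units" for x
    using states_eq_on_span[OF \<phi> \<omega> units_closed _ that] by blast
qed

text \<open>Both sides vanish unless the inner and the outer words match. Then they are the weights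
  of \<open>\<alpha>\<close> and \<open>\<mu>\<close> under \<open>p\<close>, which agree because
  the product of the \<open>p i\<close> along a word depends on its weight only.\<close>

lemma omega_trace_units:
  assumes x: "x \<in> block_units n" and y: "y \<in> block_units n"
  shows "\<omega> (x \<otimes> y) = \<omega> (y \<otimes> x)"
proof -
  obtain \<alpha> \<gamma> where a: "\<alpha> \<in> stop n" "\<gamma> \<in> stop n" "weight \<alpha> = weight \<gamma>" "x = unit \<alpha> \<gamma>"
    using x by (rule block_unitsE)
  obtain \<mu> \<nu> where m: "\<mu> \<in> stop n" "\<nu> \<in> stop n" "weight \<mu> = weight \<nu>" "y = unit \<mu> \<nu>"
    using y by (rule block_unitsE)
  have "x \<otimes> y = (if \<gamma> = \<mu> then unit \<alpha> \<nu> else \<zero>)" "y \<otimes> x = (if \<nu> = \<alpha> then unit \<mu> \<gamma> else \<zero>)"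
    using a m by (simp_all only: unit_mult_unit_stop stop_words)
  then show ?thesis using a m stop_words by (auto simp: omega_unit omega_zero prod_p)
qed

lemma omega_trace_block:
  assumes x: "x \<in> block n" and y: "y \<in> block n"
  shows "\<omega> (x \<otimes> y) = \<omega> (y \<otimes> x)"
proof -
  note bc = lin_span_carrier[OF block_units_closed]
  have 1: "\<omega> (u \<otimes> y) = \<omega> (y \<otimes> u)" if u: "u \<in> block_units n" for u
  proof -
    have uc: "u \<in> carrier A" using u block_units_closed by blast
    show ?thesis using y unfolding block_def
    proof induction
      case (add v z)
      then show ?case using uc bc[of v] bc[of z] by (simp add: l_distr r_distr omega_add)
    next
      case (smult v c)
      then show ?case using uc bc[of v] by (simp add: smult_mult_left smult_mult_right omega_smult)
    qed (use u uc omega_trace_units in auto)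
  qed
  have yc: "y \<in> carrier A" using y by (rule block_carrier)
  show ?thesis using x unfolding block_def
  proof induction
    case (add v z)
    then show ?case using yc bc[of v] bc[of z] by (simp add: l_distr r_distr omega_add)
  next
    case (smult v c)
    then show ?case using yc bc[of v] by (simp add: smult_mult_left smult_mult_right omega_smult)
  qed (use yc 1 in auto)
qed

text \<open>Multiplication by a given element on either side is Lipschitz, so the identity extends
  from \<open>blocks\<close> to its closure in one variable after the other.\<close>

lemma omega_trace:
  assumes x: "x \<in> fixed" and y: "y \<in> fixed"
  shows "\<omega> (x \<otimes> y) = \<omega> (y \<otimes> x)"
proof -
  have Bc: "blocks \<subseteq> carrier A" using block_carrier by (auto simp: blocks_def)
  have 0: "\<omega> (u \<otimes> v) = \<omega> (v \<otimes> u)" if uv: "u \<in> blocks" "v \<in> blocks" for u v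
  proof -
    obtain m n where "u \<in> block m" "v \<in> block n" using uv by (auto simp: blocks_def)
    then have "u \<in> block (max m n)" "v \<in> block (max m n)"
      using block_mono[of m "max m n"] block_mono[of n "max m n"] by auto
    then show ?thesis by (rule omega_trace_block)
  qed
  have l: "cmod (\<omega> (z \<otimes> v) - \<omega> (z' \<otimes> v)) \<le> nrm A v * nrm A (z \<ominus> z')"
    and r: "cmod (\<omega> (v \<otimes> z) - \<omega> (v \<otimes> z')) \<le> nrm A v * nrm A (z \<ominus> z')"
    if "v \<in> carrier A" "z \<in> carrier A" "z' \<in> carrier A" for v z z'
    using omega_diff_le[of "z \<otimes> v" "z' \<otimes> v"] omega_diff_le[of "v \<otimes> z" "v \<otimes> z'"] that
      nrm_mult[of "z \<ominus> z'" v] nrm_mult[of v "z \<ominus> z'"]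
    by (simp_all add: diff_mult_left diff_mult_right mult.commute)
  have 1: "\<omega> (z \<otimes> v) = \<omega> (v \<otimes> z)" if v: "v \<in> carrier A" and z: "z \<in> fixed"
    and eq: "\<And>u. u \<in> blocks \<Longrightarrow> \<omega> (u \<otimes> v) = \<omega> (v \<otimes> u)" for v z
    by (rule eq_on_dense[where f = "\<lambda>z. \<omega> (z \<otimes> v)" and g = "\<lambda>z. \<omega> (v \<otimes> z)",
          OF Bc blocks_dense[OF z] fixed_carrier[OF z] eq l[OF v fixed_carrier[OF z]]
            r[OF v fixed_carrier[OF z]]])
  have xc: "x \<in> carrier A" "y \<in> carrier A" using x y fixed_carrier by auto
  have 2: "\<omega> (u \<otimes> y) = \<omega> (y \<otimes> u)" if u: "u \<in> blocks" for u
    using 1[of u y, OF _ y 0[OF _ u]] u Bc by (metis subsetD)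
  show ?thesis by (rule 1[OF xc(2) x 2])
qed

lemma trace_state_omega: "trace_state (A\<lparr>carrier := fixed\<rparr>) (restrict \<omega> fixed)"
proof -
  note F = fixed_star_subalgebra[unfolded star_subalgebra_def]
  have "state (A\<lparr>carrier := fixed\<rparr>) (restrict \<omega> fixed)"
    unfolding state_def
    using F fixed_carrier one_fixed by (auto simp: omega_add omega_smult omega_pos omega_one)
  then show ?thesis
    unfolding trace_state_def using F omega_trace by auto
qed

text \<open>The values \<open>\<tau> (s\<^sub>\<alpha> s\<^sub>\<alpha>\<^sup>*)\<close> of a trace depend on the weight of \<open>\<alpha>\<close> only; multiplied by
  \<open>exp (\<beta> weight)\<close>, they form a nonnegative harmonic function of the weight.\<close>

lemma trace_unit_diagonal:
  assumes \<tau>: "trace_state (A\<lparr>carrier := fixed\<rparr>) \<tau>" and a0: "\<alpha> \<in> words"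
  shows "\<tau> (unit \<alpha> \<alpha>) = complex_of_real (exp (- \<beta> * real (weight \<alpha>)))"
proof -
  interpret Fx: cstar_algebra "A\<lparr>carrier := fixed\<rparr>" by (rule cstar_fixed)
  have st: "state (A\<lparr>carrier := fixed\<rparr>) \<tau>" using \<tau> by (simp add: trace_state_def)
  note F = fixed_star_subalgebra[unfolded star_subalgebra_def]
  have tr: "\<tau> (x \<otimes> y) = \<tau> (y \<otimes> x)" if "x \<in> fixed" "y \<in> fixed" for x y
    using \<tau> that by (simp add: trace_state_def)
  define t where "t \<alpha> = Re (\<tau> (unit \<alpha> \<alpha>))" for \<alpha>
  have pos: "\<tau> (unit \<alpha> \<alpha>) \<in> \<real>\<^sub>\<ge>\<^sub>0" if a: "\<alpha> \<in> words" for \<alpha>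
  proof -
    have "star A (unit \<alpha> \<alpha>) \<otimes> unit \<alpha> \<alpha> = unit \<alpha> \<alpha>"
      using a by (simp only: star_unit unit_mult_unit_same)
    then show ?thesis using Fx.state_pos[OF st, of "unit \<alpha> \<alpha>"] unit_fixed[OF a a] by simp
  qed
  then have \<tau>t: "\<tau> (unit \<alpha> \<alpha>) = complex_of_real (t \<alpha>)" and t0: "0 \<le> t \<alpha>" if "\<alpha> \<in> words" for \<alpha>
    using that by (auto simp: t_def complex_nonneg_Reals_iff complex_eq_iff)
  have t_eq: "t \<alpha> = t \<gamma>" if w: "\<alpha> \<in> words" "\<gamma> \<in> words" "weight \<alpha> = weight \<gamma>" for \<alpha> \<gamma>
  proof -
    \<comment> \<open>\<open>unit \<alpha> \<gamma>\<close> is a partial isometry between the two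
      projections, and it is fixed because the weights agree.\<close>
    have "\<tau> (unit \<alpha> \<gamma> \<otimes> unit \<gamma> \<alpha>) = \<tau> (unit \<gamma> \<alpha> \<otimes> unit \<alpha> \<gamma>)"
      using w by (intro tr unit_fixed) auto
    then show ?thesis using w by (simp only: unit_mult_unit_same t_def)
  qed
  have t_sum: "t \<alpha> = (\<Sum>i=1..d. t (\<alpha> @ [i]))" if a: "\<alpha> \<in> words" for \<alpha>
  proof -
    \<comment> \<open>\<open>\<tau>\<close> is additive on \<open>fixed\<close> only, so membership
      of the partial sums is carried through the induction.\<close>
    have fin: "\<tau> (finsum A f I) = (\<Sum>i\<in>I. \<tau> (f i)) \<and> finsum A f I \<in> fixed"
      if "finite I" "\<And>i. i \<in> I \<Longrightarrow> f i \<in> fixed" for f and I :: "nat set"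
      using that
    proof (induction I)
      case empty
      then show ?case using Fx.state_zero[OF st] F by simp
    next
      case (insert i I)
      then have "finsum A f (insert i I) = f i \<oplus> finsum A f I"
        using fixed_carrier by (intro finsum_insert) auto
      then show ?case using insert F Fx.state_add[OF st, of "f i" "finsum A f I"] by simp
    qed
    have "\<tau> (unit \<alpha> \<alpha>) = \<tau> (\<Oplus>i\<in>{1..d}. unit (\<alpha> @ [i]) (\<alpha> @ [i]))"
      using a unit_eq_finsum[of \<alpha> \<alpha>] by simp
    also have "\<dots> = (\<Sum>i=1..d. \<tau> (unit (\<alpha> @ [i]) (\<alpha> @ [i])))"
      using a by (intro fin[THEN conjunct1] unit_fixed) auto
    finally show ?thesis by (simp add: t_def)
  qed
  \<comment> \<open>Small integers may fail to be weights, so the function of the weight is set up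
    from \<open>N\<close> on; by \<open>t_eq\<close> the choice of the representatives
    \<open>\<kappa>\<close> is immaterial.\<close>
  obtain N where N: "\<And>n. N \<le> n \<Longrightarrow> \<exists>\<kappa>\<in>words. weight \<kappa> = n"
    by (rule words_of_large_weight) blast
  then obtain \<kappa> where \<kappa>: "\<And>n. N \<le> n \<Longrightarrow> \<kappa> n \<in> words" "\<And>n. N \<le> n \<Longrightarrow> weight (\<kappa> n) = n" by metis
  \<comment> \<open>The exponential is the reciprocal of the expected value of \<open>t\<close>, so
    the expected \<open>h\<close> is constantly 1.\<close>
  define h where "h m = exp (\<beta> * real (N + m)) * t (\<kappa> (N + m))" for m
  have har: "h m = (\<Sum>i=1..d. p i * h (m + L i))" for m
  proof -
    have "h m = (\<Sum>i=1..d. exp (\<beta> * real (N + m)) * t (\<kappa> (N + m) @ [i]))"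
      unfolding h_def using \<kappa> by (subst t_sum) (auto simp: sum_distrib_left)
    also have "\<dots> = (\<Sum>i=1..d. p i * h (m + L i))"
    proof (intro sum.cong refl)
      fix i assume i: "i \<in> {1..d}"
      have "t (\<kappa> (N + m) @ [i]) = t (\<kappa> (N + (m + L i)))"
        using \<kappa>[of "N + m"] \<kappa>[of "N + (m + L i)"] i by (intro t_eq) auto
      moreover have "exp (\<beta> * real (N + m)) = p i * exp (\<beta> * real (N + (m + L i)))"
        by (simp add: p_def algebra_simps flip: exp_add)
      ultimately show "exp (\<beta> * real (N + m)) * t (\<kappa> (N + m) @ [i]) = p i * h (m + L i)"
        by (simp add: h_def)
    qed
    finally show ?thesis .
  qed
  have h0: "0 \<le> h m" for m using \<kappa>(1)[of "N + m"] t0 by (simp add: h_def)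
  have const: "h m = h 0" for m
    by (rule nonneg_harmonic_const[of "{1..d}" p L, OF _ p_pos sum_p_1 weight_pos gcd_weights h0 har]) auto
  \<comment> \<open>Words lighter than \<open>N\<close> are reached by downward induction through
    \<open>t_sum\<close>, since appending a letter raises the weight.\<close>
  have diag: "t \<alpha> = h 0 * exp (- \<beta> * real (weight \<alpha>))" if "\<alpha> \<in> words" for \<alpha>
    using that
  proof (induction "N - weight \<alpha>" arbitrary: \<alpha> rule: less_induct)
    case less
    show ?case
    proof (cases "N \<le> weight \<alpha>")
      case True
      then have "t \<alpha> = t (\<kappa> (weight \<alpha>))" using less.prems \<kappa> by (intro t_eq) auto
      moreover have "h 0 = exp (\<beta> * real (weight \<alpha>)) * t (\<kappa> (weight \<alpha>))"
        using const[of "weight \<alpha> - N"] True by (simp add: h_def)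
      ultimately show ?thesis by (simp add: exp_minus)
    next
      case False
      have "t \<alpha> = (\<Sum>i=1..d. t (\<alpha> @ [i]))" using less.prems by (rule t_sum)
      also have "\<dots> = (\<Sum>i=1..d. (h 0 * exp (- \<beta> * real (weight \<alpha>))) * p i)"
      proof (intro sum.cong refl)
        fix i assume i: "i \<in> {1..d}"
        have "t (\<alpha> @ [i]) = h 0 * exp (- \<beta> * real (weight (\<alpha> @ [i])))"
          using less.prems i False weight_pos[OF i] by (intro less.hyps) auto
        then show "t (\<alpha> @ [i]) = (h 0 * exp (- \<beta> * real (weight \<alpha>))) * p i"
          by (simp add: p_def algebra_simps exp_add[symmetric])
      qed
      also have "\<dots> = h 0 * exp (- \<beta> * real (weight \<alpha>))"
        using sum_p_1 by (simp flip: sum_distrib_left)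
      finally show ?thesis .
    qed
  qed
  \<comment> \<open>The empty word fixes the remaining constant, as its unit is
    \<open>\<one>\<close>.\<close>
  have "\<tau> (unit [] []) = 1" using Fx.state_one[OF st] by simp
  then have "h 0 = 1" using diag[of "[]"] by (simp add: t_def)
  then show ?thesis using \<tau>t[OF a0] diag[OF a0] by simp
qed

lemma trace_state_unique:
  assumes \<tau>: "trace_state (A\<lparr>carrier := fixed\<rparr>) \<tau>"
  shows "\<tau> = restrict \<omega> fixed"
proof -
  interpret Fx: cstar_algebra "A\<lparr>carrier := fixed\<rparr>" by (rule cstar_fixed)
  have st: "state (A\<lparr>carrier := fixed\<rparr>) \<tau>" using \<tau> by (simp add: trace_state_def)
  have so: "state (A\<lparr>carrier := fixed\<rparr>) (restrict \<omega> fixed)"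
    using trace_state_omega by (simp add: trace_state_def)
  have units: "\<tau> x = restrict \<omega> fixed x" if x: "x \<in> block_units n" for x n
  proof -
    obtain \<alpha> \<gamma> where a: "\<alpha> \<in> stop n" "\<gamma> \<in> stop n" "weight \<alpha> = weight \<gamma>" "x = unit \<alpha> \<gamma>"
      using x by (rule block_unitsE)
    have aw: "\<alpha> \<in> words" "\<gamma> \<in> words" using a stop_words by auto
    have "\<tau> x = (if \<alpha> = \<gamma> then complex_of_real (exp (- \<beta> * real (weight \<alpha>))) else 0)"
    proof (cases "\<alpha> = \<gamma>")
      case True
      then show ?thesis using trace_unit_diagonal[OF \<tau> aw(1)] a by simp
    next
      case False
      \<comment> \<open>Off-diagonal units are killed by the trace: one order of the product
        reproduces the unit, the other is \<open>\<zero>\<close> by prefix-freeness.\<close>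
      have "\<tau> (unit \<alpha> \<alpha> \<otimes> unit \<alpha> \<gamma>) = \<tau> (unit \<alpha> \<gamma> \<otimes> unit \<alpha> \<alpha>)"
        using \<tau> unit_fixed[OF aw a(3)] unit_fixed[OF aw(1,1)] by (simp add: trace_state_def)
      moreover have "unit \<alpha> \<alpha> \<otimes> unit \<alpha> \<gamma> = unit \<alpha> \<gamma>" using aw by (simp only: unit_mult_unit_same)
      moreover have "unit \<alpha> \<gamma> \<otimes> unit \<alpha> \<alpha> = \<zero>"
        using False a aw by (simp only: unit_mult_unit_stop) simp
      ultimately show ?thesis using a False Fx.state_zero[OF st] by simp
    qed
    then show ?thesis using a aw unit_fixed[OF aw a(3)] by (simp add: omega_unit prod_p)
  qed
  show ?thesis
  proof (rule Fx.states_eqI[OF st so, of blocks])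
    show "blocks \<subseteq> carrier (A\<lparr>carrier := fixed\<rparr>)" using block_fixed by (auto simp: blocks_def)
    show "\<exists>y\<in>blocks. nrm (A\<lparr>carrier := fixed\<rparr>) (x \<ominus>\<^bsub>A\<lparr>carrier := fixed\<rparr>\<^esub> y) < e"
      if "x \<in> carrier (A\<lparr>carrier := fixed\<rparr>)" "0 < e" for x e
    proof -
      obtain y where y: "y \<in> blocks" "nrm A (x \<ominus> y) < e" using blocks_dense[of x e] \<open>0 < e\<close> \<open>x \<in> _\<close> by auto
      then have "y \<in> fixed" using block_fixed by (auto simp: blocks_def)
      then show ?thesis using y \<open>x \<in> _\<close> by (intro bexI[of _ y]) (auto simp: fixed_minus)
    qed
    fix x assume "x \<in> blocks"
    then obtain n where x: "x \<in> lin_span (A\<lparr>carrier := fixed\<rparr>) (block_units n)"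
      by (auto simp: blocks_def block_def lin_span_carrier_update)
    have "block_units n \<subseteq> fixed"
      using block_units_subset block_fixed by (rule order_trans)
    then show "\<tau> x = restrict \<omega> fixed x"
      by (intro Fx.states_eq_on_span[OF st so _ units x]) auto
  qed
qed

end

theorem theorem4p2:
  fixes d :: nat
    and L :: "nat \<Rightarrow> nat"
    and A :: "'a cstar_alg"
    and s :: "nat \<Rightarrow> 'a"
    and \<sigma> :: "real \<Rightarrow> 'a \<Rightarrow> 'a"
  assumes "2 \<le> d"
    and "\<forall>i\<in>{1..d}. 0 < L i"
    and "mono_on {1..d} L"
    and "Gcd (L ` {1..d}) = 1"
    and "cuntz_algebra d A s"
    and "one_parameter_automorphism_group A \<sigma>"
    and "\<forall>t. \<forall>j\<in>{1..d}. \<sigma> t (s j) = exp (\<i> * complex_of_real (t * real (L j))) \<odot>\<^bsub>A\<^esub> s j"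
  shows "simple_cstar_algebra (fixed_point_algebra A \<sigma>) \<and>
    AF_algebra (fixed_point_algebra A \<sigma>) \<and>
    (\<exists>!\<tau>. trace_state (fixed_point_algebra A \<sigma>) \<tau>) \<and>
    (\<exists>!\<beta>::real. 0 < \<beta> \<and> (\<Sum>i=1..d. exp (- \<beta> * real (L i))) = 1) \<and>
    (\<forall>\<beta>::real. 0 < \<beta> \<and> (\<Sum>i=1..d. exp (- \<beta> * real (L i))) = 1 \<longrightarrow>
      (\<exists>!\<omega>. cuntz_state d A s (\<lambda>i. exp (- \<beta> * real (L i))) \<omega>) \<and>
      (\<forall>\<omega>. cuntz_state d A s (\<lambda>i. exp (- \<beta> * real (L i))) \<omega> \<longrightarrow>
        trace_state (fixed_point_algebra A \<sigma>)
          (restrict \<omega> (carrier (fixed_point_algebra A \<sigma>)))))"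
proof -
  have cg: "cuntz_gauge A d s L \<sigma>"
    using assms
    by (simp add: cuntz_gauge_def cuntz_gauge_axioms_def weighted_cuntz_family_def
        weighted_cuntz_family_axioms_def cuntz_algebra_def one_parameter_automorphism_group_def)
  then interpret cuntz_gauge A d s L \<sigma> .
  have kms: "cuntz_kms A d s L \<sigma> \<beta>"
    if "0 < \<beta> \<and> (\<Sum>i=1..d. exp (- \<beta> * real (L i))) = 1" for \<beta>
    using that by (simp add: cuntz_kms_def cuntz_kms_axioms_def cg)
  have ex: "\<exists>!\<beta>::real. 0 < \<beta> \<and> (\<Sum>i=1..d. exp (- \<beta> * real (L i))) = 1"
    using assms by (intro exp_sum_eq_1_ex1) auto
  \<comment> \<open>Outside the locale the weights take \<open>L\<close> and \<open>\<beta>\<close>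
    as parameters; this identifies them with the expression in the statement.\<close>
  have p: "cuntz_kms.p L \<beta> = (\<lambda>i. exp (- \<beta> * real (L i)))"
    if "0 < \<beta> \<and> (\<Sum>i=1..d. exp (- \<beta> * real (L i))) = 1" for \<beta>
    using cuntz_kms.p_def[OF kms[OF that]] by blast
  \<comment> \<open>The claim does not involve \<open>\<beta>\<close>, so one root is picked in
    order to construct the trace.\<close>
  have trace: "\<exists>!\<tau>. trace_state (A\<lparr>carrier := fixed\<rparr>) \<tau>"
  proof -
    obtain \<beta> where "0 < \<beta> \<and> (\<Sum>i=1..d. exp (- \<beta> * real (L i))) = 1" using ex by blast
    then interpret cuntz_kms A d s L \<sigma> \<beta> by (rule kms)
    show ?thesis using trace_state_omega trace_state_unique by blast
  qed
  have "(\<exists>!\<omega>. cuntz_state d A s (\<lambda>i. exp (- \<beta> * real (L i))) \<omega>) \<and>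
      (\<forall>\<omega>. cuntz_state d A s (\<lambda>i. exp (- \<beta> * real (L i))) \<omega> \<longrightarrow>
        trace_state (A\<lparr>carrier := fixed\<rparr>) (restrict \<omega> fixed))"
    if \<beta>: "0 < \<beta> \<and> (\<Sum>i=1..d. exp (- \<beta> * real (L i))) = 1" for \<beta>
  proof -
    interpret cuntz_kms A d s L \<sigma> \<beta> by (rule kms[OF \<beta>])
    show ?thesis
      using cuntz_state_omega cuntz_state_unique trace_state_omega unfolding p[OF \<beta>] by blast
  qed
  then show ?thesis
    using simple_fixed AF_fixed trace ex by (simp add: fixed_point_algebra_eq)
qed

end
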